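(* Let $0<\alpha\le\beta<\infty$. (i) For every $w\in A_r$, $1\le r<\infty$, there holds $$\|\mathcal{A}^{\beta}F\|_{L^p(w)}\le C\Big(\frac{\beta}{\alpha}\Big)^{\frac{nr}{p}}\|\mathcal{A}^{\alpha}F\|_{L^p(w)}\qquad\text{for all }0<p\le 2r.$$ (ii) For every $w\in RH_{s'}$, $1\le s<\infty$, there holds $$\|\mathcal{A}^{\alpha}F\|_{L^p(w)}\le C\Big(\frac{\alpha}{\beta}\Big)^{\frac{n}{sp}}\|\mathcal{A}^{\beta}F\|_{L^p(w)}\qquad\text{for all }\frac2s\le p<\infty.$$ Here $F$ is an arbitrary measurable function on $\mathbb{R}^{n+1}_+$ and the constants $C$ do not depend on $\alpha$, $\beta$ or $F$.
   Context: $\mathbb{R}^{n+1}_+=\{(y,t):y\in\mathbb{R}^n,\ t>0\}$. For $\alpha>0$ and $x\in\mathbb{R}^n$, $\Gamma^\alpha(x)=\{(y,t)\in\mathbb{R}^{n+1}_+:|x-y|<\alpha t\}$ and $$\mathcal{A}^\alpha F(x)=\Big(\iint_{\Gamma^\alpha(x)}|F(y,t)|^2\frac{dy\,dt}{t^{n+1}}\Big)^{1/2}.$$ A weight is a positive locally integrable function on $\mathbb{R}^n$; $A_r$ ($1\le r<\infty$) are the usual Muckenhoupt classes and $RH_{q}$ ($1<q\le\infty$) the usual reverse Hölder classes, defined with balls; in particular $w\in RH_\infty$ means that there is $C$ with $w(y)\le C\frac1{|B|}\int_Bw\,dx$ for a.e. $y\in B$ and every ball $B$. $s'=s/(s-1)$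 is the conjugate exponent ($s'=\infty$ if $s=1$). $\|g\|_{L^p(w)}=(\int_{\mathbb{R}^n}|g|^pw\,dx)^{1/p}$. *)

theory Defs
  imports "HOL-Analysis.Analysis"
begin

text \<open>Area functions and weighted norms take values in \<open>[0, \<infinity>]\<close>, so they are rendered in
  \<^typ>\<open>ennreal\<close>. The power below is only meant (and only used) for exponents \<open>a > 0\<close>.\<close>

definition epowr :: "ennreal \<Rightarrow> real \<Rightarrow> ennreal" (infixr "epowr" 80) where
  "x epowr a = (if x = \<infinity> then \<infinity> else ennreal (enn2real x powr a))"

definition upper_half_space :: "((real ^ 'n) \<times> real) set" where
  "upper_half_space = {(y, t). t > 0}"

definition cone :: "real \<Rightarrow> real ^ 'n \<Rightarrow> ((real ^ 'n) \<times> real) set" where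
  "cone \<alpha> x = {(y, t) \<in> upper_half_space. norm (x - y) < \<alpha> * t}"

definition area :: "real \<Rightarrow> ((real ^ 'n) \<times> real \<Rightarrow> complex) \<Rightarrow> real ^ 'n \<Rightarrow> ennreal" where
  "area \<alpha> F x =
     (\<integral>\<^sup>+ z \<in> cone \<alpha> x. ennreal ((cmod (F z))\<^sup>2 / snd z ^ (CARD('n) + 1)) \<partial>lebesgue) epowr (1 / 2)"

text \<open>As usual for functions identified up to null sets, positivity is only required almost
  everywhere; this includes the everywhere positive functions.\<close>

definition weight :: "(real ^ 'n \<Rightarrow> real) \<Rightarrow> bool" where
  "weight w \<longleftrightarrow> (AE x in lebesgue. w x > 0) \<and> (\<forall>K. compact K \<longrightarrow> w absolutely_integrable_on K)"

definition average :: "(real ^ 'n) set \<Rightarrow> (real ^ 'n \<Rightarrow> real) \<Rightarrow> ennreal" where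
  "average B f = (\<integral>\<^sup>+ x \<in> B. ennreal (f x) \<partial>lebesgue) / emeasure lebesgue B"

text \<open>The class \<open>A\<^sub>r\<close> for \<open>1 \<le> r < \<infinity>\<close>; note \<open>1 - r' = - 1 / (r - 1)\<close> for \<open>r > 1\<close>.\<close>

definition Muckenhoupt :: "real \<Rightarrow> (real ^ 'n \<Rightarrow> real) set" where
  "Muckenhoupt r = {w. weight w \<and> (\<exists>C::real. \<forall>c \<rho>. \<rho> > 0 \<longrightarrow>
     (if r = 1
      then AE y in lebesgue. y \<in> ball c \<rho> \<longrightarrow> average (ball c \<rho>) w \<le> ennreal C * ennreal (w y)
      else average (ball c \<rho>) w
             * (average (ball c \<rho>) (\<lambda>x. w x powr (- 1 / (r - 1)))) epowr (r - 1) \<le> ennreal C))}"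

text \<open>The class \<open>RH\<^sub>q\<close> for \<open>1 < q \<le> \<infinity>\<close>.\<close>

definition reverse_Hoelder :: "ereal \<Rightarrow> (real ^ 'n \<Rightarrow> real) set" where
  "reverse_Hoelder q = {w. weight w \<and> (\<exists>C::real. \<forall>c \<rho>. \<rho> > 0 \<longrightarrow>
     (if q = \<infinity>
      then AE y in lebesgue. y \<in> ball c \<rho> \<longrightarrow> ennreal (w y) \<le> ennreal C * average (ball c \<rho>) w
      else (average (ball c \<rho>) (\<lambda>x. w x powr real_of_ereal q)) epowr (1 / real_of_ereal q)
             \<le> ennreal C * average (ball c \<rho>) w))}"

definition conjugate_exponent :: "real \<Rightarrow> ereal" where
  "conjugate_exponent s = (if s = 1 then \<infinity> else ereal (s / (s - 1)))"

definition weighted_Lp_norm :: "real \<Rightarrow> (real ^ 'n \<Rightarrow> real) \<Rightarrow> (real ^ 'n \<Rightarrow> ennreal) \<Rightarrow> ennreal" where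
  "weighted_Lp_norm p w g = (\<integral>\<^sup>+ x. g x epowr p * ennreal (w x) \<partial>lebesgue) epowr (1 / p)"

end

theory Submission
  imports Defs
begin

text \<open>Write \<open>Q\<^sub>\<alpha> = (\<A>\<^sup>\<alpha> F)\<^sup>2\<close> and \<open>q = p / 2\<close>. By Tonelli, \<open>\<integral> Q\<^sub>\<alpha> \<phi> \<le> \<integral> Q\<^sub>\<beta> \<psi>\<close> as soon as
  \<open>\<integral> \<phi> \<le> \<integral> \<psi>\<close> over all pairs of concentric balls with radii \<open>\<alpha> t\<close> and \<open>\<beta> t\<close>. Duality (for
  \<open>q > 1\<close>) and its variational counterpart (for \<open>q < 1\<close>) reduce the \<open>L\<^sup>q\<close> estimates to this situation:
  from a given density \<open>h\<close> on one side one has to construct a density \<open>H\<close> on the other side, satisfying the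
  inequality on balls with a norm bound of the right size in \<open>\<beta> / \<alpha>\<close>. In every case \<open>H\<close> is a supremum over
  the balls containing a point, times a power of \<open>w\<close>, and its norm is controlled by Vitali's covering
  lemma. The endpoints \<open>p = 2 r\<close> and \<open>p = 2 / s\<close> and the exponents between them and \<open>2\<close> are covered
  at once by applying the covering lemma to the measures \<open>w\<^sup>1\<^sup>-\<^sup>r\<^sup>' dx\<close> and \<open>w\<^sup>s\<^sup>' dx\<close> respectively.\<close>

section \<open>Powers in the extended nonnegative reals\<close>

text \<open>The obstacle is the exponent of the aperture ratio. For q > 1 in (i), taking for
  \<open>H\<close> a multiple of the maximal function of \<open>h\<close> with respect to
  \<open>w\<close> costs the mass ratio of the two balls to the power q instead of 1. The remedy is
  a parameter \<open>\<kappa>\<close> in [0, 1]. With \<open>m\<close> the mean of \<open>w\<close>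
  over a ball, \<open>H\<close> is \<open>w powr - \<kappa>\<close> times the supremum of
  \<open>m powr \<kappa>\<close> times the \<open>w\<close>-average of \<open>h\<close>. At q = r
  one has \<open>\<kappa> = 1\<close>, and this is the Lebesgue maximal function of h w divided by
  w, which costs only a volume ratio; as q tends to 1, \<open>\<kappa>\<close> tends to 0 and the
  measure \<open>w\<close> takes over. In (ii) with q < 1 harmonic means replace averages:
  \<open>\<kappa> = 0\<close> is the endpoint q = 1/s, and \<open>\<kappa>\<close> tends to 1 with
  q. In both cases \<open>\<kappa>\<close> is forced by the demand that the change of weight ends in
  \<open>w\<close> again. The remaining ranges, q \<le> 1 in (i) and q \<ge> 1 in (ii), use only the
  masses of concentric balls; r = 1 and s = 1 never leave them.\<close>

lemma epowr_ennreal: "0 \<le> r \<Longrightarrow> ennreal r epowr a = ennreal (r powr a)"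
  by (simp add: epowr_def)

lemma epowr_top [simp]: "top epowr a = top"
  by (simp add: epowr_def)

lemma epowr_zero [simp]: "0 epowr a = 0"
  by (simp add: epowr_def)

lemma epowr_one [simp]: "x epowr 1 = x"
  by (cases x) (simp_all add: epowr_ennreal)

lemma epowr_mono: "0 \<le> a \<Longrightarrow> x \<le> y \<Longrightarrow> x epowr a \<le> y epowr a"
  by (cases x; cases y) (auto simp: epowr_ennreal top_unique intro!: powr_mono2)

lemma epowr_mult: "0 < a \<Longrightarrow> (x * y) epowr a = x epowr a * y epowr a"
proof (cases "x = 0 \<or> y = 0 \<or> x = top \<or> y = top")
  case True
  assume "0 < a"
  then have nz: "z epowr a \<noteq> 0" if "z \<noteq> 0" for z
    using that by (cases z) (simp_all add: epowr_ennreal)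
  from True show ?thesis
    by (elim disjE) (simp_all add: ennreal_top_mult ennreal_mult_top nz)
next
  case False
  then obtain r t where "x = ennreal r" "0 \<le> r" "y = ennreal t" "0 \<le> t"
    by (metis ennreal_cases)
  then show ?thesis
    by (simp add: epowr_ennreal powr_mult ennreal_mult[symmetric])
qed

lemma epowr_epowr: "(x epowr a) epowr b = x epowr (a * b)"
  by (cases x) (auto simp: epowr_ennreal powr_powr)

text \<open>Exponents of either sign are covered, because \<open>0 epowr a = 0\<close> and
  \<open>top epowr a = top\<close> for all real \<open>a\<close>.\<close>

lemma epowr_mult_self: "x epowr (a - 1) * x = x epowr a"
proof (cases x)
  case (real r)
  then show ?thesis
    by (cases "r = 0") (auto simp: epowr_ennreal powr_diff simp flip: ennreal_mult)
qed simp

lemma epowr_measurable [measurable]: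
  assumes [measurable]: "f \<in> borel_measurable M"
  shows "(\<lambda>x. f x epowr a) \<in> borel_measurable M"
  unfolding epowr_def infinity_ennreal_def by measurable

section \<open>Layer-cake formulas and integration of distributional inequalities\<close>

lemma nn_integral_powr_layer:
  assumes "0 < q" "0 \<le> r"
  shows "(\<integral>\<^sup>+l. ennreal (q * l powr (q - 1)) * indicator {0<..<r} l \<partial>lborel) = ennreal (r powr q)"
proof -
  have "((\<lambda>l. l powr (q - 1)) has_integral (r powr (q - 1 + 1) / (q - 1 + 1))) {0..r}"
    using assms by (intro has_integral_powr_from_0) auto
  then have "((\<lambda>l. q * l powr (q - 1)) has_integral (q * (r powr (q - 1 + 1) / (q - 1 + 1)))) {0..r}"
    by (rule has_integral_mult_right)
  then have *: "((\<lambda>l. q * l powr (q - 1)) has_integral r powr q) {0..r}"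
    using assms by simp
  have "(\<integral>\<^sup>+l. ennreal (q * l powr (q - 1)) * indicator {0<..<r} l \<partial>lborel)
    = (\<integral>\<^sup>+l. ennreal (indicator {0..r} l * (q * l powr (q - 1))) \<partial>lborel)"
  proof (rule nn_integral_cong_AE)
    have "AE l in lborel. l \<noteq> 0 \<and> l \<noteq> r"
      using AE_lborel_singleton[of 0] AE_lborel_singleton[of r] by auto
    then show "AE l in lborel. ennreal (q * l powr (q - 1)) * indicator {0<..<r} l
      = ennreal (indicator {0..r} l * (q * l powr (q - 1)))"
      by eventually_elim (auto simp: indicator_def)
  qed
  also have "\<dots> = ennreal (r powr q)"
    using nn_integral_has_integral_lebesgue[OF _ *] assms by (simp add: nn_integral_completion)
  finally show ?thesis .
qed

lemma epowr_layer_cake: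
  assumes "0 < q"
  shows "x epowr q =
    (\<integral>\<^sup>+l. ennreal (q * l powr (q - 1)) * (if 0 < l \<and> ennreal l < x then 1 else 0) \<partial>lborel)"
    (is "_ = ?I x")
proof -
  have fin: "?I (ennreal r) = ennreal (r powr q)" if "0 \<le> r" for r
    unfolding nn_integral_powr_layer[OF assms that, symmetric]
    by (intro nn_integral_cong) (auto simp: indicator_def ennreal_less_iff)
  show ?thesis
  proof (cases x)
    case (real r)
    then show ?thesis using fin by (simp add: epowr_ennreal)
  next
    case top
    have "of_nat n \<le> ?I top" for n
    proof -
      \<comment> \<open>The levels below \<open>n powr (1 / q)\<close> alone contribute n, so the
        integral exceeds every natural number.\<close>
      have "?I (ennreal (real n powr (1 / q))) \<le> ?I top"
        by (intro nn_integral_mono mult_left_mono) auto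
      then show ?thesis
        using assms by (simp add: fin powr_powr ennreal_of_nat_eq_real_of_nat)
    qed
    then have "\<not> ?I top < top"
      using ennreal_Ex_less_of_nat[of "?I top"] by (auto simp: not_less[symmetric])
    then have "?I top = top"
      by (simp add: less_top[symmetric])
    then show ?thesis using top by simp
  qed
qed

text \<open>The additional factor \<open>g\<close> lets the formula be read backwards for products
  such as \<open>?g x epowr (q - 1) * g x\<close>, which arise from truncation.\<close>

lemma nn_integral_epowr_layer_cake:
  assumes "sigma_finite_measure M" "0 < q" and [measurable]: "f \<in> borel_measurable M"
    "g \<in> borel_measurable M"
  shows "(\<integral>\<^sup>+x. f x epowr q * g x \<partial>M) =
    (\<integral>\<^sup>+l. ennreal (q * l powr (q - 1)) * (if 0 < l then (\<integral>\<^sup>+x. (if ennreal l < f x then g x else 0) \<partial>M) else 0) \<partial>lborel)"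
proof -
  interpret sigma_finite_measure M by fact
  interpret pair_sigma_finite M lborel ..
  have "(\<integral>\<^sup>+x. f x epowr q * g x \<partial>M) =
    (\<integral>\<^sup>+x. (\<integral>\<^sup>+l. ennreal (q * l powr (q - 1)) * (if 0 < l \<and> ennreal l < f x then 1 else 0) * g x \<partial>lborel) \<partial>M)"
    by (subst nn_integral_multc) (auto simp: epowr_layer_cake[OF assms(2), symmetric])
  also have "\<dots> = (\<integral>\<^sup>+l. (\<integral>\<^sup>+x. ennreal (q * l powr (q - 1)) * (if 0 < l \<and> ennreal l < f x then 1 else 0) * g x \<partial>M) \<partial>lborel)"
    by (rule Fubini'[symmetric]) measurable
  also have "\<dots> = (\<integral>\<^sup>+l. ennreal (q * l powr (q - 1)) * (if 0 < l then (\<integral>\<^sup>+x. (if ennreal l < f x then g x else 0) \<partial>M) else 0) \<partial>lborel)"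
    by (rule nn_integral_cong) (auto simp: mult.assoc nn_integral_cmult[symmetric] intro!: nn_integral_cong)
  finally show ?thesis .
qed

lemma nn_integral_superlevel:
  assumes [measurable]: "h \<in> borel_measurable M"
  shows "(\<integral>\<^sup>+x. (if c < h x then 1 else 0) \<partial>M) = emeasure M {x \<in> space M. (c::ennreal) < h x}"
proof -
  have "(\<integral>\<^sup>+x. (if c < h x then 1 else 0) \<partial>M) = (\<integral>\<^sup>+x. indicator {x \<in> space M. c < h x} x \<partial>M)"
    by (intro nn_integral_cong) (simp add: indicator_def)
  then show ?thesis by simp
qed

text \<open>Superlevel sets are compared at the proportional levels l and c l; integrating in l
  after rescaling \<open>g\<close> by 1/c produces the factor \<open>c powr - q\<close>. All q > 0
  are allowed, since sets are compared with sets.\<close>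

lemma nn_integral_epowr_le_distribution:
  assumes M: "sigma_finite_measure M" and q: "0 < q" and c: "0 < c"
    and [measurable]: "f \<in> borel_measurable M" "g \<in> borel_measurable M"
    and le: "\<And>l. 0 < l \<Longrightarrow> emeasure M {x \<in> space M. ennreal l < f x}
      \<le> A * emeasure M {x \<in> space M. ennreal (c * l) < g x}"
  shows "(\<integral>\<^sup>+x. f x epowr q \<partial>M) \<le> A * ennreal (c powr - q) * (\<integral>\<^sup>+x. g x epowr q \<partial>M)"
proof -
  let ?g = "\<lambda>x. ennreal (1 / c) * g x"
  have less: "ennreal (c * l) < g x \<longleftrightarrow> ennreal l < ?g x" if "0 < l" for l x
  proof (cases "g x")
    case (real r)
    then show ?thesis using c that by (simp add: ennreal_less_iff field_simps flip: ennreal_mult)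
  qed (use c in \<open>simp add: ennreal_mult_top\<close>)
  have "(\<integral>\<^sup>+x. f x epowr q * 1 \<partial>M) \<le>
    (\<integral>\<^sup>+l. A * (ennreal (q * l powr (q - 1)) * (if 0 < l then (\<integral>\<^sup>+x. (if ennreal l < ?g x then 1 else 0) \<partial>M) else 0)) \<partial>lborel)"
    unfolding nn_integral_epowr_layer_cake[OF M q \<open>f \<in> _\<close> borel_measurable_const]
  proof (rule nn_integral_mono)
    fix l :: real
    show "ennreal (q * l powr (q - 1)) * (if 0 < l then (\<integral>\<^sup>+x. (if ennreal l < f x then 1 else 0) \<partial>M) else 0)
      \<le> A * (ennreal (q * l powr (q - 1)) * (if 0 < l then (\<integral>\<^sup>+x. (if ennreal l < ?g x then 1 else 0) \<partial>M) else 0))"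
    proof (cases "0 < l")
      case True
      have "(\<integral>\<^sup>+x. (if ennreal l < f x then 1 else 0) \<partial>M) \<le> A * (\<integral>\<^sup>+x. (if ennreal l < ?g x then 1 else 0) \<partial>M)"
        using le[OF True] by (simp add: nn_integral_superlevel less[OF True])
      from mult_left_mono[OF this, of "ennreal (q * l powr (q - 1))"] True show ?thesis
        by (simp add: mult_ac)
    qed simp
  qed
  also have "\<dots> = A * (\<integral>\<^sup>+x. ?g x epowr q * 1 \<partial>M)"
  proof -
    interpret sigma_finite_measure M by fact
    show ?thesis
      by (subst nn_integral_epowr_layer_cake[OF M q]) (auto intro!: nn_integral_cmult)
  qed
  also have "\<dots> = A * (ennreal (c powr - q) * (\<integral>\<^sup>+x. g x epowr q \<partial>M))"
    using q c by (simp add: epowr_mult epowr_ennreal nn_integral_cmult powr_minus_divide powr_divide)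
  finally show ?thesis by (simp add: mult.assoc)
qed

text \<open>A version of the Marcinkiewicz interpolation theorem between weak type (1,1) and the
  bound \<open>\<parallel>f\<parallel>\<^sub>\<infinity> \<le> \<kappa> \<parallel>g\<parallel>\<^sub>\<infinity>\<close>, after the usual truncation of \<open>g\<close>.\<close>

lemma nn_integral_epowr_le_truncation:
  assumes M: "sigma_finite_measure M" and q: "1 < q" and \<kappa>: "0 < \<kappa>"
    and [measurable]: "f \<in> borel_measurable M" "g \<in> borel_measurable M"
    and le: "\<And>l. 0 < l \<Longrightarrow> emeasure M {x \<in> space M. ennreal l < f x}
      \<le> ennreal (A / l) * (\<integral>\<^sup>+x. (if ennreal (l / \<kappa>) < g x then g x else 0) \<partial>M)"
    and A: "0 < A"
  shows "(\<integral>\<^sup>+x. f x epowr q \<partial>M) \<le> ennreal (A * q / (q - 1) * \<kappa> powr (q - 1)) * (\<integral>\<^sup>+x. g x epowr q \<partial>M)"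
proof -
  let ?g = "\<lambda>x. ennreal \<kappa> * g x"
  have less: "ennreal (l / \<kappa>) < g x \<longleftrightarrow> ennreal l < ?g x" if "0 < l" for l x
  proof (cases "g x")
    case (real r)
    then show ?thesis using \<kappa> that by (simp add: ennreal_less_iff field_simps flip: ennreal_mult)
  qed (use \<kappa> in \<open>simp add: ennreal_mult_top\<close>)
  have q0: "0 < q" "0 < q - 1" using q by auto
  have "(\<integral>\<^sup>+x. f x epowr q * 1 \<partial>M) \<le>
    (\<integral>\<^sup>+l. ennreal (A * q / (q - 1)) * (ennreal ((q - 1) * l powr (q - 1 - 1)) *
      (if 0 < l then (\<integral>\<^sup>+x. (if ennreal l < ?g x then g x else 0) \<partial>M) else 0)) \<partial>lborel)"
    unfolding nn_integral_epowr_layer_cake[OF M q0(1) \<open>f \<in> _\<close> borel_measurable_const]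
  proof (rule nn_integral_mono)
    fix l :: real
    show "ennreal (q * l powr (q - 1)) * (if 0 < l then (\<integral>\<^sup>+x. (if ennreal l < f x then 1 else 0) \<partial>M) else 0)
      \<le> ennreal (A * q / (q - 1)) * (ennreal ((q - 1) * l powr (q - 1 - 1)) *
        (if 0 < l then (\<integral>\<^sup>+x. (if ennreal l < ?g x then g x else 0) \<partial>M) else 0))"
    proof (cases "0 < l")
      case True
      have "(\<integral>\<^sup>+x. (if ennreal l < f x then 1 else 0) \<partial>M) \<le> ennreal (A / l) * (\<integral>\<^sup>+x. (if ennreal l < ?g x then g x else 0) \<partial>M)"
        using le[OF True] by (simp add: nn_integral_superlevel less[OF True])
      from mult_left_mono[OF this, of "ennreal (q * l powr (q - 1))"]
      have "ennreal (q * l powr (q - 1)) * (\<integral>\<^sup>+x. (if ennreal l < f x then 1 else 0) \<partial>M)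
        \<le> ennreal (q * l powr (q - 1)) * ennreal (A / l) * (\<integral>\<^sup>+x. (if ennreal l < ?g x then g x else 0) \<partial>M)"
        by (simp add: mult_ac)
      \<comment> \<open>The factor 1/l of the weak type bound lowers the density of level q to that
        of level q - 1; the remaining power of \<open>g\<close> sits in the truncated
        integral.\<close>
      also have "ennreal (q * l powr (q - 1)) * ennreal (A / l)
        = ennreal (A * q / (q - 1)) * ennreal ((q - 1) * l powr (q - 1 - 1))"
      proof -
        have "l powr (q - 1 - 1) = l powr (q - 1) / l"
          using True by (subst powr_diff) simp
        then have "q * l powr (q - 1) * (A / l) = A * q / (q - 1) * ((q - 1) * l powr (q - 1 - 1))"
          using q by simp
        then show ?thesis
          using q True A by (simp add: ennreal_mult[symmetric])
      qed
      finally show ?thesis using True by (simp add: mult.assoc)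
    qed simp
  qed
  also have "\<dots> = ennreal (A * q / (q - 1)) * (\<integral>\<^sup>+x. ?g x epowr (q - 1) * g x \<partial>M)"
  proof -
    interpret sigma_finite_measure M by fact
    show ?thesis
      by (subst nn_integral_epowr_layer_cake[OF M q0(2)]) (auto intro!: nn_integral_cmult)
  qed
  also have "(\<integral>\<^sup>+x. ?g x epowr (q - 1) * g x \<partial>M) = ennreal (\<kappa> powr (q - 1)) * (\<integral>\<^sup>+x. g x epowr q \<partial>M)"
  proof -
    show ?thesis
      using q \<kappa> by (simp add: epowr_mult epowr_mult_self epowr_ennreal mult.assoc nn_integral_cmult)
  qed
  finally show ?thesis
    using A q by (subst ennreal_mult) (simp_all add: mult.assoc)
qed

section \<open>Suprema over balls for doubling measures\<close>

lemma inverse_antimono_ennreal: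
  assumes "x \<le> y"
  shows "inverse y \<le> inverse (x :: ennreal)"
proof (cases x; cases y)
  fix r t assume "x = ennreal r" "0 \<le> r" "y = ennreal t" "0 \<le> t"
  with assms show ?thesis
    by (cases "r = 0") (auto simp: inverse_ennreal intro!: le_imp_inverse_le)
qed (use assms in \<open>auto simp: top_unique\<close>)

text \<open>The uncentred maximal operator of an arbitrary ball functional. Because the balls are
  open and uncentred, superlevel sets are open whatever \<open>s\<close> is, so measurability costs
  nothing.\<close>

definition ball_sup :: "('a::euclidean_space \<Rightarrow> real \<Rightarrow> ennreal) \<Rightarrow> 'a \<Rightarrow> ennreal" where
  "ball_sup s x = (SUP p\<in>{(y, \<rho>). x \<in> ball y \<rho>}. s (fst p) (snd p))"

lemma less_ball_sup_iff: "l < ball_sup s x \<longleftrightarrow> (\<exists>y \<rho>. x \<in> ball y \<rho> \<and> l < s y \<rho>)"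
  by (auto simp: ball_sup_def less_SUP_iff)

lemma ball_sup_upper: "x \<in> ball y \<rho> \<Longrightarrow> s y \<rho> \<le> ball_sup s x"
  unfolding ball_sup_def by (rule SUP_upper2[of "(y, \<rho>)"]) auto

lemma ball_sup_superlevel: "{x. l < ball_sup s x} = (\<Union>(y, \<rho>)\<in>{(y, \<rho>). 0 < \<rho> \<and> l < s y \<rho>}. ball y \<rho>)"
proof -
  have "0 < \<rho>" if "x \<in> ball y \<rho>" for x y :: 'a and \<rho>
    using that by (metis mem_ball zero_le_dist le_less_trans)
  then show ?thesis unfolding less_ball_sup_iff by blast
qed

lemma ball_sup_measurable [measurable]: "ball_sup s \<in> borel_measurable borel"
proof (rule borel_measurableI_greater)
  fix l
  have "open {x. l < ball_sup s x}"
    unfolding ball_sup_superlevel by auto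
  then show "{x \<in> space borel. l < ball_sup s x} \<in> sets borel" by simp
qed

lemma ball_borel [measurable]: "ball y r \<in> sets borel"
  by simp

text \<open>The dilation factor 5 is the one of Vitali's covering lemma.\<close>

locale doubling_measure =
  fixes M :: "'a::euclidean_space measure" and D :: real
  assumes sets_M [measurable_cong]: "sets M = sets borel"
    and ball_pos: "\<And>y \<rho>. 0 < \<rho> \<Longrightarrow> emeasure M (ball y \<rho>) \<noteq> 0"
    and ball_finite: "\<And>y \<rho>. 0 < \<rho> \<Longrightarrow> emeasure M (ball y \<rho>) \<noteq> \<infinity>"
    and doubling: "\<And>y \<rho>. 0 < \<rho> \<Longrightarrow> emeasure M (ball y (5 * \<rho>)) \<le> ennreal D * emeasure M (ball y \<rho>)"
    and D_pos: "0 < D"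
begin

lemma space_M [simp]: "space M = UNIV"
  using sets_eq_imp_space_eq[OF sets_M] by simp

lemma sigma_finite: "sigma_finite_measure M"
proof
  have "x \<in> (\<Union>n. ball (0::'a) (real (Suc n)))" for x
  proof -
    obtain n where "norm x < real n" using reals_Archimedean2 by blast
    then have "x \<in> ball 0 (real (Suc n))" by simp
    then show ?thesis by blast
  qed
  then have "(\<Union>n. ball (0::'a) (real (Suc n))) = UNIV" by blast
  moreover have "\<forall>a\<in>range (\<lambda>n. ball (0::'a) (real (Suc n))). emeasure M a \<noteq> \<infinity>"
    using ball_finite by auto
  ultimately show "\<exists>A. countable A \<and> A \<subseteq> sets M \<and> \<Union> A = space M \<and> (\<forall>a\<in>A. emeasure M a \<noteq> \<infinity>)"
    by (intro exI[of _ "range (\<lambda>n. ball (0::'a) (real (Suc n)))"]) (auto simp: sets_M)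
qed

text \<open>Vitali selects countably many disjoint balls whose fivefold dilates cover the union.
  Doubling returns from the dilates to the balls, the hypothesis replaces their measure by integrals
  of \<open>\<phi>\<close>, and disjointness sums these to at most the full integral.\<close>

lemma emeasure_Union_balls_le:
  assumes [measurable]: "\<phi> \<in> borel_measurable borel"
    and P: "\<And>y \<rho>. (y, \<rho>) \<in> P \<Longrightarrow> 0 < \<rho> \<and> emeasure M (ball y \<rho>) \<le> (\<integral>\<^sup>+x\<in>ball y \<rho>. \<phi> x \<partial>M)"
  shows "emeasure M (\<Union>(y, \<rho>)\<in>P. ball y \<rho>) \<le> ennreal D * (\<integral>\<^sup>+x. \<phi> x \<partial>M)"
proof -
  \<comment> \<open>Vitali's lemma needs bounded radii; the bound n is removed by monotone
    convergence of the unions.\<close>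
  define E where "E = (\<lambda>n::nat. \<Union>p\<in>{p \<in> P. snd p \<le> real n}. ball (fst p) (snd p))"
  have "(\<Union>(y, \<rho>)\<in>P. ball y \<rho>) = (\<Union>n. E n)"
  proof (intro equalityI subsetI)
    fix x assume "x \<in> (\<Union>(y, \<rho>)\<in>P. ball y \<rho>)"
    then obtain p where p: "p \<in> P" "x \<in> ball (fst p) (snd p)" by auto
    obtain n where "snd p \<le> real n" using real_arch_simple by blast
    with p show "x \<in> (\<Union>n. E n)" unfolding E_def by blast
  next
    fix x assume "x \<in> (\<Union>n. E n)"
    then obtain p where "p \<in> P" "x \<in> ball (fst p) (snd p)" unfolding E_def by blast
    then show "x \<in> (\<Union>(y, \<rho>)\<in>P. ball y \<rho>)" by (cases p) (auto simp del: mem_ball)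
  qed
  moreover have "emeasure M (\<Union>n. E n) = (SUP n. emeasure M (E n))"
  proof (rule SUP_emeasure_incseq[symmetric])
    show "range E \<subseteq> sets M"
      unfolding sets_M E_def by (auto intro!: borel_open open_UN)
    show "incseq E"
      unfolding E_def incseq_def by (intro allI impI UN_mono) auto
  qed
  moreover have "emeasure M (E n) \<le> ennreal D * (\<integral>\<^sup>+x. \<phi> x \<partial>M)" for n
  proof -
    have r: "0 < snd p \<and> snd p \<le> real n" if "p \<in> {p \<in> P. snd p \<le> real n}" for p
      using P[of "fst p" "snd p"] that by auto
    have sub: "E n \<subseteq> (\<Union>p\<in>{p \<in> P. snd p \<le> real n}. ball (fst p) (snd p))"
      by (simp add: E_def)
    obtain C where C: "countable C" "C \<subseteq> {p \<in> P. snd p \<le> real n}"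
      and dis: "pairwise (\<lambda>i j. disjnt (ball (fst i) (snd i)) (ball (fst j) (snd j))) C"
      and cov: "E n \<subseteq> (\<Union>i\<in>C. ball (fst i) (5 * snd i))"
      using Vitali_covering_lemma_balls[OF sub r] by blast
    have "emeasure M (E n) \<le> emeasure M (\<Union>i\<in>C. ball (fst i) (5 * snd i))"
      using cov by (rule emeasure_mono) (auto simp: sets_M intro!: borel_open open_UN)
    also have "\<dots> = (\<integral>\<^sup>+x. indicator (\<Union>i\<in>C. ball (fst i) (5 * snd i)) x \<partial>M)"
      by (rule nn_integral_indicator[symmetric]) (auto simp: sets_M intro!: borel_open open_UN)
    also have "\<dots> \<le> (\<integral>\<^sup>+x. (\<integral>\<^sup>+i. indicator (ball (fst i) (5 * snd i)) x \<partial>count_space C) \<partial>M)"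
    proof (rule nn_integral_mono)
      fix x
      show "indicator (\<Union>i\<in>C. ball (fst i) (5 * snd i)) x
        \<le> (\<integral>\<^sup>+i. indicator (ball (fst i) (5 * snd i)) x \<partial>count_space C :: ennreal)"
      proof (cases "x \<in> (\<Union>i\<in>C. ball (fst i) (5 * snd i))")
        case True
        then obtain i where "i \<in> C" "x \<in> ball (fst i) (5 * snd i)" by blast
        then have "indicator (ball (fst i) (5 * snd i)) x
          \<le> (\<integral>\<^sup>+i. indicator (ball (fst i) (5 * snd i)) x \<partial>count_space C :: ennreal)"
          by (intro nn_integral_ge_point)
        then show ?thesis using True \<open>x \<in> ball _ _\<close> by (simp del: mem_ball)
      qed (simp del: mem_ball)
    qed
    also have "\<dots> = (\<integral>\<^sup>+i. (\<integral>\<^sup>+x. indicator (ball (fst i) (5 * snd i)) x \<partial>M) \<partial>count_space C)"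
      by (rule nn_integral_count_space_nn_integral[OF C(1)]) (simp add: sets_M borel_measurable_indicator)
    also have "\<dots> = (\<integral>\<^sup>+i. emeasure M (ball (fst i) (5 * snd i)) \<partial>count_space C)"
      by (intro nn_integral_cong nn_integral_indicator) (simp add: sets_M)
    also have "\<dots> \<le> (\<integral>\<^sup>+i. ennreal D * emeasure (density M \<phi>) (ball (fst i) (snd i)) \<partial>count_space C)"
    proof (rule nn_integral_mono)
      fix i assume "i \<in> space (count_space C)"
      then have "(fst i, snd i) \<in> P" using C by auto
      note Pi = P[OF this]
      have "emeasure M (ball (fst i) (5 * snd i)) \<le> ennreal D * emeasure M (ball (fst i) (snd i))"
        using Pi by (intro doubling) auto
      also have "\<dots> \<le> ennreal D * emeasure (density M \<phi>) (ball (fst i) (snd i))"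
        using Pi by (intro mult_left_mono) (auto simp: emeasure_density sets_M)
      finally show "emeasure M (ball (fst i) (5 * snd i))
        \<le> ennreal D * emeasure (density M \<phi>) (ball (fst i) (snd i))" .
    qed
    also have "\<dots> = ennreal D * (\<integral>\<^sup>+i. emeasure (density M \<phi>) (ball (fst i) (snd i)) \<partial>count_space C)"
      by (rule nn_integral_cmult) simp
    also have "(\<integral>\<^sup>+i. emeasure (density M \<phi>) (ball (fst i) (snd i)) \<partial>count_space C)
      = emeasure (density M \<phi>) (\<Union>i\<in>C. ball (fst i) (snd i))"
      using dis C(1)
      by (intro emeasure_UN_countable[symmetric])
        (auto simp: sets_M disjoint_family_on_def pairwise_def disjnt_def)
    also have "\<dots> \<le> emeasure (density M \<phi>) (space (density M \<phi>))"
      by (rule emeasure_space)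
    also have "\<dots> = (\<integral>\<^sup>+x. \<phi> x \<partial>M)"
      by (subst emeasure_density) (auto simp: sets_M)
    finally show ?thesis by (simp add: mult_left_mono)
  qed
  ultimately show ?thesis by (auto intro: SUP_least)
qed

text \<open>A strong type bound valid for all q > 0: each ball on which \<open>s\<close> exceeds l
  contains the fixed portion 1/A of its mass on which \<open>g\<close> exceeds c l. The covering
  lemma with A times the indicator of that superlevel set then compares distribution functions
  directly.\<close>

lemma nn_integral_ball_sup_le:
  assumes q: "0 < q" and c: "0 < c" and A: "0 < A" and g [measurable]: "g \<in> borel_measurable borel"
    and le: "\<And>y \<rho> l. 0 < \<rho> \<Longrightarrow> 0 < l \<Longrightarrow> ennreal l < s y \<rho> \<Longrightarrow>
      emeasure M (ball y \<rho>) \<le> ennreal A * emeasure M (ball y \<rho> \<inter> {x. ennreal (c * l) < g x})"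
  shows "(\<integral>\<^sup>+x. ball_sup s x epowr q \<partial>M) \<le> ennreal (D * A * c powr - q) * (\<integral>\<^sup>+x. g x epowr q \<partial>M)"
proof -
  have meas: "{x. ennreal (c * l) < g x} \<in> sets borel" for l
    using g by measurable
  have "(\<integral>\<^sup>+x. ball_sup s x epowr q \<partial>M)
    \<le> ennreal (D * A) * ennreal (c powr - q) * (\<integral>\<^sup>+x. g x epowr q \<partial>M)"
  proof (rule nn_integral_epowr_le_distribution[OF sigma_finite q c])
    fix l :: real assume l: "0 < l"
    let ?\<phi> = "\<lambda>x. ennreal A * indicator {x. ennreal (c * l) < g x} x"
    have "emeasure M (\<Union>(y, \<rho>)\<in>{(y, \<rho>). 0 < \<rho> \<and> ennreal l < s y \<rho>}. ball y \<rho>)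
      \<le> ennreal D * (\<integral>\<^sup>+x. ?\<phi> x \<partial>M)"
    proof (rule emeasure_Union_balls_le)
      show "?\<phi> \<in> borel_measurable borel" using meas by measurable
      fix y \<rho> assume "(y, \<rho>) \<in> {(y, \<rho>). 0 < \<rho> \<and> ennreal l < s y \<rho>}"
      then have 1: "0 < \<rho>" "ennreal l < s y \<rho>" by auto
      have "(\<integral>\<^sup>+x\<in>ball y \<rho>. ?\<phi> x \<partial>M)
        = (\<integral>\<^sup>+x. ennreal A * indicator (ball y \<rho> \<inter> {x. ennreal (c * l) < g x}) x \<partial>M)"
        by (intro nn_integral_cong) (auto split: split_indicator)
      also have "\<dots> = ennreal A * emeasure M (ball y \<rho> \<inter> {x. ennreal (c * l) < g x})"
        using meas by (subst nn_integral_cmult_indicator) (auto simp: sets_M)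
      finally show "0 < \<rho> \<and> emeasure M (ball y \<rho>) \<le> (\<integral>\<^sup>+x\<in>ball y \<rho>. ?\<phi> x \<partial>M)"
        using le[OF 1(1) l 1(2)] 1 by simp
    qed
    also have "(\<integral>\<^sup>+x. ?\<phi> x \<partial>M) = ennreal A * emeasure M {x. ennreal (c * l) < g x}"
      using meas by (subst nn_integral_cmult_indicator) (auto simp: sets_M)
    finally show "emeasure M {x \<in> space M. ennreal l < ball_sup s x}
      \<le> ennreal (D * A) * emeasure M {x \<in> space M. ennreal (c * l) < g x}"
      using A D_pos by (simp add: ball_sup_superlevel ennreal_mult mult.assoc)
  qed measurable
  then show ?thesis
    using A D_pos c by (simp add: ennreal_mult)
qed

text \<open>The integral runs over a shrunken ball while the mass of the full ball is divided out.
  The weak type (1,1) constant does not contain \<open>K\<close>, and the bound by the supremum of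
  \<open>h\<close> contains it once; interpolation therefore yields \<open>K\<close> to the power q
  - 1, which is the exponent that duality needs.\<close>

lemma nn_integral_ball_sup_average_le:
  assumes q: "1 < q" and \<tau>: "0 < \<tau>" "\<tau> \<le> 1" and K: "0 < K"
    and [measurable]: "h \<in> borel_measurable borel"
    and le: "\<And>y \<rho>. 0 < \<rho> \<Longrightarrow> emeasure M (ball y (\<tau> * \<rho>)) \<le> ennreal K * emeasure M (ball y \<rho>)"
  shows "(\<integral>\<^sup>+x. ball_sup (\<lambda>y \<rho>. (\<integral>\<^sup>+x\<in>ball y (\<tau> * \<rho>). h x \<partial>M) / emeasure M (ball y \<rho>)) x epowr q \<partial>M)
    \<le> ennreal (2 * D * q / (q - 1) * (2 * K) powr (q - 1)) * (\<integral>\<^sup>+x. h x epowr q \<partial>M)"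
    (is "(\<integral>\<^sup>+x. ball_sup ?s x epowr q \<partial>M) \<le> _")
proof (rule nn_integral_epowr_le_truncation[OF sigma_finite q])
  fix l :: real assume l: "0 < l"
  let ?h = "\<lambda>x. if ennreal (l / (2 * K)) < h x then h x else 0"
  let ?\<phi> = "\<lambda>x. ennreal (2 / l) * ?h x"
  have "emeasure M (\<Union>(y, \<rho>)\<in>{(y, \<rho>). 0 < \<rho> \<and> ennreal l < ?s y \<rho>}. ball y \<rho>)
    \<le> ennreal D * (\<integral>\<^sup>+x. ?\<phi> x \<partial>M)"
  proof (rule emeasure_Union_balls_le)
    fix y \<rho> assume "(y, \<rho>) \<in> {(y, \<rho>). 0 < \<rho> \<and> ennreal l < ?s y \<rho>}"
    then have \<rho>: "0 < \<rho>" and less: "ennreal l < ?s y \<rho>" by auto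
    obtain m where m: "emeasure M (ball y \<rho>) = ennreal m" "0 < m"
      using ball_pos[OF \<rho>, of y] ball_finite[OF \<rho>, of y]
      by (cases "emeasure M (ball y \<rho>)") (auto simp: less_le)
    have "ennreal (l * m) \<le> (\<integral>\<^sup>+x\<in>ball y (\<tau> * \<rho>). h x \<partial>M)"
      using less l m
      by (cases "\<integral>\<^sup>+x\<in>ball y (\<tau> * \<rho>). h x \<partial>M") (auto simp: divide_ennreal ennreal_less_iff field_simps)
    \<comment> \<open>The values of \<open>h\<close> up to l / (2 K) contribute at most l m / 2,
      half of what is present. The other half must come from \<open>?h\<close>, which may be
      integrated over the larger ball.\<close>
    also have "\<dots> \<le> (\<integral>\<^sup>+x. ennreal (l / (2 * K)) * indicator (ball y (\<tau> * \<rho>)) x + ?h x * indicator (ball y \<rho>) x \<partial>M)"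
    proof (rule nn_integral_mono)
      fix x
      have "\<tau> * \<rho> \<le> \<rho>" using \<tau> \<rho> by (simp add: mult_left_le_one_le)
      then have "x \<in> ball y (\<tau> * \<rho>) \<Longrightarrow> x \<in> ball y \<rho>" by simp
      then show "h x * indicator (ball y (\<tau> * \<rho>)) x
        \<le> ennreal (l / (2 * K)) * indicator (ball y (\<tau> * \<rho>)) x + ?h x * indicator (ball y \<rho>) x"
        by (auto simp del: mem_ball split: split_indicator)
    qed
    also have "\<dots> = (\<integral>\<^sup>+x. ennreal (l / (2 * K)) * indicator (ball y (\<tau> * \<rho>)) x \<partial>M)
        + (\<integral>\<^sup>+x\<in>ball y \<rho>. ?h x \<partial>M)"
      by (intro nn_integral_add) measurable
    also have "(\<integral>\<^sup>+x. ennreal (l / (2 * K)) * indicator (ball y (\<tau> * \<rho>)) x \<partial>M)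
        \<le> ennreal (l / (2 * K)) * (ennreal K * ennreal m)"
      using le[OF \<rho>, of y] m by (subst nn_integral_cmult_indicator) (auto simp: sets_M intro!: mult_left_mono)
    also have "\<dots> = ennreal (l * m / 2)"
      using l K m by (simp add: ennreal_mult[symmetric])
    finally have "ennreal (l * m) \<le> ennreal (l * m / 2) + (\<integral>\<^sup>+x\<in>ball y \<rho>. ?h x \<partial>M)"
      by simp
    then have "ennreal (l * m / 2) \<le> (\<integral>\<^sup>+x\<in>ball y \<rho>. ?h x \<partial>M)"
      using l m by (cases "\<integral>\<^sup>+x\<in>ball y \<rho>. ?h x \<partial>M") (simp_all add: ennreal_plus[symmetric] del: ennreal_plus)
    then have "ennreal (2 / l) * ennreal (l * m / 2) \<le> ennreal (2 / l) * (\<integral>\<^sup>+x\<in>ball y \<rho>. ?h x \<partial>M)"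
      by (rule mult_left_mono) simp
    also have "\<dots> = (\<integral>\<^sup>+x\<in>ball y \<rho>. ?\<phi> x \<partial>M)"
      by (subst nn_integral_cmult[symmetric]) (auto simp: mult.assoc)
    finally show "0 < \<rho> \<and> emeasure M (ball y \<rho>) \<le> (\<integral>\<^sup>+x\<in>ball y \<rho>. ?\<phi> x \<partial>M)"
      using l m \<rho> by (simp add: ennreal_mult[symmetric])
  qed measurable
  also have "(\<integral>\<^sup>+x. ?\<phi> x \<partial>M) = ennreal (2 / l) * (\<integral>\<^sup>+x. ?h x \<partial>M)"
    by (rule nn_integral_cmult) measurable
  finally show "emeasure M {x \<in> space M. ennreal l < ball_sup ?s x} \<le> ennreal (2 * D / l) * (\<integral>\<^sup>+x. ?h x \<partial>M)"
    using D_pos l by (simp add: ball_sup_superlevel mult.assoc[symmetric] ennreal_mult[symmetric] mult.commute)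
next
  show "0 < 2 * D" using D_pos by simp
  show "0 < 2 * K" using K by simp
qed measurable

text \<open>If the harmonic mean of \<open>f\<close> over the shrunken ball exceeds l, Chebyshev's
  inequality for 1/f shows that \<open>f\<close> exceeds l/2 on at least half of that ball, hence on
  a portion 1 / (2 K) of the full one.\<close>

lemma nn_integral_ball_sup_harmonic_le:
  assumes q: "0 < q" and \<tau>: "0 < \<tau>" "\<tau> \<le> 1" and K: "0 < K"
    and [measurable]: "f \<in> borel_measurable borel"
    and le: "\<And>y \<rho>. 0 < \<rho> \<Longrightarrow> emeasure M (ball y \<rho>) \<le> ennreal K * emeasure M (ball y (\<tau> * \<rho>))"
  shows "(\<integral>\<^sup>+x. ball_sup (\<lambda>y \<rho>. emeasure M (ball y (\<tau> * \<rho>)) / (\<integral>\<^sup>+x\<in>ball y (\<tau> * \<rho>). inverse (f x) \<partial>M)) x epowr q \<partial>M)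
    \<le> ennreal (D * (2 * K) * (1 / 2) powr - q) * (\<integral>\<^sup>+x. f x epowr q \<partial>M)"
proof (rule nn_integral_ball_sup_le[OF q])
  fix y :: 'a and \<rho> l :: real
  let ?B = "ball y (\<tau> * \<rho>)"
  let ?I = "\<integral>\<^sup>+x\<in>?B. inverse (f x) \<partial>M"
  let ?Y = "?B \<inter> {x. ennreal (1 / 2 * l) < f x}"
  let ?X = "?B - {x. ennreal (1 / 2 * l) < f x}"
  assume \<rho>: "0 < \<rho>" and l: "0 < l" and less: "ennreal l < emeasure M ?B / ?I"
  have \<tau>\<rho>: "0 < \<tau> * \<rho>" using \<tau> \<rho> by simp
  obtain m where m: "emeasure M ?B = ennreal m" "0 < m"
    using ball_pos[OF \<tau>\<rho>, of y] ball_finite[OF \<tau>\<rho>, of y]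
    by (cases "emeasure M ?B") (auto simp: less_le)
  have XY: "?X \<in> sets M" "?Y \<in> sets M"
    by (simp_all add: sets_M) measurable
  have "ennreal (2 / l) * emeasure M ?X = (\<integral>\<^sup>+x. ennreal (2 / l) * indicator ?X x \<partial>M)"
    using XY by (simp add: nn_integral_cmult_indicator)
  also have "\<dots> \<le> ?I"
  proof (intro nn_integral_mono)
    fix x
    have "ennreal (2 / l) \<le> inverse (f x)" if "\<not> ennreal (1 / 2 * l) < f x"
    proof -
      have "f x \<le> ennreal (l / 2)" using that by simp
      then have "inverse (ennreal (l / 2)) \<le> inverse (f x)"
        by (rule inverse_antimono_ennreal)
      then show ?thesis using l by (simp add: inverse_ennreal)
    qed
    then show "ennreal (2 / l) * indicator ?X x \<le> inverse (f x) * indicator ?B x"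
      by (auto split: split_indicator)
  qed
  finally have I: "ennreal (2 / l) * emeasure M ?X \<le> ?I" .
  obtain i where i: "?I = ennreal i" "0 \<le> i"
    using less by (cases ?I) auto
  have li: "l * i \<le> m"
    using less l m i by (cases "i = 0") (auto simp: divide_ennreal ennreal_less_iff field_simps)
  have "emeasure M ?X \<le> emeasure M ?B" "emeasure M ?Y \<le> emeasure M ?B"
    by (intro emeasure_mono; auto simp: sets_M)+
  then obtain a b where ab: "emeasure M ?X = ennreal a" "emeasure M ?Y = ennreal b" "0 \<le> a" "0 \<le> b"
    using m by (metis ennreal_cases ennreal_less_top top.not_eq_extremum top_unique)
  have "emeasure M ?B = emeasure M ?X + emeasure M ?Y"
    using XY by (subst plus_emeasure) (auto intro: arg_cong[where f="emeasure M"])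
  then have "m = a + b" using ab m by (simp add: ennreal_plus[symmetric] del: ennreal_plus)
  moreover have "2 / l * a \<le> i" using I ab i l by (simp add: ennreal_mult[symmetric])
  then have "2 * a \<le> l * i" using l by (simp add: field_simps)
  ultimately have mb: "m \<le> 2 * b" using li by linarith
  have "emeasure M (ball y \<rho>) \<le> ennreal K * ennreal m"
    using le[OF \<rho>] m by metis
  also have "\<dots> \<le> ennreal (2 * K) * ennreal b"
    using mb K ab(3,4) m(2) by (simp add: ennreal_mult[symmetric] mult_left_mono)
  also have "\<dots> \<le> ennreal (2 * K) * emeasure M (ball y \<rho> \<inter> {x. ennreal (1 / 2 * l) < f x})"
  proof -
    have "\<tau> * \<rho> \<le> \<rho>" using \<tau> \<rho> by (simp add: mult_left_le_one_le)
    then have "?Y \<subseteq> ball y \<rho> \<inter> {x. ennreal (1 / 2 * l) < f x}" by auto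
    then show ?thesis unfolding ab(2)[symmetric]
      by (intro mult_left_mono emeasure_mono) (auto simp: sets_M)
  qed
  finally show "emeasure M (ball y \<rho>) \<le> ennreal (2 * K) * emeasure M (ball y \<rho> \<inter> {x. ennreal (1 / 2 * l) < f x})" .
qed (use K in auto)

end

section \<open>Cone integrals and duality\<close>

text \<open>The square of the area function, with |F|^2 and the kernel
  \<open>t powr - (n + 1)\<close> absorbed into \<open>G\<close>. Membership in the cone is written
  from the point of view of x, as a ball around the vertex's partner y; for a > 0 this ball is empty
  when t \<le> 0, so the integral may extend over the whole product space.\<close>

definition cone_integral :: "('a::euclidean_space \<times> real \<Rightarrow> ennreal) \<Rightarrow> real \<Rightarrow> 'a \<Rightarrow> ennreal" where
  "cone_integral G a x = (\<integral>\<^sup>+z. G z * indicator (ball (fst z) (a * snd z)) x \<partial>lborel)"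

abbreviation cone_power :: "'a::euclidean_space measure \<Rightarrow> real \<Rightarrow> ('a \<times> real \<Rightarrow> ennreal) \<Rightarrow> real \<Rightarrow> ennreal" where
  "cone_power M q G a \<equiv> (\<integral>\<^sup>+x. cone_integral G a x epowr q \<partial>M)"

lemma indicator_ball_measurable [measurable]:
  "(\<lambda>(x, z). indicator (ball (fst z) (a * snd z)) x :: ennreal)
    \<in> borel_measurable ((borel :: 'a::euclidean_space measure) \<Otimes>\<^sub>M (borel :: ('a \<times> real) measure))"
proof -
  have "(\<lambda>(x :: 'a, z). indicator (ball (fst z) (a * snd z)) x :: ennreal)
    = (\<lambda>p. if dist (fst (snd p)) (fst p) < a * snd (snd p) then 1 else 0)"
    by (auto simp: fun_eq_iff indicator_def)
  moreover have "\<dots> \<in> borel_measurable (borel \<Otimes>\<^sub>M borel)"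
  proof -
    have "open {p :: 'a \<times> 'a \<times> real. dist (fst (snd p)) (fst p) < a * snd (snd p)}"
      by (intro open_Collect_less continuous_intros)
    then have "{p :: 'a \<times> 'a \<times> real. dist (fst (snd p)) (fst p) < a * snd (snd p)} \<in> sets borel"
      by (rule borel_open)
    then show ?thesis
      unfolding borel_prod by (intro measurable_If) auto
  qed
  ultimately show ?thesis by simp
qed

lemma cone_integral_measurable [measurable]:
  assumes [measurable]: "G \<in> borel_measurable borel"
  shows "cone_integral G a \<in> borel_measurable borel"
  unfolding cone_integral_def[abs_def] by (rule lborel.borel_measurable_nn_integral) measurable

lemma nn_integral_cone_integral:
  fixes M :: "'a::euclidean_space measure"
  assumes M: "sigma_finite_measure M" and sets_M [measurable_cong]: "sets M = sets borel"
    and [measurable]: "G \<in> borel_measurable borel" "\<phi> \<in> borel_measurable borel"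
  shows "(\<integral>\<^sup>+x. cone_integral G a x * \<phi> x \<partial>M)
    = (\<integral>\<^sup>+z. G z * (\<integral>\<^sup>+x\<in>ball (fst z) (a * snd z). \<phi> x \<partial>M) \<partial>lborel)"
proof -
  interpret sigma_finite_measure M by fact
  interpret pair_sigma_finite M "lborel :: ('a \<times> real) measure" ..
  have "(\<integral>\<^sup>+x. cone_integral G a x * \<phi> x \<partial>M)
    = (\<integral>\<^sup>+x. (\<integral>\<^sup>+z. G z * indicator (ball (fst z) (a * snd z)) x * \<phi> x \<partial>lborel) \<partial>M)"
    unfolding cone_integral_def by (intro nn_integral_cong nn_integral_multc[symmetric]) measurable
  also have "\<dots> = (\<integral>\<^sup>+z. (\<integral>\<^sup>+x. G z * indicator (ball (fst z) (a * snd z)) x * \<phi> x \<partial>M) \<partial>lborel)"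
    by (rule Fubini'[symmetric]) measurable
  also have "\<dots> = (\<integral>\<^sup>+z. G z * (\<integral>\<^sup>+x\<in>ball (fst z) (a * snd z). \<phi> x \<partial>M) \<partial>lborel)"
    by (subst nn_integral_cmult[symmetric]) (auto intro!: nn_integral_cong simp: mult_ac)
  finally show ?thesis .
qed

lemma nn_integral_cone_integral_mono:
  fixes M :: "'a::euclidean_space measure"
  assumes M: "sigma_finite_measure M" "sets M = sets borel"
    and G: "G \<in> borel_measurable borel"
    and \<phi>: "\<phi> \<in> borel_measurable borel" and \<psi>: "\<psi> \<in> borel_measurable borel"
    and a: "0 < a"
    and le: "\<And>y t. 0 < t \<Longrightarrow> (\<integral>\<^sup>+x\<in>ball y (a * t). \<phi> x \<partial>M) \<le> (\<integral>\<^sup>+x\<in>ball y (b * t). \<psi> x \<partial>M)"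
  shows "(\<integral>\<^sup>+x. cone_integral G a x * \<phi> x \<partial>M) \<le> (\<integral>\<^sup>+x. cone_integral G b x * \<psi> x \<partial>M)"
proof -
  have "(\<integral>\<^sup>+x\<in>ball y (a * t). \<phi> x \<partial>M) \<le> (\<integral>\<^sup>+x\<in>ball y (b * t). \<psi> x \<partial>M)" for y t
  proof (cases "0 < t")
    case False
    then have empty: "ball y (a * t) = {}"
      using a by (intro ball_empty) (simp add: mult_le_0_iff)
    show ?thesis unfolding empty by simp
  qed (rule le)
  then have "G z * (\<integral>\<^sup>+x\<in>ball (fst z) (a * snd z). \<phi> x \<partial>M)
    \<le> G z * (\<integral>\<^sup>+x\<in>ball (fst z) (b * snd z). \<psi> x \<partial>M)" for z
    by (rule mult_left_mono) simp
  then show ?thesis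
    unfolding nn_integral_cone_integral[OF M G \<phi>] nn_integral_cone_integral[OF M G \<psi>]
    by (rule nn_integral_mono)
qed

text \<open>One of the two terms dominates on its own, according to whether
  \<open>x powr (1 - q)\<close> is below \<open>h\<close> or not. The degenerate values are
  consistent: for x different from 0 the right side is infinite at H = 0 and at H = top.\<close>

lemma epowr_Young_less_one:
  assumes q: "0 < q" "q < 1"
  shows "x epowr q \<le> x * inverse H + H epowr (q / (1 - q))"
proof (cases "x = 0 \<or> H = 0 \<or> H = top")
  case True
  then show ?thesis
    by (cases "x = 0") (auto simp: ennreal_mult_top)
next
  case False
  then obtain h where h: "H = ennreal h" "0 < h"
    by (cases H) (auto simp: less_le)
  show ?thesis
  proof (cases x)
    case top
    then show ?thesis using h by (simp add: inverse_ennreal ennreal_top_mult)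
  next
    case (real r)
    then have r: "0 < r" using False by (simp add: less_le)
    have "r powr q \<le> r / h + h powr (q / (1 - q))"
    proof (cases "r powr (1 - q) \<le> h")
      case True
      then have "(r powr (1 - q)) powr (q / (1 - q)) \<le> h powr (q / (1 - q))"
        using q by (intro powr_mono2) auto
      then have "r powr q \<le> h powr (q / (1 - q))"
        using q by (simp add: powr_powr)
      then show ?thesis using r h by (simp add: add_increasing)
    next
      case False
      then have "r powr q * h \<le> r powr q * r powr (1 - q)"
        by (intro mult_left_mono) auto
      also have "\<dots> = r" using r by (simp add: powr_add[symmetric])
      finally have "r powr q \<le> r / h" using h by (simp add: field_simps)
      then show ?thesis by (simp add: add_increasing2)
    qed
    then show ?thesis
      using real r h by (simp add: epowr_ennreal inverse_ennreal ennreal_mult[symmetric]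
        ennreal_plus[symmetric] divide_inverse del: ennreal_plus)
  qed
qed

text \<open>The free parameter \<open>d\<close> makes the term in \<open>H\<close> small enough to
  be absorbed later. The power \<open>d powr - (q - 1)\<close> results from splitting where
  \<open>r = d * h powr (1 / (q - 1))\<close>.\<close>

lemma epowr_Young_greater_one:
  assumes q: "1 < q" and d: "0 < d"
  shows "x * H \<le> ennreal d * H epowr (q / (q - 1)) + ennreal (d powr - (q - 1)) * x epowr q"
proof (cases "x = 0 \<or> H = 0 \<or> x = top \<or> H = top")
  case True
  then show ?thesis
    using d by (elim disjE) (simp_all add: ennreal_mult_top)
next
  case False
  then obtain r h where r: "x = ennreal r" "0 < r" and h: "H = ennreal h" "0 < h"
    by (cases x; cases H) (auto simp: less_le)
  have "r * h \<le> d * h powr (q / (q - 1)) + d powr - (q - 1) * r powr q"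
  proof (cases "r \<le> d * h powr (1 / (q - 1))")
    case True
    then have "r * h \<le> d * h powr (1 / (q - 1)) * h powr 1"
      using h by (simp add: mult_right_mono)
    also have "\<dots> = d * h powr (1 / (q - 1) + 1)"
      by (simp only: powr_add mult.assoc)
    also have "1 / (q - 1) + 1 = q / (q - 1)" using q by (simp add: field_simps)
    finally show ?thesis by (simp add: add_increasing2)
  next
    case False
    then have "(h powr (1 / (q - 1))) powr (q - 1) \<le> (r / d) powr (q - 1)"
      using q d by (intro powr_mono2) (auto simp: field_simps)
    then have "h \<le> (r / d) powr (q - 1)"
      using q h by (simp add: powr_powr)
    then have "r * h \<le> r * (r / d) powr (q - 1)" using r by simp
    also have "\<dots> = d powr - (q - 1) * (r powr (q - 1) * r)"
    proof -
      have "(r / d) powr (q - 1) = r powr (q - 1) / d powr (q - 1)"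
        using r d by (simp add: powr_divide)
      moreover have "d powr - (q - 1) = 1 / d powr (q - 1)" by (rule powr_minus_divide)
      ultimately show ?thesis by simp
    qed
    also have "r powr (q - 1) * r = r powr q"
      using r by (simp add: powr_diff)
    finally show ?thesis using d by (simp add: add_increasing)
  qed
  then show ?thesis
    using r h d by (simp add: epowr_ennreal ennreal_mult[symmetric] ennreal_plus[symmetric] del: ennreal_plus)
qed

text \<open>The \<open>L\<^sup>q\<close> quasinorms are reduced to weighted \<open>L\<^sup>1\<close> norms of the squared area functions,
  which are governed by an inequality between integrals over concentric balls. For \<open>q < 1\<close> the
  variational formula \<open>\<parallel>g\<parallel>\<^sub>q = inf \<integral> g / H\<close> (over \<open>H\<close> normalized in \<open>L\<^sup>q\<^sup>/\<^sup>(\<^sup>1\<^sup>-\<^sup>q\<^sup>)\<close>) plays the part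
  of duality.\<close>

lemma cone_integral_le_of_less_one:
  fixes M :: "'a::euclidean_space measure"
  assumes M: "sigma_finite_measure M" and sets_M [measurable_cong]: "sets M = sets borel"
    and q: "0 < q" "q < 1" and a: "0 < a" and K: "0 < K" and C: "0 < C"
    and G [measurable]: "G \<in> borel_measurable borel"
    and ex: "\<And>f. f \<in> borel_measurable borel \<Longrightarrow> \<exists>H \<in> borel_measurable borel.
      (\<forall>y t. 0 < t \<longrightarrow> (\<integral>\<^sup>+x\<in>ball y (a * t). inverse (H x) \<partial>M)
        \<le> ennreal K * (\<integral>\<^sup>+x\<in>ball y (b * t). inverse (f x) \<partial>M)) \<and>
      (\<integral>\<^sup>+x. H x epowr (q / (1 - q)) \<partial>M) \<le> ennreal (C * K) * (\<integral>\<^sup>+x. f x epowr (q / (1 - q)) \<partial>M)"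
  shows "cone_power M q G a
    \<le> ennreal ((1 + C) * K) * cone_power M q G b"
proof -
  let ?A = "cone_integral G a" and ?B = "cone_integral G b"
  \<comment> \<open>The choice that makes the Young splitting balanced for \<open>?B\<close>: both
    B/f and \<open>f powr (q / (1 - q))\<close> are then B to the power q, up to degenerate
    values.\<close>
  let ?f = "\<lambda>x. ?B x epowr (1 - q)"
  have "?f \<in> borel_measurable borel" by measurable
  from ex[OF this] obtain H where [measurable]: "H \<in> borel_measurable borel"
    and H: "\<And>y t. 0 < t \<Longrightarrow> (\<integral>\<^sup>+x\<in>ball y (a * t). inverse (H x) \<partial>M)
        \<le> ennreal K * (\<integral>\<^sup>+x\<in>ball y (b * t). inverse (?f x) \<partial>M)"
    and H2: "(\<integral>\<^sup>+x. H x epowr (q / (1 - q)) \<partial>M) \<le> ennreal (C * K) * (\<integral>\<^sup>+x. ?f x epowr (q / (1 - q)) \<partial>M)"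
    by blast
  \<comment> \<open>Only an inequality, since \<open>top * inverse top = 0\<close>.\<close>
  have f: "?B x * inverse (?f x) \<le> ?B x epowr q" for x
  proof (cases "?B x")
    case (real r)
    show ?thesis
    proof (cases "r = 0")
      case False
      then have r: "0 < r" using real by simp
      have "r * inverse (r powr (1 - q)) = r powr 1 * r powr - (1 - q)"
        using r by (simp only: powr_minus) simp
      also have "\<dots> = r powr q"
        by (simp only: powr_add[symmetric]) simp
      finally have "r * inverse (r powr (1 - q)) = r powr q" .
      then show ?thesis
        using real r by (simp add: epowr_ennreal inverse_ennreal ennreal_mult[symmetric])
    qed (use real in simp)
  qed simp
  have "(\<integral>\<^sup>+x. ?A x epowr q \<partial>M) \<le> (\<integral>\<^sup>+x. ?A x * inverse (H x) + H x epowr (q / (1 - q)) \<partial>M)"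
    by (intro nn_integral_mono epowr_Young_less_one q)
  also have "\<dots> = (\<integral>\<^sup>+x. ?A x * inverse (H x) \<partial>M) + (\<integral>\<^sup>+x. H x epowr (q / (1 - q)) \<partial>M)"
    by (intro nn_integral_add) measurable
  also have "(\<integral>\<^sup>+x. ?A x * inverse (H x) \<partial>M) \<le> (\<integral>\<^sup>+x. ?B x * (ennreal K * inverse (?f x)) \<partial>M)"
  proof (rule nn_integral_cone_integral_mono[OF M sets_M G _ _ a])
    show "(\<integral>\<^sup>+x\<in>ball y (a * t). inverse (H x) \<partial>M)
      \<le> (\<integral>\<^sup>+x\<in>ball y (b * t). ennreal K * inverse (?f x) \<partial>M)" if "0 < t" for y t
      using H[OF that, of y] by (simp add: nn_integral_cmult[symmetric] mult.assoc)
  qed measurable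
  also have "\<dots> = ennreal K * (\<integral>\<^sup>+x. ?B x * inverse (?f x) \<partial>M)"
    by (subst nn_integral_cmult[symmetric]) (auto simp: mult_ac)
  also have "\<dots> \<le> ennreal K * (\<integral>\<^sup>+x. ?B x epowr q \<partial>M)"
    by (intro mult_left_mono nn_integral_mono f) simp
  also note H2
  also have "(\<integral>\<^sup>+x. ?f x epowr (q / (1 - q)) \<partial>M) = (\<integral>\<^sup>+x. ?B x epowr q \<partial>M)"
    using q by (simp add: epowr_epowr)
  also have "ennreal K * (\<integral>\<^sup>+x. ?B x epowr q \<partial>M) + ennreal (C * K) * (\<integral>\<^sup>+x. ?B x epowr q \<partial>M)
    = ennreal ((1 + C) * K) * (\<integral>\<^sup>+x. ?B x epowr q \<partial>M)"
    using K C by (simp add: distrib_right)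
  finally show ?thesis by (simp add: add_mono)
qed

text \<open>The dual function is the extremal one, the power q - 1 of the (truncated) left-hand cone
  integral itself, so that its dual norm is again the left side and can be absorbed. The power
  \<open>K powr (1 / (q - 1))\<close> in the hypothesis becomes a single factor \<open>K\<close> in
  the conclusion.\<close>

lemma cone_integral_le_of_greater_one:
  fixes M :: "'a::euclidean_space measure"
  assumes M: "sigma_finite_measure M" and sets_M [measurable_cong]: "sets M = sets borel"
    and fin: "\<And>n::nat. emeasure M (ball 0 (real n)) \<noteq> \<infinity>"
    and q: "1 < q" and a: "0 < a" and K: "0 < K" and C: "0 < C"
    and G [measurable]: "G \<in> borel_measurable borel"
    and ex: "\<And>h. h \<in> borel_measurable borel \<Longrightarrow> \<exists>H \<in> borel_measurable borel.
      (\<forall>y t. 0 < t \<longrightarrow> (\<integral>\<^sup>+x\<in>ball y (a * t). h x \<partial>M) \<le> (\<integral>\<^sup>+x\<in>ball y (b * t). H x \<partial>M)) \<and>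
      (\<integral>\<^sup>+x. H x epowr (q / (q - 1)) \<partial>M)
        \<le> ennreal (C * K powr (1 / (q - 1))) * (\<integral>\<^sup>+x. h x epowr (q / (q - 1)) \<partial>M)"
  shows "cone_power M q G a
    \<le> ennreal (2 * (2 * C) powr (q - 1) * K) * cone_power M q G b"
proof -
  let ?A = "cone_integral G a" and ?B = "cone_integral G b"
  \<comment> \<open>Truncation in size and in space makes the integral finite, as absorption
    requires.\<close>
  define g where "g n x = min (?A x) (of_nat n) * indicator (ball 0 (real n)) x" for n x
  have [measurable]: "g n \<in> borel_measurable borel" for n
    unfolding g_def by measurable
  have g_le: "g n x \<le> ?A x" for n x
    by (auto simp: g_def split: split_indicator)
  \<comment> \<open>Chosen so that the term in \<open>H\<close> returns exactly half of the left
    side.\<close>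
  define d where "d = 1 / (2 * (C * K powr (1 / (q - 1))))"
  have d: "0 < d" using C K by (simp add: d_def)
  have dC: "d * (C * K powr (1 / (q - 1))) = 1 / 2"
    using C K by (simp add: d_def)
  have dq: "d powr - (q - 1) = (2 * C) powr (q - 1) * K"
  proof -
    have "d powr - (q - 1) = (2 * C * K powr (1 / (q - 1))) powr (q - 1)"
      using C K unfolding powr_minus_divide by (simp add: d_def powr_divide mult.assoc)
    also have "\<dots> = (2 * C) powr (q - 1) * K"
      using C K q by (simp add: powr_mult powr_powr)
    finally show ?thesis .
  qed
  have bound: "(\<integral>\<^sup>+x. g n x epowr q \<partial>M)
    \<le> ennreal (2 * (2 * C) powr (q - 1) * K) * (\<integral>\<^sup>+x. ?B x epowr q \<partial>M)" (is "?X \<le> _") for n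
  proof -
    let ?h = "\<lambda>x. g n x epowr (q - 1)"
    have "?h \<in> borel_measurable borel" by measurable
    from ex[OF this] obtain H where [measurable]: "H \<in> borel_measurable borel"
      and H: "\<And>y t. 0 < t \<Longrightarrow> (\<integral>\<^sup>+x\<in>ball y (a * t). ?h x \<partial>M) \<le> (\<integral>\<^sup>+x\<in>ball y (b * t). H x \<partial>M)"
      and H2: "(\<integral>\<^sup>+x. H x epowr (q / (q - 1)) \<partial>M)
        \<le> ennreal (C * K powr (1 / (q - 1))) * (\<integral>\<^sup>+x. ?h x epowr (q / (q - 1)) \<partial>M)"
      by blast
    have "?X \<le> (\<integral>\<^sup>+x. of_nat n epowr q * indicator (ball 0 (real n)) x \<partial>M)"
      by (intro nn_integral_mono) (use q in \<open>auto simp: g_def intro!: epowr_mono split: split_indicator\<close>)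
    also have "\<dots> = of_nat n epowr q * emeasure M (ball 0 (real n))"
      by (rule nn_integral_cmult_indicator) (simp add: sets_M)
    also have "\<dots> < top"
      using fin[of n] by (simp add: ennreal_mult_less_top less_top ennreal_of_nat_eq_real_of_nat epowr_ennreal)
    finally have X: "?X < top" .
    have "?X = (\<integral>\<^sup>+x. g n x * ?h x \<partial>M)"
      by (intro nn_integral_cong) (simp add: epowr_mult_self mult.commute[of "g n _"])
    also have "\<dots> \<le> (\<integral>\<^sup>+x. ?A x * ?h x \<partial>M)"
      by (intro nn_integral_mono mult_right_mono g_le) simp
    also have "\<dots> \<le> (\<integral>\<^sup>+x. ?B x * H x \<partial>M)"
      by (rule nn_integral_cone_integral_mono[OF M sets_M G _ _ a H]) measurable
    also have "\<dots> \<le> (\<integral>\<^sup>+x. ennreal d * H x epowr (q / (q - 1)) + ennreal (d powr - (q - 1)) * ?B x epowr q \<partial>M)"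
      by (intro nn_integral_mono epowr_Young_greater_one q d)
    also have "\<dots> = ennreal d * (\<integral>\<^sup>+x. H x epowr (q / (q - 1)) \<partial>M) + ennreal (d powr - (q - 1)) * (\<integral>\<^sup>+x. ?B x epowr q \<partial>M)"
      by (simp add: nn_integral_add nn_integral_cmult)
    also have "ennreal d * (\<integral>\<^sup>+x. H x epowr (q / (q - 1)) \<partial>M)
      \<le> ennreal d * (ennreal (C * K powr (1 / (q - 1))) * (\<integral>\<^sup>+x. ?h x epowr (q / (q - 1)) \<partial>M))"
      using H2 by (rule mult_left_mono) simp
    also have "\<dots> = ennreal (d * (C * K powr (1 / (q - 1)))) * ?X"
      using q d C by (simp add: epowr_epowr ennreal_mult mult.assoc)
    also have "\<dots> = ennreal (1 / 2) * ?X"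
      unfolding dC ..
    finally have le: "?X \<le> ennreal (1 / 2) * ?X + ennreal (d powr - (q - 1)) * (\<integral>\<^sup>+x. ?B x epowr q \<partial>M)"
      by (simp add: add_mono)
    show ?thesis
    proof (cases "ennreal (d powr - (q - 1)) * (\<integral>\<^sup>+x. ?B x epowr q \<partial>M)")
      case (real r)
      obtain x where x: "?X = ennreal x" "0 \<le> x" using X by (cases ?X) auto
      have "x \<le> 2 * r"
        using le x real by (simp add: ennreal_mult[symmetric] ennreal_plus[symmetric] del: ennreal_plus ennreal_half)
      then have "?X \<le> ennreal 2 * (ennreal (d powr - (q - 1)) * (\<integral>\<^sup>+x. ?B x epowr q \<partial>M))"
        using x real by (simp add: ennreal_mult[symmetric] del: ennreal_numeral)
      then show ?thesis
        unfolding dq using C K by (simp add: mult.assoc[symmetric] ennreal_mult[symmetric] del: ennreal_numeral)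
    next
      case top
      then have "(\<integral>\<^sup>+x. ?B x epowr q \<partial>M) = top" by (simp add: ennreal_mult_eq_top_iff)
      then show ?thesis using C K by (simp add: ennreal_mult_top)
    qed
  qed
  have "?A x epowr q \<le> (SUP n. g n x epowr q)" for x
  proof (cases "?A x")
    case (real r)
    obtain n where n: "max r (norm x) < real n" using reals_Archimedean2 by blast
    then have "g n x = ?A x"
      using real by (simp add: g_def min_def ennreal_of_nat_eq_real_of_nat)
    then show ?thesis by (metis SUP_upper UNIV_I)
  next
    case top
    obtain m where m: "norm x < real m" using reals_Archimedean2 by blast
    have "of_nat k \<le> (SUP n. g n x epowr q)" for k
    proof -
      \<comment> \<open>At least k to reach the desired size, at least m so that x lies in the ball,
        and at least 1 so that n \<le> n^q.\<close>
      let ?n = "max (max k m) 1"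
      have "real k \<le> real ?n powr 1" by simp
      also have "\<dots> \<le> real ?n powr q" using q by (intro powr_mono) auto
      finally have "of_nat k \<le> ennreal (real ?n) epowr q"
        by (simp add: epowr_ennreal ennreal_of_nat_eq_real_of_nat del: of_nat_max)
      also have "ennreal (real ?n) = g ?n x"
        using m top by (simp add: g_def ennreal_of_nat_eq_real_of_nat)
      finally show ?thesis by (meson SUP_upper2 UNIV_I)
    qed
    then have "\<not> (SUP n. g n x epowr q) < top"
      using ennreal_Ex_less_of_nat by (meson leD)
    then have SUP_top: "(SUP n. g n x epowr q) = top"
      by (simp only: less_top[symmetric] not_not)
    show ?thesis unfolding SUP_top by (rule top_greatest)
  qed
  then have "(\<integral>\<^sup>+x. ?A x epowr q \<partial>M) \<le> (\<integral>\<^sup>+x. (SUP n. g n x epowr q) \<partial>M)"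
    by (intro nn_integral_mono)
  also have "\<dots> = (SUP n. (\<integral>\<^sup>+x. g n x epowr q \<partial>M))"
  proof (rule nn_integral_monotone_convergence_SUP)
    show "incseq (\<lambda>n x. g n x epowr q)"
    proof (intro incseq_SucI le_funI)
      fix n x
      have "min (?A x) (of_nat n) \<le> min (?A x) (of_nat (Suc n))"
        by (intro min.mono of_nat_mono) auto
      then have "g n x \<le> g (Suc n) x"
        by (auto simp: g_def simp del: of_nat_Suc split: split_indicator)
      then show "g n x epowr q \<le> g (Suc n) x epowr q"
        using q by (intro epowr_mono) auto
    qed
  qed measurable
  also have "\<dots> \<le> ennreal (2 * (2 * C) powr (q - 1) * K) * (\<integral>\<^sup>+x. ?B x epowr q \<partial>M)"
    by (intro SUP_least bound)
  finally show ?thesis .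
qed

section \<open>Doubling weights\<close>

lemma measure_ball_scale:
  fixes y :: "'a::euclidean_space"
  assumes "0 \<le> c" "0 \<le> \<rho>"
  shows "measure lborel (ball y (c * \<rho>)) = c powr real DIM('a) * measure lborel (ball y \<rho>)"
  using assms by (cases "c = 0") (simp_all add: content_ball power_mult_distrib powr_realpow)

lemma measure_ball_pos: "0 < \<rho> \<Longrightarrow> 0 < measure lborel (ball (y :: 'a::euclidean_space) \<rho>)"
  by (simp add: content_ball)

lemma inverse_divide_ennreal:
  assumes "0 < m"
  shows "inverse (ennreal m / x) = x / ennreal m"
proof (cases x)
  case (real r)
  with assms show ?thesis
    by (cases "r = 0") (simp_all add: divide_ennreal inverse_ennreal)
qed (use assms in \<open>simp add: ennreal_top_divide\<close>)

lemma set_nn_integral_ge_const: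
  assumes "A \<in> sets M" "\<And>x. x \<in> A \<Longrightarrow> c \<le> f x"
  shows "c * emeasure M A \<le> (\<integral>\<^sup>+x\<in>A. f x \<partial>M)"
proof -
  have "c * emeasure M A = (\<integral>\<^sup>+x. c * indicator A x \<partial>M)"
    using assms by (simp add: nn_integral_cmult_indicator)
  also have "\<dots> \<le> (\<integral>\<^sup>+x\<in>A. f x \<partial>M)"
    using assms by (intro nn_integral_mono) (auto split: split_indicator)
  finally show ?thesis .
qed

lemma set_nn_integral_le_const:
  assumes "A \<in> sets M" "\<And>x. x \<in> A \<Longrightarrow> f x \<le> c"
  shows "(\<integral>\<^sup>+x\<in>A. f x \<partial>M) \<le> c * emeasure M A"
proof -
  have "(\<integral>\<^sup>+x\<in>A. f x \<partial>M) \<le> (\<integral>\<^sup>+x. c * indicator A x \<partial>M)"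
    using assms by (intro nn_integral_mono) (auto split: split_indicator)
  then show ?thesis using assms by (simp add: nn_integral_cmult_indicator)
qed

section \<open>Cone integrals under comparison of the masses of concentric balls\<close>

context doubling_measure
begin

lemma ball_measure:
  assumes "0 < \<rho>"
  obtains m where "emeasure M (ball y \<rho>) = ennreal m" "0 < m"
  using ball_pos[OF assms, of y] ball_finite[OF assms, of y]
  by (cases "emeasure M (ball y \<rho>)") (auto simp: less_le)

lemma cone_power_one_le:
  assumes a: "0 < a" and G [measurable]: "G \<in> borel_measurable borel"
    and le: "\<And>y t. 0 < t \<Longrightarrow> emeasure M (ball y (a * t)) \<le> ennreal K * emeasure M (ball y (b * t))"
  shows "cone_power M 1 G a \<le> ennreal K * cone_power M 1 G b"
proof -
  have "(\<integral>\<^sup>+x. cone_integral G a x * 1 \<partial>M) \<le> (\<integral>\<^sup>+x. cone_integral G b x * ennreal K \<partial>M)"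
    by (rule nn_integral_cone_integral_mono[OF sigma_finite sets_M G _ _ a])
      (use le in \<open>simp_all add: sets_M nn_integral_cmult_indicator\<close>)
  also have "\<dots> = ennreal K * (\<integral>\<^sup>+x. cone_integral G b x \<partial>M)"
    by (subst nn_integral_cmult[symmetric]) (auto simp: mult.commute)
  finally show ?thesis by simp
qed

text \<open>\<open>H\<close> is the supremum of harmonic means of \<open>f\<close> over balls shrunk
  by a/b. At every point of B(y, b t) its inverse is at most the average of 1/f over B(y, a t), so
  integrating costs only the mass ratio \<open>K\<close>. At q = 1 the quotient
  \<open>q / (1 - q)\<close> is 0, and the summand 1 of the constant already suffices.\<close>

lemma cone_integral_expand:
  assumes q: "0 < q" "q \<le> 1" and a: "0 < a" "a \<le> b" and K: "0 < K"
    and G [measurable]: "G \<in> borel_measurable borel"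
    and le: "\<And>y \<rho>. 0 < \<rho> \<Longrightarrow> emeasure M (ball y \<rho>) \<le> ennreal K * emeasure M (ball y (a / b * \<rho>))"
  shows "cone_power M q G b
    \<le> ennreal ((1 + 2 * D * (1 / 2) powr - (q / (1 - q))) * K) * cone_power M q G a"
proof (cases "q = 1")
  case True
  have "cone_power M 1 G b \<le> ennreal K * cone_power M 1 G a"
    using a le[of "b * _"] by (intro cone_power_one_le G) auto
  also have "\<dots> \<le> ennreal ((1 + 2 * D * (1 / 2) powr - (q / (1 - q))) * K) * cone_power M 1 G a"
    using K D_pos by (intro mult_right_mono ennreal_leI) (auto simp: distrib_right)
  finally show ?thesis using True by simp
next
  case False
  then have q: "0 < q" "q < 1" using q by auto
  then have q': "0 < q / (1 - q)" by simp
  have ab: "0 < a / b" "a / b \<le> 1" "0 < b" using a by auto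
  show ?thesis
  proof (rule cone_integral_le_of_less_one[OF sigma_finite sets_M q _ K _ G])
    fix f :: "'a \<Rightarrow> ennreal" assume f [measurable]: "f \<in> borel_measurable borel"
    define s where "s = (\<lambda>y \<rho>. emeasure M (ball y (a / b * \<rho>)) / (\<integral>\<^sup>+x\<in>ball y (a / b * \<rho>). inverse (f x) \<partial>M))"
    show "\<exists>H\<in>borel_measurable borel.
      (\<forall>y t. 0 < t \<longrightarrow> (\<integral>\<^sup>+x\<in>ball y (b * t). inverse (H x) \<partial>M)
        \<le> ennreal K * (\<integral>\<^sup>+x\<in>ball y (a * t). inverse (f x) \<partial>M)) \<and>
      (\<integral>\<^sup>+x. H x epowr (q / (1 - q)) \<partial>M)
        \<le> ennreal (2 * D * (1 / 2) powr - (q / (1 - q)) * K) * (\<integral>\<^sup>+x. f x epowr (q / (1 - q)) \<partial>M)"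
    proof (intro bexI[of _ "ball_sup s"] conjI allI impI)
      fix y :: 'a and t :: real assume t: "0 < t"
      let ?I = "\<integral>\<^sup>+x\<in>ball y (a * t). inverse (f x) \<partial>M"
      have abt: "a / b * (b * t) = a * t" "0 < a * t" "0 < b * t" using ab t a by auto
      obtain m where m: "emeasure M (ball y (a * t)) = ennreal m" "0 < m"
        using ball_measure[OF abt(2)] by metis
      have s: "inverse (s y (b * t)) = ?I / ennreal m"
        unfolding s_def abt m
        by (rule inverse_divide_ennreal[OF m(2)])
      have "(\<integral>\<^sup>+x\<in>ball y (b * t). inverse (ball_sup s x) \<partial>M) \<le> ?I / ennreal m * emeasure M (ball y (b * t))"
        unfolding s[symmetric]
        by (intro set_nn_integral_le_const inverse_antimono_ennreal ball_sup_upper) (simp_all add: sets_M)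
      also have "\<dots> \<le> ?I / ennreal m * (ennreal K * ennreal m)"
        using le[OF abt(3), of y] abt m by (intro mult_left_mono) auto
      also have "\<dots> = ennreal K * (?I / ennreal m * ennreal m)"
        by (simp add: mult_ac)
      also have "?I / ennreal m * ennreal m = ?I"
        using m by (simp add: ennreal_divide_times ennreal_mult_divide_eq)
      finally show "(\<integral>\<^sup>+x\<in>ball y (b * t). inverse (ball_sup s x) \<partial>M) \<le> ennreal K * ?I" .
    next
      show "(\<integral>\<^sup>+x. ball_sup s x epowr (q / (1 - q)) \<partial>M)
        \<le> ennreal (2 * D * (1 / 2) powr - (q / (1 - q)) * K) * (\<integral>\<^sup>+x. f x epowr (q / (1 - q)) \<partial>M)"
        using nn_integral_ball_sup_harmonic_le[OF q' ab(1,2) K f le]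
        unfolding s_def by (simp add: mult_ac)
    qed measurable
  qed (use ab D_pos in auto)
qed

text \<open>\<open>H\<close> is the supremum of the integrals of \<open>h\<close> over balls shrunk
  by a/b, divided by the mass of the full ball; on B(y, b t) it is at least the quotient needed
  there. With dual exponent q' the maximal bound gives \<open>K\<close> to the power q' - 1 = 1 / (q
  - 1). At q = 1 the summand 1 of the constant suffices.\<close>

lemma cone_integral_contract:
  assumes q: "1 \<le> q" and a: "0 < a" "a \<le> b" and K: "0 < K"
    and G [measurable]: "G \<in> borel_measurable borel"
    and le: "\<And>y \<rho>. 0 < \<rho> \<Longrightarrow> emeasure M (ball y (a / b * \<rho>)) \<le> ennreal K * emeasure M (ball y \<rho>)"
  shows "cone_power M q G a
    \<le> ennreal ((1 + 2 * (4 * D * q * 2 powr (1 / (q - 1))) powr (q - 1)) * K) * cone_power M q G b"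
proof (cases "q = 1")
  case True
  have "cone_power M 1 G a \<le> ennreal K * cone_power M 1 G b"
    using a le[of "b * _"] by (intro cone_power_one_le G) auto
  also have "\<dots> \<le> ennreal ((1 + 2 * (4 * D * q * 2 powr (1 / (q - 1))) powr (q - 1)) * K) * cone_power M 1 G b"
    using K D_pos by (intro mult_right_mono ennreal_leI) (auto simp: distrib_right)
  finally show ?thesis using True by simp
next
  case False
  then have q: "1 < q" using q by auto
  define q' where "q' = q / (q - 1)"
  have q': "1 < q'" "q' - 1 = 1 / (q - 1)" "q' / (q' - 1) = q"
    using q by (auto simp: q'_def field_simps)
  have ab: "0 < a / b" "a / b \<le> 1" "0 < b" using a by auto
  let ?C = "2 * D * q * 2 powr (1 / (q - 1))"
  have "cone_power M q G a
    \<le> ennreal (2 * (2 * ?C) powr (q - 1) * K) * cone_power M q G b"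
  proof (rule cone_integral_le_of_greater_one[OF sigma_finite sets_M _ q a(1) K _ G])
    show "emeasure M (ball 0 (real n)) \<noteq> \<infinity>" for n
      using ball_finite[of "real n" 0] by (cases "n = 0") auto
    show "0 < ?C" using D_pos q by simp
    fix h :: "'a \<Rightarrow> ennreal" assume h [measurable]: "h \<in> borel_measurable borel"
    define s where "s = (\<lambda>y \<rho>. (\<integral>\<^sup>+x\<in>ball y (a / b * \<rho>). h x \<partial>M) / emeasure M (ball y \<rho>))"
    show "\<exists>H\<in>borel_measurable borel.
      (\<forall>y t. 0 < t \<longrightarrow> (\<integral>\<^sup>+x\<in>ball y (a * t). h x \<partial>M) \<le> (\<integral>\<^sup>+x\<in>ball y (b * t). H x \<partial>M)) \<and>
      (\<integral>\<^sup>+x. H x epowr (q / (q - 1)) \<partial>M)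
        \<le> ennreal (?C * K powr (1 / (q - 1))) * (\<integral>\<^sup>+x. h x epowr (q / (q - 1)) \<partial>M)"
    proof (intro bexI[of _ "ball_sup s"] conjI allI impI)
      fix y :: 'a and t :: real assume t: "0 < t"
      let ?I = "\<integral>\<^sup>+x\<in>ball y (a * t). h x \<partial>M"
      have abt: "a / b * (b * t) = a * t" "0 < a * t" "0 < b * t" using ab t a by auto
      obtain m where m: "emeasure M (ball y (b * t)) = ennreal m" "0 < m"
        using ball_measure[OF abt(3)] by metis
      have "?I = ?I / ennreal m * ennreal m"
        using m by (simp add: ennreal_divide_times ennreal_mult_divide_eq)
      also have "\<dots> = s y (b * t) * emeasure M (ball y (b * t))"
        unfolding s_def abt m ..
      also have "\<dots> \<le> (\<integral>\<^sup>+x\<in>ball y (b * t). ball_sup s x \<partial>M)"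
        by (intro set_nn_integral_ge_const ball_sup_upper) (simp_all add: sets_M)
      finally show "?I \<le> (\<integral>\<^sup>+x\<in>ball y (b * t). ball_sup s x \<partial>M)" .
    next
      have "(\<integral>\<^sup>+x. ball_sup s x epowr q' \<partial>M)
        \<le> ennreal (2 * D * q' / (q' - 1) * (2 * K) powr (q' - 1)) * (\<integral>\<^sup>+x. h x epowr q' \<partial>M)"
        unfolding s_def by (rule nn_integral_ball_sup_average_le[OF q'(1) ab(1,2) K h le])
      also have "2 * D * q' / (q' - 1) * (2 * K) powr (q' - 1) = ?C * K powr (1 / (q - 1))"
      proof -
        have "2 * D * q' / (q' - 1) = 2 * D * q" using q'(3) by (metis times_divide_eq_right)
        then show ?thesis using K by (simp add: q'(2) powr_mult)
      qed
      finally show "(\<integral>\<^sup>+x. ball_sup s x epowr (q / (q - 1)) \<partial>M)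
        \<le> ennreal (?C * K powr (1 / (q - 1))) * (\<integral>\<^sup>+x. h x epowr (q / (q - 1)) \<partial>M)"
        by (simp add: q'_def)
    qed measurable
  qed
  also have "\<dots> \<le> ennreal ((1 + 2 * (4 * D * q * 2 powr (1 / (q - 1))) powr (q - 1)) * K) * cone_power M q G b"
    using K by (intro mult_right_mono ennreal_leI) (auto simp: mult.assoc)
  finally show ?thesis .
qed

end

section \<open>Weights as densities of Borel measures\<close>

definition weighted :: "('a::euclidean_space \<Rightarrow> real) \<Rightarrow> 'a measure" where
  "weighted w = density lborel (\<lambda>x. ennreal (w x))"

lemma sets_weighted [simp, measurable_cong]: "sets (weighted w) = sets borel"
  by (simp add: weighted_def)

lemma weighted_one: "weighted (\<lambda>x. 1) = lborel"
  by (simp add: weighted_def density_1)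

lemma nn_integral_weighted:
  assumes [measurable]: "w \<in> borel_measurable borel" "f \<in> borel_measurable borel"
  shows "(\<integral>\<^sup>+x. f x \<partial>weighted w) = (\<integral>\<^sup>+x. f x * ennreal (w x) \<partial>lborel)"
  unfolding weighted_def by (subst nn_integral_density) (auto simp: mult.commute)

lemma emeasure_weighted:
  assumes [measurable]: "w \<in> borel_measurable borel" "A \<in> sets borel"
  shows "emeasure (weighted w) A = (\<integral>\<^sup>+x\<in>A. ennreal (w x) \<partial>lborel)"
  unfolding weighted_def by (subst emeasure_density) auto

lemma measure_weighted_mono:
  assumes [measurable]: "u \<in> borel_measurable borel" "v \<in> borel_measurable borel" "A \<in> sets borel"
    and le: "\<And>x. x \<in> A \<Longrightarrow> c * u x \<le> v x" and c: "0 \<le> c"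
    and fin: "emeasure (weighted v) A \<noteq> \<infinity>"
  shows "c * measure (weighted u) A \<le> measure (weighted v) A"
proof -
  have "ennreal c * emeasure (weighted u) A = (\<integral>\<^sup>+x. ennreal c * (ennreal (u x) * indicator A x) \<partial>lborel)"
    by (subst nn_integral_cmult) (auto simp: emeasure_weighted)
  also have "\<dots> \<le> emeasure (weighted v) A"
    unfolding emeasure_weighted[OF assms(2,3)]
    using le c by (intro nn_integral_mono) (auto split: split_indicator simp: ennreal_mult'[symmetric] intro: ennreal_leI)
  finally have "enn2real (ennreal c * emeasure (weighted u) A) \<le> enn2real (emeasure (weighted v) A)"
    using fin by (intro enn2real_mono) (auto simp: less_top)
  then show ?thesis using c by (simp add: measure_def enn2real_mult)
qed

text \<open>Borel measurability and positivity everywhere are a normalization: every weight has such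
  a representative up to a null set, and all norms involved are insensitive to the change.\<close>

locale local_weight =
  fixes w :: "'a::euclidean_space \<Rightarrow> real"
  assumes w_meas [measurable]: "w \<in> borel_measurable borel"
    and w_pos: "\<And>x. 0 < w x"
    and w_fin: "\<And>y \<rho>. emeasure (weighted w) (ball y \<rho>) \<noteq> \<infinity>"
begin

lemma subset_ball_fin: "A \<subseteq> ball y \<rho> \<Longrightarrow> emeasure (weighted w) A \<noteq> \<infinity>"
  using emeasure_mono[of A "ball y \<rho>" "weighted w"] w_fin[of y \<rho>] by (auto simp: top_unique)

lemma measure_subset_ball_le:
  assumes "A \<in> sets borel" "A \<subseteq> ball y \<rho>"
  shows "measure (weighted w) A \<le> measure (weighted w) (ball y \<rho>)"
  using assms w_fin[of y \<rho>]
  by (intro measure_mono_fmeasurable) (auto simp: fmeasurable_def less_top[symmetric])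

lemma emeasure_ball_weighted: "emeasure (weighted w) (ball y \<rho>) = ennreal (measure (weighted w) (ball y \<rho>))"
  using w_fin[of y \<rho>] by (intro emeasure_eq_ennreal_measure) simp

lemma emeasure_ball_weighted_pos: "0 < \<rho> \<Longrightarrow> emeasure (weighted w) (ball y \<rho>) \<noteq> 0"
proof
  assume "0 < \<rho>" "emeasure (weighted w) (ball y \<rho>) = 0"
  then have "AE x in lborel. ennreal (w x) * indicator (ball y \<rho>) x = 0"
    by (simp add: emeasure_weighted nn_integral_0_iff_AE)
  then have "AE x in lborel. x \<notin> ball y \<rho>"
  proof eventually_elim
    case (elim x)
    then show ?case
      using w_pos[of x] by (auto simp: indicator_def ennreal_eq_0_iff split: if_splits)
  qed
  then have "ball y \<rho> \<in> null_sets lborel"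
    by (subst (asm) AE_iff_null_sets[symmetric]) auto
  then show False
    using measure_ball_pos[OF \<open>0 < \<rho>\<close>, of y] by (simp add: null_sets_def measure_def)
qed

lemma measure_ball_weighted_pos: "0 < \<rho> \<Longrightarrow> 0 < measure (weighted w) (ball y \<rho>)"
  using emeasure_ball_weighted_pos[of \<rho> y] by (simp add: emeasure_ball_weighted less_le)

lemma doubling_measure_weighted:
  assumes "\<And>y \<rho>. 0 < \<rho> \<Longrightarrow> measure (weighted w) (ball y (5 * \<rho>)) \<le> D * measure (weighted w) (ball y \<rho>)" "0 < D"
  shows "doubling_measure (weighted w) D"
proof
  show "emeasure (weighted w) (ball y (5 * \<rho>)) \<le> ennreal D * emeasure (weighted w) (ball y \<rho>)"
    if "0 < \<rho>" for y \<rho>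
    using assms(1)[OF that, of y] assms(2)
    by (simp add: emeasure_ball_weighted ennreal_mult[symmetric])
qed (use assms w_fin emeasure_ball_weighted_pos in auto)

end

section \<open>Muckenhoupt weights\<close>

lemma powr_le_imp_le_powr_inverse:
  fixes x :: real
  assumes "x powr p \<le> y" "0 < p" "0 \<le> x"
  shows "x \<le> y powr (1 / p)"
proof -
  have "(x powr p) powr (1 / p) \<le> y powr (1 / p)"
    using assms by (intro powr_mono2) auto
  then show ?thesis using assms by (simp add: powr_powr)
qed

lemma ennreal_mult_regroup: "0 \<le> v \<Longrightarrow> ennreal u * X * ennreal v = ennreal (u * v) * X"
  by (simp add: ennreal_mult'' mult_ac)

text \<open>The Muckenhoupt condition for r > 1 multiplied by the r-th power of the volume. The
  exponent of the dual weight is 1 - r' = -1 / (r - 1).\<close>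

locale Ar_weight = local_weight w for w :: "'a::euclidean_space \<Rightarrow> real" +
  fixes r C :: real
  assumes r: "1 < r" and C_pos: "0 < C"
    and dual_fin: "\<And>y \<rho>. emeasure (weighted (\<lambda>x. w x powr (- (1 / (r - 1))))) (ball y \<rho>) \<noteq> \<infinity>"
    and Ar: "\<And>y \<rho>. 0 < \<rho> \<Longrightarrow> measure (weighted w) (ball y \<rho>)
      * measure (weighted (\<lambda>x. w x powr (- (1 / (r - 1))))) (ball y \<rho>) powr (r - 1)
      \<le> C * measure lborel (ball y \<rho>) powr r"
begin

abbreviation \<sigma> :: "'a \<Rightarrow> real" where "\<sigma> \<equiv> \<lambda>x. w x powr (- (1 / (r - 1)))"

abbreviation V :: "'a \<Rightarrow> real \<Rightarrow> real" where "V y \<rho> \<equiv> measure lborel (ball y \<rho>)"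
abbreviation W :: "'a \<Rightarrow> real \<Rightarrow> real" where "W y \<rho> \<equiv> measure (weighted w) (ball y \<rho>)"
abbreviation S :: "'a \<Rightarrow> real \<Rightarrow> real" where "S y \<rho> \<equiv> measure (weighted \<sigma>) (ball y \<rho>)"

sublocale dual: local_weight \<sigma>
proof
  show "0 < \<sigma> x" for x
    using w_pos[of x] by simp
qed (use dual_fin in auto)

lemma Chebyshev_upper:
  assumes T: "0 < T"
  shows "T * measure lborel {x \<in> ball y \<rho>. T < w x} \<le> W y \<rho>"
proof -
  have [measurable]: "{x \<in> ball y \<rho>. T < w x} \<in> sets borel" by measurable
  have "T * measure (weighted (\<lambda>x. 1)) {x \<in> ball y \<rho>. T < w x} \<le> measure (weighted w) {x \<in> ball y \<rho>. T < w x}"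
    using T by (intro measure_weighted_mono subset_ball_fin[of _ y \<rho>]) auto
  also have "\<dots> \<le> W y \<rho>"
    by (rule measure_subset_ball_le) auto
  finally show ?thesis by (simp add: weighted_one)
qed

text \<open>Chebyshev's inequality for the dual weight, which is large exactly where
  \<open>w\<close> is small.\<close>

lemma Chebyshev_lower:
  assumes T: "0 < T"
  shows "measure lborel {x \<in> ball y \<rho>. w x \<le> T} \<le> T powr (1 / (r - 1)) * S y \<rho>"
proof -
  have [measurable]: "{x \<in> ball y \<rho>. w x \<le> T} \<in> sets borel" by measurable
  have "T powr (- (1 / (r - 1))) * measure (weighted (\<lambda>x. 1)) {x \<in> ball y \<rho>. w x \<le> T}
    \<le> measure (weighted \<sigma>) {x \<in> ball y \<rho>. w x \<le> T}"
  proof (intro measure_weighted_mono dual.subset_ball_fin[of _ y \<rho>])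
    show "T powr (- (1 / (r - 1))) * 1 \<le> \<sigma> x" if "x \<in> {x \<in> ball y \<rho>. w x \<le> T}" for x
      using that T r w_pos[of x] by (auto intro!: powr_mono2' simp: divide_le_0_iff)
  qed auto
  also have "\<dots> \<le> S y \<rho>"
    by (rule dual.measure_subset_ball_le) auto
  finally have "T powr (1 / (r - 1)) * (T powr (- (1 / (r - 1))) * measure lborel {x \<in> ball y \<rho>. w x \<le> T})
    \<le> T powr (1 / (r - 1)) * S y \<rho>"
    by (intro mult_left_mono) (auto simp: weighted_one)
  then show ?thesis
    using T by (simp add: mult.assoc[symmetric] powr_add[symmetric])
qed

text \<open>The Hoelder inequality opposite to \<open>Ar\<close>, up to the factor
  \<open>2 powr r\<close>. At the threshold of twice the mean, \<open>w\<close> exceeds it on at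
  most half of the ball; on the rest the dual weight is bounded below.\<close>

lemma volume_le:
  assumes \<rho>: "0 < \<rho>"
  shows "V y \<rho> powr r \<le> 2 powr r * (W y \<rho> * S y \<rho> powr (r - 1))"
proof -
  define T where "T = 2 * W y \<rho> / V y \<rho>"
  have pos: "0 < V y \<rho>" "0 < W y \<rho>" "0 < S y \<rho>"
    using \<rho> by (auto intro: measure_ball_pos measure_ball_weighted_pos dual.measure_ball_weighted_pos)
  then have T: "0 < T" by (simp add: T_def)
  have sets: "{x \<in> ball y \<rho>. T < w x} \<in> sets borel" "{x \<in> ball y \<rho>. w x \<le> T} \<in> sets borel"
    by measurable
  have "V y \<rho> = measure lborel ({x \<in> ball y \<rho>. T < w x} \<union> {x \<in> ball y \<rho>. w x \<le> T})"
    by (rule arg_cong[of _ _ "measure lborel"]) auto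
  also have "\<dots> \<le> measure lborel {x \<in> ball y \<rho>. T < w x} + measure lborel {x \<in> ball y \<rho>. w x \<le> T}"
    using sets by (intro measure_Un_le) simp_all
  finally have "V y \<rho> \<le> measure lborel {x \<in> ball y \<rho>. T < w x} + measure lborel {x \<in> ball y \<rho>. w x \<le> T}" .
  moreover have "measure lborel {x \<in> ball y \<rho>. T < w x} \<le> V y \<rho> / 2"
    using Chebyshev_upper[OF T, of y \<rho>] pos by (simp add: T_def field_simps)
  ultimately have "V y \<rho> / 2 \<le> T powr (1 / (r - 1)) * S y \<rho>"
    using Chebyshev_lower[OF T, of y \<rho>] by linarith
  then have "(V y \<rho> / 2) powr (r - 1) \<le> (T powr (1 / (r - 1)) * S y \<rho>) powr (r - 1)"
    using r pos by (intro powr_mono2) auto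
  also have "\<dots> = T * S y \<rho> powr (r - 1)"
    using r pos T by (simp add: powr_mult powr_powr)
  finally have "(V y \<rho> / 2) powr (r - 1) * (V y \<rho> / 2) \<le> T * S y \<rho> powr (r - 1) * (V y \<rho> / 2)"
    using pos by (intro mult_right_mono) auto
  also have "\<dots> = W y \<rho> * S y \<rho> powr (r - 1)"
    using pos by (simp add: T_def)
  also have "(V y \<rho> / 2) powr (r - 1) * (V y \<rho> / 2) = V y \<rho> powr r / 2 powr r"
    using pos by (simp add: powr_diff powr_divide)
  finally show ?thesis by (simp add: field_simps)
qed

lemma dual_mass_le:
  assumes \<rho>: "0 < \<rho>"
  shows "S y \<rho> \<le> (C / (W y \<rho> / V y \<rho>)) powr (1 / (r - 1)) * V y \<rho>"
proof -
  have pos: "0 < V y \<rho>" "0 < W y \<rho>" "0 < S y \<rho>"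
    using \<rho> by (auto intro: measure_ball_pos measure_ball_weighted_pos dual.measure_ball_weighted_pos)
  have "S y \<rho> powr (r - 1) \<le> C * V y \<rho> powr r / W y \<rho>"
    using Ar[OF \<rho>, of y] pos by (simp add: field_simps)
  also have "\<dots> = C / (W y \<rho> / V y \<rho>) * V y \<rho> powr (r - 1)"
    using pos by (simp add: powr_diff)
  finally have "S y \<rho> \<le> (C / (W y \<rho> / V y \<rho>) * V y \<rho> powr (r - 1)) powr (1 / (r - 1))"
    using r pos by (intro powr_le_imp_le_powr_inverse) auto
  also have "\<dots> = (C / (W y \<rho> / V y \<rho>)) powr (1 / (r - 1)) * (V y \<rho> powr (r - 1)) powr (1 / (r - 1))"
    by (rule powr_mult)
  also have "(V y \<rho> powr (r - 1)) powr (1 / (r - 1)) = V y \<rho>"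
    using r pos by (simp add: powr_powr)
  finally show ?thesis .
qed

text \<open>\<open>Ar\<close> on the large ball, scaling of the volume and \<open>volume_le\<close>
  on the small ball compare the products of \<open>w\<close>-mass and dual mass to the power r - 1.
  Since each factor grows with the ball, one of them can be cancelled, leaving the bound for the
  other.\<close>

lemma mass_scale:
  assumes \<rho>: "0 < \<rho>" and \<tau>: "0 < \<tau>" "\<tau> \<le> 1"
  shows "W y \<rho> \<le> 2 powr r * C * (1 / \<tau>) powr (real DIM('a) * r) * W y (\<tau> * \<rho>)"
    and "S y \<rho> \<le> (2 powr r * C * (1 / \<tau>) powr (real DIM('a) * r)) powr (1 / (r - 1)) * S y (\<tau> * \<rho>)"
proof -
  have \<tau>\<rho>: "0 < \<tau> * \<rho>" "\<tau> * \<rho> \<le> \<rho>" using \<rho> \<tau> by (auto simp: mult_left_le_one_le)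
  have pos: "0 < V y \<rho>" "0 < W y \<rho>" "0 < S y \<rho>" "0 < V y (\<tau> * \<rho>)" "0 < W y (\<tau> * \<rho>)" "0 < S y (\<tau> * \<rho>)"
    using \<rho> \<tau>\<rho> by (auto intro: measure_ball_pos measure_ball_weighted_pos dual.measure_ball_weighted_pos)
  have sub: "W y (\<tau> * \<rho>) \<le> W y \<rho>" "S y (\<tau> * \<rho>) \<le> S y \<rho>"
    using \<tau>\<rho> by (auto intro!: measure_subset_ball_le dual.measure_subset_ball_le)
  let ?K = "2 powr r * C * (1 / \<tau>) powr (real DIM('a) * r)"
  have "V y \<rho> = (1 / \<tau>) powr real DIM('a) * V y (\<tau> * \<rho>)"
    using measure_ball_scale[of "1 / \<tau>" "\<tau> * \<rho>" y] \<tau> \<rho> by simp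
  then have "V y \<rho> powr r = (1 / \<tau>) powr (real DIM('a) * r) * V y (\<tau> * \<rho>) powr r"
    by (simp add: powr_mult powr_powr)
  also have "\<dots> \<le> (1 / \<tau>) powr (real DIM('a) * r) * (2 powr r * (W y (\<tau> * \<rho>) * S y (\<tau> * \<rho>) powr (r - 1)))"
    by (intro mult_left_mono volume_le \<tau>\<rho>) auto
  finally have "C * V y \<rho> powr r \<le> C * ((1 / \<tau>) powr (real DIM('a) * r) * (2 powr r * (W y (\<tau> * \<rho>) * S y (\<tau> * \<rho>) powr (r - 1))))"
    using C_pos by (intro mult_left_mono) auto
  then have le: "W y \<rho> * S y \<rho> powr (r - 1) \<le> ?K * (W y (\<tau> * \<rho>) * S y (\<tau> * \<rho>) powr (r - 1))"
    using Ar[OF \<rho>, of y] by (simp add: mult_ac)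
  have "W y \<rho> * S y (\<tau> * \<rho>) powr (r - 1) \<le> W y \<rho> * S y \<rho> powr (r - 1)"
    using sub pos r by (intro mult_left_mono powr_mono2) auto
  also note le
  finally show "W y \<rho> \<le> ?K * W y (\<tau> * \<rho>)" using pos by (simp add: mult.assoc[symmetric])
  have "W y (\<tau> * \<rho>) * S y \<rho> powr (r - 1) \<le> W y \<rho> * S y \<rho> powr (r - 1)"
    using sub pos r by (intro mult_right_mono) auto
  also note le
  also have "?K * (W y (\<tau> * \<rho>) * S y (\<tau> * \<rho>) powr (r - 1)) = W y (\<tau> * \<rho>) * (?K * S y (\<tau> * \<rho>) powr (r - 1))"
    by (simp add: mult_ac)
  finally have "S y \<rho> powr (r - 1) \<le> ?K * S y (\<tau> * \<rho>) powr (r - 1)" using pos by simp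
  then have "S y \<rho> \<le> (?K * S y (\<tau> * \<rho>) powr (r - 1)) powr (1 / (r - 1))"
    using r pos by (intro powr_le_imp_le_powr_inverse) auto
  also have "\<dots> = ?K powr (1 / (r - 1)) * S y (\<tau> * \<rho>)"
    using r pos C_pos by (simp add: powr_mult powr_powr)
  finally show "S y \<rho> \<le> ?K powr (1 / (r - 1)) * S y (\<tau> * \<rho>)" .
qed

definition doubling_const :: real where
  "doubling_const = 2 powr r * C * 5 powr (real DIM('a) * r)"

lemma doubling_const_pos: "0 < doubling_const"
  using C_pos by (simp add: doubling_const_def)

lemma doubling: "doubling_measure (weighted w) doubling_const"
proof (rule doubling_measure_weighted[OF _ doubling_const_pos])
  show "W y (5 * \<rho>) \<le> doubling_const * W y \<rho>" if "0 < \<rho>" for y \<rho>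
    using mass_scale(1)[of "5 * \<rho>" "1 / 5" y] that by (simp add: doubling_const_def)
qed

lemma dual_doubling: "doubling_measure (weighted \<sigma>) (doubling_const powr (1 / (r - 1)))"
proof (rule dual.doubling_measure_weighted)
  show "S y (5 * \<rho>) \<le> doubling_const powr (1 / (r - 1)) * S y \<rho>" if "0 < \<rho>" for y \<rho>
    using mass_scale(2)[of "5 * \<rho>" "1 / 5" y] that by (simp add: doubling_const_def)
qed (use doubling_const_pos in simp)

section \<open>Points where the weight is comparable to its mean\<close>

definition lower_const :: real where "lower_const = 4 powr - (r - 1) / C"

lemma lower_const_pos: "0 < lower_const"
  using C_pos by (simp add: lower_const_def)

text \<open>Both thresholds are set so that each exceptional part has at most a quarter of the
  volume: 4 by Chebyshev for \<open>w\<close>, and \<open>lower_const\<close> by Chebyshev for the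
  dual weight together with \<open>dual_mass_le\<close>.\<close>

definition typical :: "'a \<Rightarrow> real \<Rightarrow> 'a set" where
  "typical y \<rho> = {x \<in> ball y \<rho>. lower_const * (W y \<rho> / V y \<rho>) < w x \<and> w x \<le> 4 * (W y \<rho> / V y \<rho>)}"

lemma typical_borel [measurable, simp]: "typical y \<rho> \<in> sets borel"
  unfolding typical_def by measurable

lemma typical_subset: "typical y \<rho> \<subseteq> ball y \<rho>"
  by (auto simp: typical_def)

lemma measure_typical:
  assumes \<rho>: "0 < \<rho>"
  shows "V y \<rho> / 2 \<le> measure lborel (typical y \<rho>)"
proof -
  define m where "m = W y \<rho> / V y \<rho>"
  have pos: "0 < V y \<rho>" "0 < W y \<rho>"
    using \<rho> by (auto intro: measure_ball_pos measure_ball_weighted_pos)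
  then have m: "0 < m" by (simp add: m_def)
  let ?X = "{x \<in> ball y \<rho>. 4 * m < w x}" and ?Y = "{x \<in> ball y \<rho>. w x \<le> lower_const * m}"
  have sets: "?X \<in> sets lborel" "?Y \<in> sets lborel" "typical y \<rho> \<in> sets lborel" "?X \<union> ?Y \<in> sets lborel"
    by measurable
  have "V y \<rho> = measure lborel ((?X \<union> ?Y) \<union> typical y \<rho>)"
    by (rule arg_cong[of _ _ "measure lborel"]) (auto simp: typical_def m_def)
  also have "\<dots> \<le> measure lborel (?X \<union> ?Y) + measure lborel (typical y \<rho>)"
    by (rule measure_Un_le[OF sets(4,3)])
  also have "measure lborel (?X \<union> ?Y) \<le> measure lborel ?X + measure lborel ?Y"
    using sets by (intro measure_Un_le)
  also have "measure lborel ?X \<le> V y \<rho> / 4"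
    using Chebyshev_upper[of "4 * m" y \<rho>] m pos by (simp add: m_def field_simps)
  also have "measure lborel ?Y \<le> (lower_const * m) powr (1 / (r - 1)) * S y \<rho>"
    using m lower_const_pos by (intro Chebyshev_lower) simp
  also have "\<dots> \<le> (lower_const * m) powr (1 / (r - 1)) * ((C / m) powr (1 / (r - 1)) * V y \<rho>)"
    unfolding m_def by (intro mult_left_mono dual_mass_le[OF \<rho>]) simp
  also have "\<dots> = (lower_const * m * (C / m)) powr (1 / (r - 1)) * V y \<rho>"
    using m C_pos lower_const_pos by (simp add: powr_mult powr_divide)
  also have "lower_const * m * (C / m) = 4 powr - (r - 1)"
    using m C_pos by (simp add: lower_const_def)
  also have "(4 powr - (r - 1)) powr (1 / (r - 1)) = 4 powr (- 1)"
    using r unfolding powr_powr by (intro arg_cong[of _ _ "\<lambda>u. 4 powr u"]) (simp add: field_simps)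
  finally show ?thesis by (simp add: powr_minus)
qed

text \<open>The upper bound for \<open>w\<close> on typical points is a lower bound for
  \<open>\<sigma>\<close> there, and \<open>dual_mass_le\<close> says that the mean of
  \<open>\<sigma>\<close> over the whole ball is not larger than a multiple of it.\<close>

lemma dual_measure_typical:
  assumes \<rho>: "0 < \<rho>"
  shows "S y \<rho> \<le> 2 * (4 * C) powr (1 / (r - 1)) * measure (weighted \<sigma>) (typical y \<rho>)"
proof -
  define m where "m = W y \<rho> / V y \<rho>"
  have pos: "0 < V y \<rho>" "0 < W y \<rho>"
    using \<rho> by (auto intro: measure_ball_pos measure_ball_weighted_pos)
  then have m: "0 < m" by (simp add: m_def)
  have "(4 * m) powr (- (1 / (r - 1))) * measure (weighted (\<lambda>x. 1)) (typical y \<rho>) \<le> measure (weighted \<sigma>) (typical y \<rho>)"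
  proof (intro measure_weighted_mono dual.subset_ball_fin[OF typical_subset])
    show "(4 * m) powr (- (1 / (r - 1))) * 1 \<le> \<sigma> x" if "x \<in> typical y \<rho>" for x
      using that m r w_pos[of x] by (auto intro!: powr_mono2' simp: divide_le_0_iff typical_def m_def)
  qed auto
  then have "(4 * m) powr (- (1 / (r - 1))) * (V y \<rho> / 2) \<le> measure (weighted \<sigma>) (typical y \<rho>)"
    using mult_left_mono[OF measure_typical[OF \<rho>, of y], of "(4 * m) powr (- (1 / (r - 1)))"]
    by (simp add: weighted_one)
  then have "2 * (4 * C) powr (1 / (r - 1)) * ((4 * m) powr (- (1 / (r - 1))) * (V y \<rho> / 2))
    \<le> 2 * (4 * C) powr (1 / (r - 1)) * measure (weighted \<sigma>) (typical y \<rho>)"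
    by (intro mult_left_mono) auto
  also have "2 * (4 * C) powr (1 / (r - 1)) * ((4 * m) powr (- (1 / (r - 1))) * (V y \<rho> / 2)) = (C / m) powr (1 / (r - 1)) * V y \<rho>"
  proof -
    have "C / m = (4 * C) / (4 * m)" by simp
    then have "(C / m) powr (1 / (r - 1)) = (4 * C) powr (1 / (r - 1)) / (4 * m) powr (1 / (r - 1))"
      using C_pos m by (simp only: powr_divide)
    moreover have "(4 * m) powr (- (1 / (r - 1))) = 1 / (4 * m) powr (1 / (r - 1))"
      using powr_minus_divide[of "4 * m" "1 / (r - 1)"] by simp
    ultimately show ?thesis by simp
  qed
  finally show ?thesis
    using dual_mass_le[OF \<rho>, of y] unfolding m_def by linarith
qed

text \<open>On a large part of every ball \<open>w\<close> is comparable to its average over the ball. Trading this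
  average for \<open>w\<close> itself reduces the term below, a sup over balls in \<open>L\<^sup>p(\<sigma>)\<close>, to the maximal
  function of \<open>h\<close> in \<open>L\<^sup>p(w)\<close>.\<close>

definition ball_term :: "real \<Rightarrow> ('a \<Rightarrow> ennreal) \<Rightarrow> 'a \<Rightarrow> real \<Rightarrow> ennreal" where
  "ball_term \<kappa> h y \<rho> = ennreal ((W y \<rho> / V y \<rho>) powr \<kappa>)
    * ((\<integral>\<^sup>+x\<in>ball y \<rho>. h x \<partial>weighted w) / emeasure (weighted w) (ball y \<rho>))"

lemma nn_integral_ball_term_le:
  assumes p: "1 < p" and \<kappa>: "0 < \<kappa>" "\<kappa> * p = r / (r - 1)"
  obtains A where "0 < A" "\<And>h. h \<in> borel_measurable borel \<Longrightarrow>
    (\<integral>\<^sup>+x. ball_sup (ball_term \<kappa> h) x epowr p \<partial>weighted \<sigma>) \<le> ennreal A * (\<integral>\<^sup>+x. h x epowr p \<partial>weighted w)"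
proof -
  interpret W: doubling_measure "weighted w" doubling_const by (rule doubling)
  interpret S: doubling_measure "weighted \<sigma>" "doubling_const powr (1 / (r - 1))" by (rule dual_doubling)
  let ?A1 = "2 * doubling_const * p / (p - 1) * (2 * 1) powr (p - 1)"
  let ?A2 = "doubling_const powr (1 / (r - 1)) * (2 * (4 * C) powr (1 / (r - 1))) * (lower_const powr \<kappa>) powr - p"
  have A: "0 < ?A1" "0 < ?A2"
    using p doubling_const_pos C_pos lower_const_pos by auto
  show thesis
  proof (rule that)
    show "0 < ?A2 * ?A1" by (rule mult_pos_pos[OF A(2) A(1)])
    fix h :: "'a \<Rightarrow> ennreal" assume h [measurable]: "h \<in> borel_measurable borel"
    define s where "s = (\<lambda>y \<rho>. (\<integral>\<^sup>+x\<in>ball y (1 * \<rho>). h x \<partial>weighted w) / emeasure (weighted w) (ball y \<rho>))"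
    \<comment> \<open>By \<open>\<kappa> * p = r / (r - 1)\<close> the product of
      \<open>w powr (\<kappa> * p)\<close> and \<open>\<sigma>\<close> is \<open>w\<close>. Hence
      \<open>g\<close> has the same norm with respect to \<open>\<sigma>\<close> as the maximal
      function has with respect to \<open>w\<close>. On typical points the mean of \<open>w\<close>
      is at most \<open>w / lower_const\<close>, which is how the factor
      \<open>w x powr \<kappa>\<close> enters.\<close>
    define g where "g = (\<lambda>x. ball_sup s x * ennreal (w x powr \<kappa>))"
    have [measurable]: "g \<in> borel_measurable borel" unfolding g_def by measurable
    have "(\<integral>\<^sup>+x. ball_sup (ball_term \<kappa> h) x epowr p \<partial>weighted \<sigma>) \<le> ennreal ?A2 * (\<integral>\<^sup>+x. g x epowr p \<partial>weighted \<sigma>)"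
    proof (rule S.nn_integral_ball_sup_le)
      fix y :: 'a and \<rho> l :: real
      assume \<rho>: "0 < \<rho>" and l: "0 < l" and less: "ennreal l < ball_term \<kappa> h y \<rho>"
      have pos: "0 < V y \<rho>" "0 < W y \<rho>"
        using \<rho> by (auto intro: measure_ball_pos measure_ball_weighted_pos)
      have sub: "typical y \<rho> \<subseteq> ball y \<rho> \<inter> {x. ennreal (lower_const powr \<kappa> * l) < g x}"
      proof
        fix x assume x: "x \<in> typical y \<rho>"
        then have xB: "x \<in> ball y \<rho>" using typical_subset by blast
        have "ennreal (lower_const powr \<kappa> * l) = ennreal (lower_const powr \<kappa>) * ennreal l"
          using l by (simp add: ennreal_mult)
        also have "\<dots> < ennreal (lower_const powr \<kappa>) * ball_term \<kappa> h y \<rho>"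
          using less lower_const_pos by (intro ennreal_mult_strict_left_mono) auto
        also have "\<dots> = ennreal ((lower_const * (W y \<rho> / V y \<rho>)) powr \<kappa>) * s y \<rho>"
        proof -
          have "(lower_const * (W y \<rho> / V y \<rho>)) powr \<kappa> = lower_const powr \<kappa> * (W y \<rho> / V y \<rho>) powr \<kappa>"
            by (rule powr_mult)
          then show ?thesis
            by (simp only: ball_term_def s_def ennreal_mult[OF powr_ge_zero powr_ge_zero] mult.assoc mult_1)
        qed
        also have "\<dots> \<le> ennreal (w x powr \<kappa>) * ball_sup s x"
          using x xB \<kappa> pos lower_const_pos
          by (intro mult_mono ball_sup_upper ennreal_leI powr_mono2) (auto simp: typical_def)
        finally show "x \<in> ball y \<rho> \<inter> {x. ennreal (lower_const powr \<kappa> * l) < g x}"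
          using xB by (simp add: g_def mult.commute)
      qed
      have "emeasure (weighted \<sigma>) (ball y \<rho>)
        \<le> ennreal (2 * (4 * C) powr (1 / (r - 1))) * ennreal (measure (weighted \<sigma>) (typical y \<rho>))"
        using dual_measure_typical[OF \<rho>, of y] C_pos
        by (simp add: dual.emeasure_ball_weighted ennreal_mult[symmetric])
      also have "ennreal (measure (weighted \<sigma>) (typical y \<rho>)) = emeasure (weighted \<sigma>) (typical y \<rho>)"
        using dual.subset_ball_fin[OF typical_subset, of y \<rho>] by (simp add: emeasure_eq_ennreal_measure)
      also have "\<dots> \<le> emeasure (weighted \<sigma>) (ball y \<rho> \<inter> {x. ennreal (lower_const powr \<kappa> * l) < g x})"
      proof (rule emeasure_mono[OF sub])
        have "{x. ennreal (lower_const powr \<kappa> * l) < g x} \<in> sets borel" by measurable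
        then show "ball y \<rho> \<inter> {x. ennreal (lower_const powr \<kappa> * l) < g x} \<in> sets (weighted \<sigma>)"
          by (simp add: sets.Int)
      qed
      finally show "emeasure (weighted \<sigma>) (ball y \<rho>) \<le> ennreal (2 * (4 * C) powr (1 / (r - 1)))
        * emeasure (weighted \<sigma>) (ball y \<rho> \<inter> {x. ennreal (lower_const powr \<kappa> * l) < g x})"
        by (simp add: mult_left_mono)
    qed (use p C_pos lower_const_pos in auto)
    also have "(\<integral>\<^sup>+x. g x epowr p \<partial>weighted \<sigma>) = (\<integral>\<^sup>+x. ball_sup s x epowr p \<partial>weighted w)"
    proof -
      have "g x epowr p * ennreal (\<sigma> x) = ball_sup s x epowr p * ennreal (w x)" for x
      proof -
        have "w x powr (\<kappa> * p) * \<sigma> x = w x powr (\<kappa> * p + - (1 / (r - 1)))"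
          by (simp only: powr_add)
        also have "\<kappa> * p + - (1 / (r - 1)) = 1"
          unfolding \<kappa> using r by (simp add: diff_divide_distrib[symmetric])
        finally have "w x powr (\<kappa> * p) * \<sigma> x = w x" using w_pos[of x] by simp
        then show ?thesis
          using p by (simp add: g_def epowr_mult epowr_ennreal powr_powr mult.assoc ennreal_mult[symmetric])
      qed
      then show ?thesis by (simp add: nn_integral_weighted)
    qed
    also have "\<dots> \<le> ennreal ?A1 * (\<integral>\<^sup>+x. h x epowr p \<partial>weighted w)"
      unfolding s_def by (rule W.nn_integral_ball_sup_average_le[OF p _ _ _ h]) auto
    finally show "(\<integral>\<^sup>+x. ball_sup (ball_term \<kappa> h) x epowr p \<partial>weighted \<sigma>)
      \<le> ennreal (?A2 * ?A1) * (\<integral>\<^sup>+x. h x epowr p \<partial>weighted w)"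
      unfolding ennreal_mult[OF less_imp_le[OF A(2)] less_imp_le[OF A(1)]]
      by (simp only: mult.assoc mult_left_mono zero_le)
  qed
qed

text \<open>It suffices to integrate over the typical points of the small ball: they also lie in the
  large ball, whose term thus bounds the supremum from below, and there
  \<open>w powr (1 - \<kappa>)\<close> is at least a multiple of the corresponding power of the mean
  \<open>ma\<close>. \<open>L\<close> is the volume ratio; the ratio of the means mb/ma, controlled
  by \<open>L powr (r - 1)\<close>, enters only to the power 1 - \<kappa>, so that nothing beyond
  \<open>L\<close> is lost at q = r.\<close>

lemma set_nn_integral_ball_le:
  fixes a b t :: real
  assumes a: "0 < a" "a \<le> b" and t: "0 < t" and \<kappa>: "0 < \<kappa>" "\<kappa> \<le> 1"
    and [measurable]: "h \<in> borel_measurable borel"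
  defines "L \<equiv> (b / a) powr real DIM('a)"
  defines "\<Lambda> \<equiv> 2 * L * lower_const powr - (1 - \<kappa>) * (2 powr r * C * L powr (r - 1)) powr (1 - \<kappa>)"
  shows "(\<integral>\<^sup>+x\<in>ball y (b * t). h x \<partial>weighted w)
    \<le> (\<integral>\<^sup>+x\<in>ball y (a * t). ennreal (\<Lambda> * w x powr - \<kappa>) * ball_sup (ball_term \<kappa> h) x \<partial>weighted w)"
proof -
  let ?I = "\<integral>\<^sup>+x\<in>ball y (b * t). h x \<partial>weighted w"
  define va vb wa wb where "va = V y (a * t)" and "vb = V y (b * t)" and "wa = W y (a * t)" and "wb = W y (b * t)"
  have ab: "0 < a * t" "0 < b * t" "a * t \<le> b * t" "1 \<le> b / a" using a t by auto
  have pos: "0 < va" "0 < vb" "0 < wa" "0 < wb"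
    using ab unfolding va_def vb_def wa_def wb_def by (simp_all add: measure_ball_pos measure_ball_weighted_pos)
  have L: "0 < L" using a by (simp add: L_def)
  have \<Lambda>: "0 < \<Lambda>" using L lower_const_pos C_pos by (simp add: \<Lambda>_def)
  have vb: "vb = L * va"
    using measure_ball_scale[of "b / a" "a * t" y] a t by (simp add: va_def vb_def L_def)
  have "wb \<le> 2 powr r * C * (1 / (a / b)) powr (real DIM('a) * r) * wa"
    using mass_scale(1)[of "b * t" "a / b" y] a t by (simp add: wa_def wb_def)
  also have "(1 / (a / b)) powr (real DIM('a) * r) = L powr r"
    by (simp add: L_def powr_powr)
  finally have wb: "wb \<le> 2 powr r * C * L powr r * wa" .
  define ma mb where "ma = wa / va" and "mb = wb / vb"
  have m: "0 < ma" "0 < mb" using pos by (auto simp: ma_def mb_def)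
  have "mb \<le> 2 powr r * C * L powr r * wa / vb"
    unfolding mb_def using wb pos by (intro divide_right_mono) auto
  also have "\<dots> = 2 powr r * C * L powr (r - 1) * ma"
    using L pos by (simp add: vb ma_def powr_diff)
  finally have "mb powr (1 - \<kappa>) \<le> (2 powr r * C * L powr (r - 1) * ma) powr (1 - \<kappa>)"
    using m \<kappa> by (intro powr_mono2) auto
  also have "\<dots> = (2 powr r * C * L powr (r - 1)) powr (1 - \<kappa>) * ma powr (1 - \<kappa>)"
    by (rule powr_mult)
  finally have mb: "mb powr (1 - \<kappa>) \<le> (2 powr r * C * L powr (r - 1)) powr (1 - \<kappa>) * ma powr (1 - \<kappa>)" .
  \<comment> \<open>The identity isolates \<open>mb powr (1 - \<kappa>)\<close>, the only part of
    the mean over the large ball that has to be traded for the mean over the small one; the other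
    part belongs to the ball term.\<close>
  have "1 = 2 * L * mb powr (1 - \<kappa>) * mb powr \<kappa> / (2 * (L * mb))"
    using m L by (simp add: powr_add[symmetric])
  also have "\<dots> \<le> 2 * L * ((2 powr r * C * L powr (r - 1)) powr (1 - \<kappa>) * ma powr (1 - \<kappa>)) * mb powr \<kappa> / (2 * (L * mb))"
    using m L mb by (intro divide_right_mono mult_right_mono mult_left_mono) auto
  also have "\<dots> = \<Lambda> * (mb powr \<kappa> / wb * (lower_const powr (1 - \<kappa>) * ma powr (1 - \<kappa>) * (va / 2)))"
  proof -
    have "L * mb = wb / va" using pos L by (simp add: mb_def vb)
    moreover have "lower_const powr - (1 - \<kappa>) * lower_const powr (1 - \<kappa>) = 1"
      using lower_const_pos by (simp add: powr_add[symmetric])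
    then have "X * lower_const powr - (1 - \<kappa>) * Y * (Z * (lower_const powr (1 - \<kappa>) * U * (va / 2))) = X * Y * Z * U * (va / 2)" for X Y Z U
      by algebra
    ultimately show ?thesis
      unfolding \<Lambda>_def using pos by simp
  qed
  also have "lower_const powr (1 - \<kappa>) * ma powr (1 - \<kappa>) = (lower_const * ma) powr (1 - \<kappa>)"
    by (rule powr_mult[symmetric])
  finally have one: "1 \<le> \<Lambda> * (mb powr \<kappa> / wb * ((lower_const * ma) powr (1 - \<kappa>) * (va / 2)))" .

  let ?E = "typical y (a * t)" and ?T = "ball_term \<kappa> h y (b * t)"
  have T: "?T = ennreal (mb powr \<kappa> / wb) * ?I"
    using pos unfolding ball_term_def mb_def wb_def vb_def emeasure_ball_weighted
    by (simp add: divide_ennreal_def inverse_ennreal ennreal_mult divide_inverse mult_ac)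
  have "?I \<le> ennreal (\<Lambda> * (mb powr \<kappa> / wb * ((lower_const * ma) powr (1 - \<kappa>) * (va / 2)))) * ?I"
    using mult_right_mono[OF ennreal_leI[OF one], of ?I] by simp
  also have "\<dots> = ennreal (\<Lambda> * (lower_const * ma) powr (1 - \<kappa>)) * ?T * ennreal (va / 2)"
  proof -
    have regroup: "ennreal (\<Lambda> * (X * (Y * Z))) * I = ennreal (\<Lambda> * Y) * (ennreal X * I) * ennreal Z"
      if "0 \<le> X" "0 \<le> Y" "0 \<le> Z" for X Y Z I
      using that \<Lambda> by (simp add: ennreal_mult mult_ac)
    show ?thesis unfolding T by (rule regroup) (use pos in auto)
  qed
  also have "\<dots> \<le> ennreal (\<Lambda> * (lower_const * ma) powr (1 - \<kappa>)) * ?T * emeasure lborel ?E"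
  proof (intro mult_left_mono)
    have "emeasure lborel ?E \<noteq> top"
      using emeasure_mono[OF typical_subset[of y "a * t"], of lborel] emeasure_lborel_ball_finite[of y "a * t"]
      by (auto simp: top_unique)
    then show "ennreal (va / 2) \<le> emeasure lborel ?E"
      using measure_typical[OF ab(1), of y] by (simp add: emeasure_eq_ennreal_measure va_def del: ennreal_half)
  qed simp
  also have "\<dots> \<le> (\<integral>\<^sup>+x\<in>?E. ennreal (\<Lambda> * w x powr - \<kappa>) * ball_sup (ball_term \<kappa> h) x * ennreal (w x) \<partial>lborel)"
  proof (rule set_nn_integral_ge_const)
    fix x assume x: "x \<in> ?E"
    then have "x \<in> ball y (a * t)" using typical_subset by blast
    then have xB: "x \<in> ball y (b * t)" using ab by simp
    have power: "\<Lambda> * w x powr - \<kappa> * w x = \<Lambda> * w x powr (1 - \<kappa>)"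
      using w_pos[of x] by (simp add: powr_diff powr_minus_divide)
    have "ennreal (\<Lambda> * w x powr - \<kappa>) * ball_sup (ball_term \<kappa> h) x * ennreal (w x)
      = ennreal (\<Lambda> * w x powr (1 - \<kappa>)) * ball_sup (ball_term \<kappa> h) x"
      unfolding power[symmetric] by (rule ennreal_mult_regroup[OF less_imp_le[OF w_pos]])
    moreover have "ennreal (\<Lambda> * (lower_const * ma) powr (1 - \<kappa>)) * ?T
      \<le> ennreal (\<Lambda> * w x powr (1 - \<kappa>)) * ball_sup (ball_term \<kappa> h) x"
      using x xB \<Lambda> \<kappa> lower_const_pos m
      by (intro mult_mono ball_sup_upper ennreal_leI mult_left_mono powr_mono2)
        (auto simp: typical_def ma_def wa_def va_def)
    ultimately show "ennreal (\<Lambda> * (lower_const * ma) powr (1 - \<kappa>)) * ?T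
      \<le> ennreal (\<Lambda> * w x powr - \<kappa>) * ball_sup (ball_term \<kappa> h) x * ennreal (w x)" by simp
  qed simp
  also have "\<dots> \<le> (\<integral>\<^sup>+x\<in>ball y (a * t). ennreal (\<Lambda> * w x powr - \<kappa>) * ball_sup (ball_term \<kappa> h) x * ennreal (w x) \<partial>lborel)"
    using typical_subset[of y "a * t"] by (intro nn_integral_mono) (auto simp del: mem_ball split: split_indicator)
  also have "\<dots> = (\<integral>\<^sup>+x\<in>ball y (a * t). ennreal (\<Lambda> * w x powr - \<kappa>) * ball_sup (ball_term \<kappa> h) x \<partial>weighted w)"
    by (subst nn_integral_weighted) (auto intro!: nn_integral_cong simp: mult_ac)
  finally show ?thesis .
qed

lemma cone_integral_expand_greater_one:
  assumes q: "1 < q" "q \<le> r"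
  obtains A where "0 < A" "\<And>a b G. 0 < a \<Longrightarrow> a \<le> b \<Longrightarrow> G \<in> borel_measurable borel \<Longrightarrow>
    cone_power (weighted w) q G b
      \<le> ennreal (A * (b / a) powr (real DIM('a) * r)) * cone_power (weighted w) q G a"
proof -
  define p where "p = q / (q - 1)"
  \<comment> \<open>Forced by the change of weight from \<open>\<sigma>\<close> to \<open>w\<close>;
    the condition q \<le> r is what makes it at most 1.\<close>
  define \<kappa> where "\<kappa> = r / (r - 1) / p"
  have p: "1 < p" "p - 1 = 1 / (q - 1)"
    using q by (auto simp: p_def field_simps)
  have \<kappa>: "0 < \<kappa>" "\<kappa> * p = r / (r - 1)"
    using p r by (auto simp: \<kappa>_def)
  have "r / (r - 1) \<le> p" using q r by (simp add: p_def field_simps)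
  then have \<kappa>1: "\<kappa> \<le> 1"
    unfolding \<kappa>_def using p by (subst divide_le_eq_1_pos) auto
  obtain A where A: "0 < A" "\<And>h. h \<in> borel_measurable borel \<Longrightarrow>
    (\<integral>\<^sup>+x. ball_sup (ball_term \<kappa> h) x epowr p \<partial>weighted \<sigma>) \<le> ennreal A * (\<integral>\<^sup>+x. h x epowr p \<partial>weighted w)"
    using nn_integral_ball_term_le[OF p(1) \<kappa>] by blast
  define B where "B = (2 * lower_const powr - (1 - \<kappa>) * (2 powr r * C) powr (1 - \<kappa>)) powr p * A"
  have B: "0 < B" using A lower_const_pos C_pos by (simp add: B_def)
  interpret W: doubling_measure "weighted w" doubling_const by (rule doubling)
  show thesis
  proof (rule that)
    show "0 < 2 * (2 * B) powr (q - 1)" using B by simp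
    fix a b :: real and G :: "'a \<times> real \<Rightarrow> ennreal"
    assume a: "0 < a" "a \<le> b" and G: "G \<in> borel_measurable borel"
    define L where "L = (b / a) powr real DIM('a)"
    have L: "0 < L" using a by (simp add: L_def)
    define \<Lambda> where "\<Lambda> = 2 * L * lower_const powr - (1 - \<kappa>) * (2 powr r * C * L powr (r - 1)) powr (1 - \<kappa>)"
    have \<Lambda>: "0 < \<Lambda>" using L lower_const_pos C_pos by (simp add: \<Lambda>_def)
    have \<Lambda>p: "\<Lambda> powr p * A = B * (L powr r) powr (1 / (q - 1))"
    proof -
      have "\<Lambda> = (2 * lower_const powr - (1 - \<kappa>) * (2 powr r * C) powr (1 - \<kappa>)) * (L powr 1 * L powr ((r - 1) * (1 - \<kappa>)))"
        using L by (simp add: \<Lambda>_def powr_mult powr_powr)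
      also have "L powr 1 * L powr ((r - 1) * (1 - \<kappa>)) = L powr (1 + (r - 1) * (1 - \<kappa>))"
        by (simp only: powr_add)
      finally have "\<Lambda> powr p = (2 * lower_const powr - (1 - \<kappa>) * (2 powr r * C) powr (1 - \<kappa>)) powr p
          * L powr ((1 + (r - 1) * (1 - \<kappa>)) * p)"
        by (simp only: powr_mult powr_powr)
      \<comment> \<open>\<open>L\<close> occurs in \<open>\<Lambda>\<close> with exponent 1 + (r -
        1)(1 - \<kappa>). As \<kappa> p = r', multiplying by p gives r p - r = r / (q - 1),
        independent of \<kappa>; this is what keeps the aperture exponent at n r for all q.\<close>
      also have "(1 + (r - 1) * (1 - \<kappa>)) * p = r * p - (r - 1) * (\<kappa> * p)"
        by (simp add: algebra_simps)
      also have "\<dots> = r * (1 / (q - 1))"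
        unfolding \<kappa> p(2)[symmetric] using r by (simp add: field_simps)
      finally show ?thesis by (simp add: B_def powr_powr)
    qed
    have "cone_power (weighted w) q G b
      \<le> ennreal (2 * (2 * B) powr (q - 1) * L powr r) * cone_power (weighted w) q G a"
    proof (rule cone_integral_le_of_greater_one[OF W.sigma_finite sets_weighted _ q(1) _ _ B G])
      fix h :: "'a \<Rightarrow> ennreal" assume h [measurable]: "h \<in> borel_measurable borel"
      let ?H = "\<lambda>x. ennreal (\<Lambda> * w x powr - \<kappa>) * ball_sup (ball_term \<kappa> h) x"
      show "\<exists>H\<in>borel_measurable borel.
        (\<forall>y t. 0 < t \<longrightarrow> (\<integral>\<^sup>+x\<in>ball y (b * t). h x \<partial>weighted w) \<le> (\<integral>\<^sup>+x\<in>ball y (a * t). H x \<partial>weighted w)) \<and>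
        (\<integral>\<^sup>+x. H x epowr (q / (q - 1)) \<partial>weighted w)
          \<le> ennreal (B * (L powr r) powr (1 / (q - 1))) * (\<integral>\<^sup>+x. h x epowr (q / (q - 1)) \<partial>weighted w)"
      proof (intro bexI[of _ ?H] conjI allI impI)
        show "(\<integral>\<^sup>+x\<in>ball y (b * t). h x \<partial>weighted w) \<le> (\<integral>\<^sup>+x\<in>ball y (a * t). ?H x \<partial>weighted w)" if "0 < t" for y t
          unfolding \<Lambda>_def L_def by (rule set_nn_integral_ball_le[OF a that \<kappa>(1) \<kappa>1 h])
        have "?H x epowr p * ennreal (w x) = ennreal (\<Lambda> powr p) * (ball_sup (ball_term \<kappa> h) x epowr p * ennreal (\<sigma> x))" for x
        proof -
          have "(\<Lambda> * w x powr - \<kappa>) powr p * w x = \<Lambda> powr p * (w x powr - (\<kappa> * p) * w x powr 1)"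
            using w_pos[of x] by (simp add: powr_mult powr_powr)
          also have "w x powr - (\<kappa> * p) * w x powr 1 = w x powr (- (\<kappa> * p) + 1)"
            by (simp only: powr_add)
          also have "- (\<kappa> * p) + 1 = - (1 / (r - 1))"
            unfolding \<kappa> using r by (simp add: field_simps)
          finally have *: "(\<Lambda> * w x powr - \<kappa>) powr p * w x = \<Lambda> powr p * \<sigma> x" .
          have "?H x epowr p * ennreal (w x) = ennreal ((\<Lambda> * w x powr - \<kappa>) powr p * w x) * ball_sup (ball_term \<kappa> h) x epowr p"
          proof -
            have "?H x epowr p = ennreal (\<Lambda> * w x powr - \<kappa>) epowr p * ball_sup (ball_term \<kappa> h) x epowr p"
              using p by (intro epowr_mult) simp
            also have "ennreal (\<Lambda> * w x powr - \<kappa>) epowr p = ennreal ((\<Lambda> * w x powr - \<kappa>) powr p)"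
              using \<Lambda> by (intro epowr_ennreal) simp
            finally show ?thesis
              by (simp only: ennreal_mult_regroup[OF less_imp_le[OF w_pos]])
          qed
          also have "\<dots> = ennreal (\<Lambda> powr p) * (ball_sup (ball_term \<kappa> h) x epowr p * ennreal (\<sigma> x))"
            unfolding * by (simp add: ennreal_mult mult_ac)
          finally show ?thesis .
        qed
        then have "(\<integral>\<^sup>+x. ?H x epowr p \<partial>weighted w)
          = ennreal (\<Lambda> powr p) * (\<integral>\<^sup>+x. ball_sup (ball_term \<kappa> h) x epowr p \<partial>weighted \<sigma>)"
          by (simp add: nn_integral_weighted nn_integral_cmult)
        also have "\<dots> \<le> ennreal (\<Lambda> powr p) * (ennreal A * (\<integral>\<^sup>+x. h x epowr p \<partial>weighted w))"
          by (intro mult_left_mono A h) simp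
        also have "\<dots> = ennreal (\<Lambda> powr p * A) * (\<integral>\<^sup>+x. h x epowr p \<partial>weighted w)"
          using A by (simp add: ennreal_mult mult.assoc)
        finally show "(\<integral>\<^sup>+x. ?H x epowr (q / (q - 1)) \<partial>weighted w)
          \<le> ennreal (B * (L powr r) powr (1 / (q - 1))) * (\<integral>\<^sup>+x. h x epowr (q / (q - 1)) \<partial>weighted w)"
          unfolding \<Lambda>p unfolding p_def .
      qed measurable
    qed (use a L w_fin in auto)
    also have "L powr r = (b / a) powr (real DIM('a) * r)"
      by (simp add: L_def powr_powr)
    finally show "cone_power (weighted w) q G b
      \<le> ennreal (2 * (2 * B) powr (q - 1) * (b / a) powr (real DIM('a) * r)) * cone_power (weighted w) q G a" .
  qed
qed

end

section \<open>Reverse Hoelder weights\<close>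

text \<open>The first summand dominates for x \<le> T, the second for x > T.\<close>

lemma powr_le_linear:
  fixes x :: real
  assumes "0 < x" "0 < T" "0 \<le> \<kappa>" "\<kappa> \<le> 1"
  shows "x powr \<kappa> \<le> T powr \<kappa> + T powr (\<kappa> - 1) * x"
proof (cases "x \<le> T")
  case True
  then have "x powr \<kappa> \<le> T powr \<kappa>" using assms by (intro powr_mono2) auto
  then show ?thesis using assms by (simp add: add_increasing2)
next
  case False
  then have "x powr (\<kappa> - 1) \<le> T powr (\<kappa> - 1)"
    using assms by (intro powr_mono2') auto
  then have "x powr (\<kappa> - 1) * x \<le> T powr (\<kappa> - 1) * x" using assms by simp
  moreover have "x powr (\<kappa> - 1) * x = x powr \<kappa>"
    using assms by (simp add: powr_diff)
  ultimately show ?thesis by (simp add: add_increasing)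
qed

lemma ennreal_divide_mult_ennreal:
  "0 < d \<Longrightarrow> 0 \<le> v \<Longrightarrow> X / ennreal d * ennreal v = X * ennreal (inverse d * v)"
  by (simp add: divide_ennreal_def inverse_ennreal ennreal_mult mult.assoc)

context local_weight
begin

text \<open>Jensen's inequality for a concave power, up to the factor 2:
  \<open>powr_le_linear\<close> is applied with T equal to the mean of \<open>w\<close>.\<close>

lemma nn_integral_powr_ball_le:
  assumes \<rho>: "0 < \<rho>" and \<kappa>: "0 \<le> \<kappa>" "\<kappa> \<le> 1"
  shows "(\<integral>\<^sup>+x\<in>ball y \<rho>. ennreal (w x powr \<kappa>) \<partial>lborel)
    \<le> ennreal (2 * measure lborel (ball y \<rho>) * (measure (weighted w) (ball y \<rho>) / measure lborel (ball y \<rho>)) powr \<kappa>)"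
proof -
  let ?V = "measure lborel (ball y \<rho>)" and ?W = "measure (weighted w) (ball y \<rho>)"
  define m where "m = ?W / ?V"
  have pos: "0 < ?V" "0 < ?W" using \<rho> by (simp_all add: measure_ball_pos measure_ball_weighted_pos)
  then have m: "0 < m" by (simp add: m_def)
  have "(\<integral>\<^sup>+x\<in>ball y \<rho>. ennreal (w x powr \<kappa>) \<partial>lborel)
    \<le> (\<integral>\<^sup>+x. ennreal (m powr \<kappa>) * indicator (ball y \<rho>) x + ennreal (m powr (\<kappa> - 1)) * (ennreal (w x) * indicator (ball y \<rho>) x) \<partial>lborel)"
  proof (rule nn_integral_mono)
    fix x
    have "ennreal (w x powr \<kappa>) \<le> ennreal (m powr \<kappa> + m powr (\<kappa> - 1) * w x)"
      using powr_le_linear[OF w_pos[of x] m \<kappa>] by (rule ennreal_leI)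
    also have "\<dots> = ennreal (m powr \<kappa>) + ennreal (m powr (\<kappa> - 1)) * ennreal (w x)"
      using w_pos[of x] by (simp add: ennreal_mult)
    finally show "ennreal (w x powr \<kappa>) * indicator (ball y \<rho>) x
      \<le> ennreal (m powr \<kappa>) * indicator (ball y \<rho>) x + ennreal (m powr (\<kappa> - 1)) * (ennreal (w x) * indicator (ball y \<rho>) x)"
      by (auto split: split_indicator)
  qed
  also have "\<dots> = ennreal (m powr \<kappa>) * emeasure lborel (ball y \<rho>) + ennreal (m powr (\<kappa> - 1)) * emeasure (weighted w) (ball y \<rho>)"
    by (simp add: nn_integral_add nn_integral_cmult nn_integral_cmult_indicator emeasure_weighted)
  also have "\<dots> = ennreal (m powr \<kappa> * ?V + m powr (\<kappa> - 1) * ?W)"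
    using emeasure_lborel_ball_finite[of y \<rho>]
    by (simp add: emeasure_ball_weighted emeasure_eq_ennreal_measure ennreal_mult ennreal_plus)
  also have "m powr \<kappa> * ?V + m powr (\<kappa> - 1) * ?W = 2 * ?V * m powr \<kappa>"
    using pos m by (simp add: powr_diff) (simp add: m_def)
  finally show ?thesis unfolding m_def .
qed

end

text \<open>The smallness of \<open>w\<close> on thin annuli gives the doubling property.\<close>

lemma (in local_weight) doubling_of_scaling:
  assumes A: "0 < A" and \<delta>: "0 < \<delta>"
    and sub: "\<And>y \<rho> X. 0 < \<rho> \<Longrightarrow> X \<in> sets borel \<Longrightarrow> X \<subseteq> ball y \<rho> \<Longrightarrow>
      measure (weighted w) X \<le> A * (measure lborel X / measure lborel (ball y \<rho>)) powr \<delta> * measure (weighted w) (ball y \<rho>)"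
  obtains D where "doubling_measure (weighted w) D"
proof -
  \<comment> \<open>\<open>\<epsilon>\<close> will be the relative volume of an annulus; it is
    chosen so that the annulus carries at most half of the mass of the ball.\<close>
  define \<epsilon> where "\<epsilon> = min (1 / 2) ((1 / (2 * A)) powr (1 / \<delta>))"
  have \<epsilon>: "0 < \<epsilon>" "\<epsilon> \<le> 1 / 2" using A by (auto simp: \<epsilon>_def)
  have "\<epsilon> powr \<delta> \<le> ((1 / (2 * A)) powr (1 / \<delta>)) powr \<delta>"
    using \<epsilon> \<delta> by (intro powr_mono2) (auto simp: \<epsilon>_def)
  also have "\<dots> = 1 / (2 * A)" using \<delta> A by (simp add: powr_powr)
  finally have \<epsilon>A: "A * \<epsilon> powr \<delta> \<le> 1 / 2" using A by (simp add: field_simps)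
  \<comment> \<open>The inner radius that leaves exactly the portion \<open>\<epsilon>\<close> of
    the volume outside.\<close>
  define \<theta> where "\<theta> = (1 - \<epsilon>) powr (1 / real DIM('a))"
  have \<theta>0: "0 < \<theta>" using \<epsilon> by (simp add: \<theta>_def)
  have "\<theta> < 1 powr (1 / real DIM('a))"
    unfolding \<theta>_def using \<epsilon> by (intro powr_less_mono2) auto
  then have \<theta>1: "\<theta> < 1" by simp
  have \<theta>n: "\<theta> powr real DIM('a) = 1 - \<epsilon>" using \<epsilon> by (simp add: \<theta>_def powr_powr)
  have shrink: "measure (weighted w) (ball y \<rho>) \<le> 2 * measure (weighted w) (ball y (\<theta> * \<rho>))" if \<rho>: "0 < \<rho>" for y \<rho>
  proof -
    let ?W = "\<lambda>X. measure (weighted w) X" and ?V = "\<lambda>X. measure lborel X"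
    have le: "\<theta> * \<rho> \<le> \<rho>" using \<theta>0 \<theta>1 \<rho> by (simp add: mult_left_le_one_le)
    then have subset: "ball y (\<theta> * \<rho>) \<subseteq> ball y \<rho>" by auto
    have Vpos: "0 < ?V (ball y \<rho>)" using \<rho> by (rule measure_ball_pos)
    have "?V (ball y \<rho> - ball y (\<theta> * \<rho>)) = ?V (ball y \<rho>) - ?V (ball y (\<theta> * \<rho>))"
      using subset emeasure_lborel_ball_finite[of y \<rho>] by (intro measure_Diff) auto
    also have "?V (ball y (\<theta> * \<rho>)) = (1 - \<epsilon>) * ?V (ball y \<rho>)"
      using measure_ball_scale[of \<theta> \<rho> y] \<theta>0 \<rho> \<theta>n by simp
    finally have "?V (ball y \<rho> - ball y (\<theta> * \<rho>)) / ?V (ball y \<rho>) = \<epsilon>"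
      using Vpos by (simp add: field_simps)
    then have "?W (ball y \<rho> - ball y (\<theta> * \<rho>)) \<le> A * \<epsilon> powr \<delta> * ?W (ball y \<rho>)"
      using sub[OF \<rho>, of "ball y \<rho> - ball y (\<theta> * \<rho>)" y] by auto
    also have "\<dots> \<le> 1 / 2 * ?W (ball y \<rho>)"
      by (intro mult_right_mono \<epsilon>A) simp
    also have "?W (ball y \<rho> - ball y (\<theta> * \<rho>)) = ?W (ball y \<rho>) - ?W (ball y (\<theta> * \<rho>))"
      using subset w_fin[of y \<rho>] by (intro measure_Diff) auto
    finally show ?thesis by simp
  qed
  have iter: "measure (weighted w) (ball y \<rho>) \<le> 2 ^ k * measure (weighted w) (ball y (\<theta> ^ k * \<rho>))" if "0 < \<rho>" for y \<rho> k
  proof (induction k)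
    case (Suc k)
    note Suc
    also have "2 ^ k * measure (weighted w) (ball y (\<theta> ^ k * \<rho>)) \<le> 2 ^ k * (2 * measure (weighted w) (ball y (\<theta> * (\<theta> ^ k * \<rho>))))"
      using that \<theta>0 by (intro mult_left_mono shrink) auto
    finally show ?case by (simp add: mult_ac)
  qed simp
  \<comment> \<open>After k halvings the radius has shrunk by more than the factor 5, which gives
    the doubling constant \<open>2 ^ k\<close>.\<close>
  obtain k where k: "\<theta> ^ k < 1 / 5"
    using real_arch_pow_inv[of "1 / 5" \<theta>] \<theta>1 by auto
  show thesis
  proof (rule that, rule doubling_measure_weighted)
    fix y :: 'a and \<rho> :: real assume \<rho>: "0 < \<rho>"
    have "measure (weighted w) (ball y (\<theta> ^ k * (5 * \<rho>))) \<le> measure (weighted w) (ball y \<rho>)"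
    proof (rule measure_subset_ball_le)
      show "ball y (\<theta> ^ k * (5 * \<rho>)) \<subseteq> ball y \<rho>"
        using k \<rho> by (intro subset_ball) (simp add: field_simps)
    qed simp
    then show "measure (weighted w) (ball y (5 * \<rho>)) \<le> 2 ^ k * measure (weighted w) (ball y \<rho>)"
      using iter[of "5 * \<rho>" y k] \<rho> by (smt (verit) mult_left_mono zero_le_power)
  qed simp
qed

text \<open>The reverse Hoelder inequality raised to the power \<open>e\<close>, so that
  \<open>C\<close> stands for the e-th power of the usual constant. In the application e =
  s'.\<close>

locale RH_weight = local_weight w for w :: "'a::euclidean_space \<Rightarrow> real" +
  fixes e C :: real
  assumes e: "1 < e" and C_pos: "0 < C"
    and power_fin: "\<And>y \<rho>. emeasure (weighted (\<lambda>x. w x powr e)) (ball y \<rho>) \<noteq> \<infinity>"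
    and RH: "\<And>y \<rho>. 0 < \<rho> \<Longrightarrow> measure (weighted (\<lambda>x. w x powr e)) (ball y \<rho>)
      \<le> C * (measure (weighted w) (ball y \<rho>) / measure lborel (ball y \<rho>)) powr e * measure lborel (ball y \<rho>)"
begin

abbreviation V :: "'a \<Rightarrow> real \<Rightarrow> real" where "V y \<rho> \<equiv> measure lborel (ball y \<rho>)"
abbreviation W :: "'a \<Rightarrow> real \<Rightarrow> real" where "W y \<rho> \<equiv> measure (weighted w) (ball y \<rho>)"
abbreviation we :: "'a \<Rightarrow> real" where "we \<equiv> \<lambda>x. w x powr e"

sublocale power: local_weight we
proof
  show "0 < we x" for x
    using w_pos[of x] by simp
qed (use power_fin in auto)

lemma avg_pos: "0 < \<rho> \<Longrightarrow> 0 < W y \<rho> / V y \<rho>"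
  by (simp add: measure_ball_pos measure_ball_weighted_pos)

text \<open>On the set in question w \<le> \<open>T powr (1 - e) * w powr e\<close>: higher
  integrability limits the mass that sits on large values.\<close>

lemma Chebyshev_high:
  assumes T: "0 < T"
  shows "measure (weighted w) {x \<in> ball y \<rho>. T < w x} \<le> T powr (1 - e) * measure (weighted we) (ball y \<rho>)"
proof -
  let ?X = "{x \<in> ball y \<rho>. T < w x}"
  have [measurable]: "?X \<in> sets borel" by measurable
  have "T powr (e - 1) * measure (weighted w) ?X \<le> measure (weighted we) ?X"
  proof (intro measure_weighted_mono power.subset_ball_fin[of _ y \<rho>])
    show "T powr (e - 1) * w x \<le> we x" if "x \<in> ?X" for x
    proof -
      have "T powr (e - 1) * w x \<le> w x powr (e - 1) * w x"
        using that T e w_pos[of x] by (intro mult_right_mono powr_mono2) auto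
      also have "\<dots> = we x" using w_pos[of x] by (simp add: powr_diff)
      finally show ?thesis .
    qed
  qed auto
  also have "\<dots> \<le> measure (weighted we) (ball y \<rho>)"
    by (rule power.measure_subset_ball_le) auto
  finally have "T powr (1 - e) * (T powr (e - 1) * measure (weighted w) ?X) \<le> T powr (1 - e) * measure (weighted we) (ball y \<rho>)"
    by (intro mult_left_mono) auto
  moreover have "T powr (1 - e) * T powr (e - 1) = 1"
    using T by (simp add: powr_add[symmetric])
  ultimately show ?thesis by (simp add: mult.assoc[symmetric])
qed

lemma Chebyshev_low:
  assumes T: "0 < T"
  shows "measure (weighted w) {x \<in> ball y \<rho>. w x \<le> T} \<le> T * V y \<rho>"
proof -
  let ?X = "{x \<in> ball y \<rho>. w x \<le> T}"
  have [measurable]: "?X \<in> sets borel" by measurable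
  have "1 / T * measure (weighted w) ?X \<le> measure (weighted (\<lambda>x. 1)) ?X"
  proof (intro measure_weighted_mono)
    have "emeasure lborel ?X \<le> emeasure lborel (ball y \<rho>)" by (intro emeasure_mono) auto
    then show "emeasure (weighted (\<lambda>x. 1)) ?X \<noteq> \<infinity>"
      using emeasure_lborel_ball_finite[of y \<rho>] unfolding weighted_one by (auto simp: top_unique)
  qed (use T in auto)
  also have "\<dots> \<le> V y \<rho>"
    unfolding weighted_one using emeasure_lborel_ball_finite[of y \<rho>]
    by (intro measure_mono_fmeasurable) (auto simp: fmeasurable_def)
  finally show ?thesis using T by (simp add: field_simps)
qed

text \<open>Hoelder's inequality combined with \<open>RH\<close>, obtained by splitting
  \<open>X\<close> at a level of \<open>w\<close>. This quantitative absolute continuity yields both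
  doubling and the decay of mass under shrinking.\<close>

lemma measure_le_powr:
  assumes \<rho>: "0 < \<rho>" and [measurable]: "X \<in> sets borel" and X: "X \<subseteq> ball y \<rho>"
  shows "measure (weighted w) X \<le> (1 + C) * (measure lborel X / V y \<rho>) powr (1 - 1 / e) * W y \<rho>"
\<comment> \<open>For a null set \<open>u\<close> would be 0 and the threshold \<open>T\<close>
  would degenerate.\<close>
proof (cases "measure lborel X = 0")
  case True
  have "emeasure lborel X \<noteq> \<infinity>"
    using emeasure_mono[OF X, of lborel] emeasure_lborel_ball_finite[of y \<rho>] by (auto simp: top_unique)
  then have "emeasure lborel X = 0" using True by (simp add: emeasure_eq_ennreal_measure)
  then have "AE x in lborel. x \<notin> X"
    by (subst AE_iff_null_sets[symmetric]) (auto simp: null_sets_def)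
  then have "emeasure (weighted w) X = 0"
    unfolding emeasure_weighted[OF w_meas \<open>X \<in> sets borel\<close>]
    by (subst nn_integral_0_iff_AE) (auto simp: indicator_def)
  then show ?thesis using True by (simp add: measure_def)
next
  case False
  define u where "u = measure lborel X / V y \<rho>"
  define m where "m = W y \<rho> / V y \<rho>"
  \<comment> \<open>The level at which both parts have the same order:
    \<open>T powr (1 - e) * m powr e * V\<close> and \<open>T * u * V\<close> are each
    \<open>u powr (1 - 1 / e)\<close> times the mass of the ball.\<close>
  define T where "T = m * u powr (- 1 / e)"
  have pos: "0 < V y \<rho>" "0 < W y \<rho>" "0 < m" using \<rho> avg_pos[OF \<rho>] by (simp_all add: measure_ball_pos measure_ball_weighted_pos m_def)
  have u: "0 < u" using False pos by (simp add: u_def less_le)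
  have T: "0 < T" using pos u by (simp add: T_def)
  let ?Y = "{x \<in> ball y \<rho>. T < w x}" and ?Z = "{x \<in> X. w x \<le> T}"
  have [measurable]: "?Y \<in> sets borel" "?Z \<in> sets borel" by measurable
  have "measure (weighted w) X \<le> measure (weighted w) (?Y \<union> ?Z)"
  proof (rule measure_mono_fmeasurable)
    have "?Y \<union> ?Z \<subseteq> ball y \<rho>" using X by blast
    from subset_ball_fin[OF this] show "?Y \<union> ?Z \<in> fmeasurable (weighted w)"
      by (simp add: fmeasurable_def less_top[symmetric])
  qed (use X in auto)
  also have "\<dots> \<le> measure (weighted w) ?Y + measure (weighted w) ?Z"
    by (intro measure_Un_le) auto
  also have "measure (weighted w) ?Y \<le> T powr (1 - e) * (C * m powr e * V y \<rho>)"
    using Chebyshev_high[OF T, of y \<rho>] mult_left_mono[OF RH[OF \<rho>, of y], of "T powr (1 - e)"] by (simp add: m_def)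
  also have "\<dots> = C * (m powr (1 - e) * m powr e) * u powr (- 1 / e * (1 - e)) * V y \<rho>"
    using pos u by (simp add: T_def powr_mult powr_powr)
  also have "m powr (1 - e) * m powr e = m" using pos by (simp add: powr_add[symmetric])
  also have "- 1 / e * (1 - e) = 1 - 1 / e" using e by (simp add: field_simps)
  also have "C * m * u powr (1 - 1 / e) * V y \<rho> = C * u powr (1 - 1 / e) * W y \<rho>"
    using pos by (simp add: m_def)
  also have "measure (weighted w) ?Z \<le> u powr (1 - 1 / e) * W y \<rho>"
  proof -
    have "1 / T * measure (weighted w) ?Z \<le> measure (weighted (\<lambda>x. 1)) ?Z"
    proof (intro measure_weighted_mono)
      have "emeasure lborel ?Z \<le> emeasure lborel (ball y \<rho>)" using X by (intro emeasure_mono) auto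
      then show "emeasure (weighted (\<lambda>x. 1)) ?Z \<noteq> \<infinity>"
        using emeasure_lborel_ball_finite[of y \<rho>] unfolding weighted_one by (auto simp: top_unique)
    qed (use T in auto)
    also have "\<dots> \<le> measure lborel X"
    proof (unfold weighted_one, rule measure_mono_fmeasurable)
      show "X \<in> fmeasurable lborel"
        using emeasure_mono[OF X, of lborel] emeasure_lborel_ball_finite[of y \<rho>]
        by (auto simp: fmeasurable_def less_top[symmetric] top_unique)
    qed auto
    also have "\<dots> = u * V y \<rho>" using pos by (simp add: u_def)
    finally have "measure (weighted w) ?Z \<le> T * (u * V y \<rho>)" using T by (simp add: field_simps)
    also have "\<dots> = u powr (- 1 / e) * u powr 1 * W y \<rho>"
      using pos u by (simp add: T_def m_def)
    also have "u powr (- 1 / e) * u powr 1 = u powr (- 1 / e + 1)" by (simp only: powr_add)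
    finally show ?thesis by simp
  qed
  finally show ?thesis unfolding u_def by (simp add: distrib_right)
qed

lemma mass_scale:
  assumes \<rho>: "0 < \<rho>" and \<tau>: "0 < \<tau>" "\<tau> \<le> 1"
  shows "W y (\<tau> * \<rho>) \<le> (1 + C) * \<tau> powr (real DIM('a) * (1 - 1 / e)) * W y \<rho>"
proof -
  have "\<tau> * \<rho> \<le> \<rho>" using \<tau> \<rho> by (simp add: mult_left_le_one_le)
  then have "W y (\<tau> * \<rho>) \<le> (1 + C) * (V y (\<tau> * \<rho>) / V y \<rho>) powr (1 - 1 / e) * W y \<rho>"
    by (intro measure_le_powr \<rho>) auto
  also have "V y (\<tau> * \<rho>) / V y \<rho> = \<tau> powr real DIM('a)"
    using measure_ball_scale[of \<tau> \<rho> y] \<tau> \<rho> measure_ball_pos[OF \<rho>, of y] by simp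
  finally show ?thesis by (simp add: powr_powr)
qed

lemma doubling:
  obtains D where "doubling_measure (weighted w) D"
proof (rule doubling_of_scaling[of "1 + C" "1 - 1 / e"])
  show "0 < 1 + C" "0 < 1 - 1 / e" using e C_pos by auto
qed (auto intro: measure_le_powr that)

text \<open>Jensen's inequality for the power \<open>e\<close>, up to \<open>2 powr e\<close>: the
  points with w \<le> m/2 carry at most half of the mass, and on the others \<open>w powr e\<close>
  controls \<open>w\<close>.\<close>

lemma power_mass_ge:
  assumes \<rho>: "0 < \<rho>"
  shows "(W y \<rho> / V y \<rho>) powr e * V y \<rho> \<le> 2 powr e * measure (weighted we) (ball y \<rho>)"
proof -
  define m where "m = W y \<rho> / V y \<rho>"
  have pos: "0 < V y \<rho>" "0 < W y \<rho>" "0 < m" using \<rho> avg_pos[OF \<rho>] by (simp_all add: measure_ball_pos measure_ball_weighted_pos m_def)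
  let ?X = "{x \<in> ball y \<rho>. m / 2 < w x}" and ?Y = "{x \<in> ball y \<rho>. w x \<le> m / 2}"
  have sets: "?X \<in> sets (weighted w)" "?Y \<in> sets (weighted w)" by measurable
  have "W y \<rho> = measure (weighted w) (?X \<union> ?Y)"
    by (rule arg_cong[of _ _ "measure (weighted w)"]) auto
  also have "\<dots> \<le> measure (weighted w) ?X + measure (weighted w) ?Y"
    by (rule measure_Un_le[OF sets])
  also have "measure (weighted w) ?X \<le> (m / 2) powr (1 - e) * measure (weighted we) (ball y \<rho>)"
    using pos by (intro Chebyshev_high) simp
  also have "measure (weighted w) ?Y \<le> m / 2 * V y \<rho>"
    using pos by (intro Chebyshev_low) simp
  also have "m / 2 * V y \<rho> = W y \<rho> / 2" using pos by (simp add: m_def)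
  finally have "m / 2 * V y \<rho> \<le> (m / 2) powr (1 - e) * measure (weighted we) (ball y \<rho>)"
    using pos by (simp add: m_def)
  then have "(m / 2) powr (e - 1) * (m / 2 * V y \<rho>) \<le> (m / 2) powr (e - 1) * ((m / 2) powr (1 - e) * measure (weighted we) (ball y \<rho>))"
    by (intro mult_left_mono) auto
  also have "\<dots> = measure (weighted we) (ball y \<rho>)"
    using pos by (simp add: mult.assoc[symmetric] powr_add[symmetric])
  also have "(m / 2) powr (e - 1) * (m / 2 * V y \<rho>) = (m / 2) powr e * V y \<rho>"
    using pos by (simp add: powr_diff)
  also have "(m / 2) powr e = m powr e / 2 powr e" by (simp add: powr_divide)
  finally show ?thesis by (simp add: m_def field_simps)
qed

text \<open>By \<open>RH\<close> and \<open>power_mass_ge\<close> the mass of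
  \<open>w powr e\<close> on a ball is comparable to its volume times the e-th power of the mean of
  \<open>w\<close>, and the latter quantity inherits doubling from \<open>w\<close>.\<close>

lemma power_doubling:
  obtains D where "doubling_measure (weighted we) D"
proof -
  obtain D where D: "doubling_measure (weighted w) D" using doubling by blast
  interpret W: doubling_measure "weighted w" D by fact
  let ?n = "real DIM('a)"
  define A where "A = C * (D / 5 powr ?n) powr e * 5 powr ?n * 2 powr e"
  have "measure (weighted we) (ball y (5 * \<rho>)) \<le> A * measure (weighted we) (ball y \<rho>)" if \<rho>: "0 < \<rho>" for y \<rho>
  proof -
    have pos: "0 < V y \<rho>" "0 < W y \<rho>" "0 < V y (5 * \<rho>)" "0 < W y (5 * \<rho>)"
      using \<rho> by (simp_all add: measure_ball_pos measure_ball_weighted_pos)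
    have V5: "V y (5 * \<rho>) = 5 powr ?n * V y \<rho>" using \<rho> measure_ball_scale[of 5 \<rho> y] by simp
    have "W y (5 * \<rho>) \<le> D * W y \<rho>"
      using W.doubling[OF \<rho>, of y] W.D_pos by (simp add: emeasure_ball_weighted ennreal_mult[symmetric])
    then have "W y (5 * \<rho>) / V y (5 * \<rho>) \<le> D * W y \<rho> / V y (5 * \<rho>)"
      using pos by (intro divide_right_mono) auto
    also have "\<dots> = D / 5 powr ?n * (W y \<rho> / V y \<rho>)" unfolding V5 by simp
    finally have "(W y (5 * \<rho>) / V y (5 * \<rho>)) powr e \<le> (D / 5 powr ?n * (W y \<rho> / V y \<rho>)) powr e"
      using pos e by (intro powr_mono2) auto
    also have "\<dots> = (D / 5 powr ?n) powr e * (W y \<rho> / V y \<rho>) powr e" by (rule powr_mult)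
    finally have m: "(W y (5 * \<rho>) / V y (5 * \<rho>)) powr e \<le> (D / 5 powr ?n) powr e * (W y \<rho> / V y \<rho>) powr e" .
    have "measure (weighted we) (ball y (5 * \<rho>)) \<le> C * (W y (5 * \<rho>) / V y (5 * \<rho>)) powr e * V y (5 * \<rho>)"
      using \<rho> by (intro RH) simp
    also have "\<dots> \<le> C * ((D / 5 powr ?n) powr e * (W y \<rho> / V y \<rho>) powr e) * V y (5 * \<rho>)"
      using C_pos pos by (intro mult_right_mono mult_left_mono m) auto
    also have "\<dots> = C * (D / 5 powr ?n) powr e * 5 powr ?n * ((W y \<rho> / V y \<rho>) powr e * V y \<rho>)"
      unfolding V5 by simp
    also have "\<dots> \<le> C * (D / 5 powr ?n) powr e * 5 powr ?n * (2 powr e * measure (weighted we) (ball y \<rho>))"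
      using C_pos by (intro mult_left_mono power_mass_ge \<rho>) auto
    finally show ?thesis by (simp add: A_def mult_ac)
  qed
  moreover have "0 < A" using C_pos W.D_pos by (simp add: A_def)
  ultimately show thesis by (intro that[of A] power.doubling_measure_weighted)
qed

text \<open>Since \<open>w\<close> is comparable to its average \<open>m\<close> on a large part of every ball, the factor
  \<open>m\<^sup>\<kappa>\<close> below is traded for a power of \<open>w\<close> in passing from \<open>w\<close> to the weight \<open>w\<^sup>e\<close>.\<close>

definition harmonic_term :: "real \<Rightarrow> ('a \<Rightarrow> ennreal) \<Rightarrow> 'a \<Rightarrow> real \<Rightarrow> ennreal" where
  "harmonic_term \<kappa> f y \<rho> = ennreal ((W y \<rho> / V y \<rho>) powr \<kappa> * V y \<rho>)
    / (\<integral>\<^sup>+x\<in>ball y \<rho>. inverse (f x) \<partial>weighted w)"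

text \<open>Three parts of the ball are discarded: small \<open>f\<close> (at most 1/2 of the
  \<open>w\<close>-mass), \<open>w\<close> above T m and \<open>w\<close> below m/8 (at most 1/8
  each). At least a quarter of the \<open>w\<close>-mass is left. There w > m/8 converts
  \<open>w\<close>-mass into mass of \<open>w powr e\<close>, while \<open>RH\<close> bounds that
  mass for the whole ball. The constant \<open>T\<close> solves
  \<open>C * T powr (1 - e) = 1 / 8\<close>.\<close>

lemma power_measure_le_good_set:
  fixes f :: "'a \<Rightarrow> ennreal" and l \<kappa> \<rho> :: real
  assumes [measurable]: "f \<in> borel_measurable borel"
    and \<kappa>: "\<kappa> \<le> 1" and \<rho>: "0 < \<rho>" and l: "0 < l" and less: "ennreal l < harmonic_term \<kappa> f y \<rho>"
  defines "T \<equiv> (8 * C) powr (1 / (e - 1))"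
  shows "emeasure (weighted we) (ball y \<rho>) \<le> ennreal (4 * C * 8 powr (e - 1)) *
    emeasure (weighted we) (ball y \<rho> \<inter> {x. ennreal (T powr (\<kappa> - 1) / 2 * l) < f x * ennreal (w x powr (\<kappa> - 1))})" (is "_ \<le> _ * emeasure _ ?G")
proof -
  define m where "m = W y \<rho> / V y \<rho>"
  \<comment> \<open>By \<open>less\<close> the integral of 1/f is at most the \<open>w\<close>-mass
    divided by \<open>l * m powr (1 - \<kappa>)\<close>, so Chebyshev at this level leaves at most
    half of the mass.\<close>
  define \<eta> where "\<eta> = l * m powr (1 - \<kappa>) / 2"
  have pos: "0 < V y \<rho>" "0 < W y \<rho>" "0 < m"
    using \<rho> avg_pos[OF \<rho>] by (simp_all add: measure_ball_pos measure_ball_weighted_pos m_def)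
  have \<eta>: "0 < \<eta>" using l pos by (simp add: \<eta>_def)
  have T: "0 < T" using C_pos by (simp add: T_def)
  let ?J = "\<integral>\<^sup>+x\<in>ball y \<rho>. inverse (f x) \<partial>weighted w"
  obtain j where j: "?J = ennreal j" "0 \<le> j"
    using less unfolding harmonic_term_def by (cases ?J) auto
  have "l * j \<le> m powr \<kappa> * V y \<rho>"
    using less l pos j unfolding harmonic_term_def m_def[symmetric]
    by (cases "j = 0") (auto simp: divide_ennreal ennreal_less_iff field_simps)
  then have "m powr (1 - \<kappa>) / 2 * (l * j) \<le> m powr (1 - \<kappa>) / 2 * (m powr \<kappa> * V y \<rho>)"
    by (intro mult_left_mono) auto
  also have "\<dots> = W y \<rho> / 2"
    using pos by (simp add: mult.assoc[symmetric] powr_add[symmetric]) (simp add: m_def)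
  finally have \<eta>j: "\<eta> * j \<le> W y \<rho> / 2" by (simp add: \<eta>_def mult_ac)

  let ?X1 = "{x \<in> ball y \<rho>. f x \<le> ennreal \<eta>}" and ?X2 = "{x \<in> ball y \<rho>. T * m < w x}"
    and ?X3 = "{x \<in> ball y \<rho>. w x \<le> m / 8}"
  define E where "E = {x \<in> ball y \<rho>. ennreal \<eta> < f x \<and> m / 8 < w x \<and> w x \<le> T * m}"
  have sets [measurable]: "?X1 \<in> sets (weighted w)" "?X2 \<in> sets (weighted w)" "?X3 \<in> sets (weighted w)" "E \<in> sets (weighted w)"
    unfolding E_def by measurable
  have E: "E \<subseteq> ball y \<rho>" by (auto simp: E_def)
  have X1: "measure (weighted w) ?X1 \<le> W y \<rho> / 2"
  proof -
    have "ennreal (1 / \<eta>) * emeasure (weighted w) ?X1 \<le> (\<integral>\<^sup>+x\<in>?X1. inverse (f x) \<partial>weighted w)"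
    proof (rule set_nn_integral_ge_const[OF sets(1)])
      show "ennreal (1 / \<eta>) \<le> inverse (f x)" if "x \<in> ?X1" for x
        using inverse_antimono_ennreal[of "f x" "ennreal \<eta>"] that \<eta> by (simp add: inverse_ennreal divide_inverse)
    qed
    also have "\<dots> \<le> ?J"
      by (intro nn_integral_mono) (auto split: split_indicator)
    also have "emeasure (weighted w) ?X1 = ennreal (measure (weighted w) ?X1)"
    proof (rule emeasure_eq_ennreal_measure)
      have "?X1 \<subseteq> ball y \<rho>" by blast
      from subset_ball_fin[OF this] show "emeasure (weighted w) ?X1 \<noteq> top" by simp
    qed
    finally have "1 / \<eta> * measure (weighted w) ?X1 \<le> j"
      using \<eta> j by (simp add: ennreal_mult[symmetric])
    then have "measure (weighted w) ?X1 \<le> \<eta> * j" using \<eta> by (simp add: field_simps)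
    then show ?thesis using \<eta>j by simp
  qed
  have X2: "measure (weighted w) ?X2 \<le> W y \<rho> / 8"
  proof -
    have "measure (weighted w) ?X2 \<le> (T * m) powr (1 - e) * measure (weighted we) (ball y \<rho>)"
      using T pos by (intro Chebyshev_high) simp
    also have "\<dots> \<le> (T * m) powr (1 - e) * (C * m powr e * V y \<rho>)"
      using RH[OF \<rho>, of y] by (intro mult_left_mono) (auto simp: m_def)
    also have "\<dots> = C * T powr (1 - e) * (m powr (1 - e) * m powr e) * V y \<rho>"
      by (simp add: powr_mult)
    also have "m powr (1 - e) * m powr e = m" using pos by (simp add: powr_add[symmetric])
    also have "T powr (1 - e) = (8 * C) powr (- 1)"
      using e unfolding T_def powr_powr by (intro arg_cong[of _ _ "\<lambda>u. (8 * C) powr u"]) (simp add: field_simps)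
    also have "C * (8 * C) powr (- 1) * m * V y \<rho> = W y \<rho> / 8"
      using C_pos pos by (simp add: powr_minus m_def)
    finally show ?thesis .
  qed
  have X3: "measure (weighted w) ?X3 \<le> W y \<rho> / 8"
    using Chebyshev_low[of "m / 8" y \<rho>] pos by (simp add: m_def)
  have "W y \<rho> = measure (weighted w) (?X1 \<union> (?X2 \<union> (?X3 \<union> E)))"
    by (rule arg_cong[of _ _ "measure (weighted w)"]) (auto simp: E_def)
  also have "\<dots> \<le> measure (weighted w) ?X1 + (measure (weighted w) ?X2 + (measure (weighted w) ?X3 + measure (weighted w) E))"
    by (intro order_trans[OF measure_Un_le] add_left_mono sets sets.Un order_refl)
  finally have WE: "W y \<rho> \<le> 4 * measure (weighted w) E" using X1 X2 X3 by linarith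

  \<comment> \<open>From \<open>w\<close> to \<open>w powr e\<close>: the lower bound for
    \<open>w\<close> on \<open>E\<close> pays for the additional power e - 1.\<close>
  have "(m / 8) powr (e - 1) * measure (weighted w) E \<le> measure (weighted we) E"
  proof (intro measure_weighted_mono power.subset_ball_fin[OF E])
    show "(m / 8) powr (e - 1) * w x \<le> we x" if "x \<in> E" for x
    proof -
      have "(m / 8) powr (e - 1) * w x \<le> w x powr (e - 1) * w x"
        using that pos e w_pos[of x] by (intro mult_right_mono powr_mono2) (auto simp: E_def)
      also have "\<dots> = we x" using w_pos[of x] by (simp add: powr_diff)
      finally show ?thesis .
    qed
  qed (use sets(4) in auto)
  then have "m powr (e - 1) * measure (weighted w) E \<le> 8 powr (e - 1) * measure (weighted we) E"
    by (simp add: powr_divide field_simps)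
  then have "4 * C * (m powr (e - 1) * measure (weighted w) E) \<le> 4 * C * (8 powr (e - 1) * measure (weighted we) E)"
    using C_pos by (intro mult_left_mono) auto
  moreover have "measure (weighted we) (ball y \<rho>) \<le> 4 * C * (m powr (e - 1) * measure (weighted w) E)"
  proof -
    have "measure (weighted we) (ball y \<rho>) \<le> C * m powr e * V y \<rho>"
      using RH[OF \<rho>, of y] by (simp add: m_def)
    also have "\<dots> = C * m powr (e - 1) * W y \<rho>"
      using pos by (simp add: powr_diff) (simp add: m_def)
    also have "\<dots> \<le> C * m powr (e - 1) * (4 * measure (weighted w) E)"
      using C_pos by (intro mult_left_mono WE) auto
    finally show ?thesis by (simp add: mult_ac)
  qed
  ultimately have "measure (weighted we) (ball y \<rho>) \<le> 4 * C * 8 powr (e - 1) * measure (weighted we) E"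
    by (simp add: mult.assoc)
  then have "emeasure (weighted we) (ball y \<rho>) \<le> ennreal (4 * C * 8 powr (e - 1)) * ennreal (measure (weighted we) E)"
    using C_pos by (simp add: power.emeasure_ball_weighted ennreal_mult[symmetric])
  also have "ennreal (measure (weighted we) E) = emeasure (weighted we) E"
    using power.subset_ball_fin[OF E] by (simp add: emeasure_eq_ennreal_measure)
  also have "\<dots> \<le> emeasure (weighted we) ?G"
  proof (rule emeasure_mono)
    show "E \<subseteq> ?G"
    proof
      fix x assume x: "x \<in> E"
      have "T powr (\<kappa> - 1) / 2 * l = (T * m) powr (\<kappa> - 1) * \<eta>"
      proof -
        have "m powr (\<kappa> - 1) * m powr (1 - \<kappa>) = 1"
          using pos by (simp add: powr_add[symmetric])
        then show ?thesis by (simp add: \<eta>_def powr_mult)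
      qed
      then have "ennreal (T powr (\<kappa> - 1) / 2 * l) = ennreal ((T * m) powr (\<kappa> - 1)) * ennreal \<eta>"
        using \<eta> by (simp add: ennreal_mult)
      also have "\<dots> < ennreal ((T * m) powr (\<kappa> - 1)) * f x"
        using x T pos by (intro ennreal_mult_strict_left_mono) (auto simp: E_def)
      also have "\<dots> \<le> ennreal (w x powr (\<kappa> - 1)) * f x"
        using x \<kappa> w_pos[of x] by (intro mult_right_mono ennreal_leI powr_mono2') (auto simp: E_def)
      finally show "x \<in> ?G"
        using x E by (auto simp: mult.commute)
    qed
    have "{x. ennreal (T powr (\<kappa> - 1) / 2 * l) < f x * ennreal (w x powr (\<kappa> - 1))} \<in> sets borel"
      by measurable
    then show "?G \<in> sets (weighted we)"
      by (simp add: sets.Int)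
  qed
  finally show ?thesis by (simp add: mult_left_mono)
qed

lemma nn_integral_harmonic_term_le:
  assumes p: "0 < p" and \<kappa>: "\<kappa> \<le> 1" "(1 - \<kappa>) * p = e - 1"
  obtains A where "0 < A" "\<And>f. f \<in> borel_measurable borel \<Longrightarrow>
    (\<integral>\<^sup>+x. ball_sup (harmonic_term \<kappa> f) x epowr p \<partial>weighted we) \<le> ennreal A * (\<integral>\<^sup>+x. f x epowr p \<partial>weighted w)"
proof -
  obtain D where D: "doubling_measure (weighted we) D" using power_doubling by blast
  interpret P: doubling_measure "weighted we" D by fact
  define c where "c = ((8 * C) powr (1 / (e - 1))) powr (\<kappa> - 1) / 2"
  have c: "0 < c" using C_pos by (simp add: c_def)
  let ?A = "D * (4 * C * 8 powr (e - 1)) * c powr - p"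
  show thesis
  proof (rule that)
    show "0 < ?A" using P.D_pos C_pos c by simp
    fix f :: "'a \<Rightarrow> ennreal" assume f [measurable]: "f \<in> borel_measurable borel"
    \<comment> \<open>Since (1 - \<kappa>) p = e - 1, the p-th power of
      \<open>w powr (\<kappa> - 1)\<close> times \<open>w powr e\<close> is \<open>w\<close>, and
      the norm of \<open>g\<close> is that of \<open>f\<close> with respect to
      \<open>w\<close>.\<close>
    define g where "g = (\<lambda>x. f x * ennreal (w x powr (\<kappa> - 1)))"
    have [measurable]: "g \<in> borel_measurable borel" unfolding g_def by measurable
    have "(\<integral>\<^sup>+x. ball_sup (harmonic_term \<kappa> f) x epowr p \<partial>weighted we) \<le> ennreal ?A * (\<integral>\<^sup>+x. g x epowr p \<partial>weighted we)"
    proof (rule P.nn_integral_ball_sup_le[OF p c])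
      show "emeasure (weighted we) (ball y \<rho>) \<le> ennreal (4 * C * 8 powr (e - 1)) *
          emeasure (weighted we) (ball y \<rho> \<inter> {x. ennreal (c * l) < g x})"
        if "0 < \<rho>" "0 < l" "ennreal l < harmonic_term \<kappa> f y \<rho>" for y \<rho> l
        using power_measure_le_good_set[OF f \<kappa>(1) that] unfolding c_def g_def .
    qed (use C_pos in auto)
    also have "(\<integral>\<^sup>+x. g x epowr p \<partial>weighted we) = (\<integral>\<^sup>+x. f x epowr p \<partial>weighted w)"
    proof -
      have "g x epowr p * ennreal (we x) = f x epowr p * ennreal (w x)" for x
      proof -
        have "w x powr ((\<kappa> - 1) * p) * we x = w x powr ((\<kappa> - 1) * p + e)"
          by (simp only: powr_add)
        also have "(\<kappa> - 1) * p + e = 1"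
          using \<kappa>(2) by (simp add: algebra_simps)
        finally have "w x powr ((\<kappa> - 1) * p) * we x = w x" using w_pos[of x] by simp
        then show ?thesis
          using p by (simp add: g_def epowr_mult epowr_ennreal powr_powr mult.assoc ennreal_mult[symmetric])
      qed
      then show ?thesis by (simp add: nn_integral_weighted)
    qed
    finally show "(\<integral>\<^sup>+x. ball_sup (harmonic_term \<kappa> f) x epowr p \<partial>weighted we) \<le> ennreal ?A * (\<integral>\<^sup>+x. f x epowr p \<partial>weighted w)" .
  qed
qed

text \<open>Pointwise, w/H is at most a multiple of \<open>w powr \<kappa>\<close>, whose integral
  over the small ball is bounded through the mean \<open>ma\<close>; and \<open>ma\<close> exceeds
  \<open>mb\<close> at most by the factor \<open>(1 + C) * (a / b) powr (- (n / e))\<close>. The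
  constant \<open>\<Lambda>\<close> is the one for which the resulting factor is exactly
  \<open>(a / b) powr (n * (1 - 1 / e))\<close>, the mass decay of \<open>w\<close>.\<close>

lemma set_nn_integral_inverse_ball_le:
  fixes a b t :: real
  assumes a: "0 < a" "a \<le> b" and t: "0 < t" and \<kappa>: "0 \<le> \<kappa>" "\<kappa> \<le> 1"
    and [measurable]: "f \<in> borel_measurable borel"
  defines "\<Lambda> \<equiv> 2 * (1 + C) powr \<kappa> * (a / b) powr (real DIM('a) * (1 / e) * (1 - \<kappa>))"
  shows "(\<integral>\<^sup>+x\<in>ball y (a * t). inverse (ennreal (\<Lambda> * w x powr (1 - \<kappa>)) * ball_sup (harmonic_term \<kappa> f) x) \<partial>weighted w)
    \<le> ennreal ((a / b) powr (real DIM('a) * (1 - 1 / e))) * (\<integral>\<^sup>+x\<in>ball y (b * t). inverse (f x) \<partial>weighted w)"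
proof -
  let ?J = "\<integral>\<^sup>+x\<in>ball y (b * t). inverse (f x) \<partial>weighted w"
  define n where "n = real DIM('a)"
  define \<tau> where "\<tau> = a / b"
  define va vb wa wb where "va = V y (a * t)" and "vb = V y (b * t)" and "wa = W y (a * t)" and "wb = W y (b * t)"
  have ab: "0 < a * t" "0 < b * t" "a * t \<le> b * t" using a t by auto
  have \<tau>: "0 < \<tau>" "\<tau> \<le> 1" "\<tau> * (b * t) = a * t" using a by (auto simp: \<tau>_def)
  have pos: "0 < va" "0 < vb" "0 < wa" "0 < wb"
    using ab unfolding va_def vb_def wa_def wb_def by (simp_all add: measure_ball_pos measure_ball_weighted_pos)
  have \<Lambda>: "0 < \<Lambda>" using a C_pos by (simp add: \<Lambda>_def)
  have va: "va = \<tau> powr n * vb"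
    using measure_ball_scale[of \<tau> "b * t" y] \<tau> ab by (simp add: va_def vb_def n_def)
  have wa: "wa \<le> (1 + C) * \<tau> powr (n * (1 - 1 / e)) * wb"
    using mass_scale[OF ab(2) \<tau>(1,2), of y] \<tau> by (simp add: wa_def wb_def n_def)
  define ma mb where "ma = wa / va" and "mb = wb / vb"
  have m: "0 < ma" "0 < mb" using pos by (auto simp: ma_def mb_def)
  have "ma \<le> (1 + C) * \<tau> powr (n * (1 - 1 / e)) * wb / va"
    unfolding ma_def using wa pos by (intro divide_right_mono) auto
  also have "\<dots> = (1 + C) * (\<tau> powr (n * (1 - 1 / e)) / \<tau> powr n) * mb"
    by (simp add: va mb_def)
  also have "\<tau> powr (n * (1 - 1 / e)) / \<tau> powr n = \<tau> powr (- (n * (1 / e)))"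
    by (simp add: powr_diff[symmetric] algebra_simps)
  finally have "ma powr \<kappa> \<le> ((1 + C) * \<tau> powr (- (n * (1 / e))) * mb) powr \<kappa>"
    using m \<kappa> by (intro powr_mono2) auto
  also have "\<dots> = (1 + C) powr \<kappa> * \<tau> powr (- (n * (1 / e)) * \<kappa>) * mb powr \<kappa>"
    by (simp only: powr_mult powr_powr)
  finally have ma: "ma powr \<kappa> \<le> (1 + C) powr \<kappa> * \<tau> powr (- (n * (1 / e)) * \<kappa>) * mb powr \<kappa>" .
  have "2 * va * ma powr \<kappa> / (\<Lambda> * (mb powr \<kappa> * vb))
    \<le> 2 * va * ((1 + C) powr \<kappa> * \<tau> powr (- (n * (1 / e)) * \<kappa>) * mb powr \<kappa>) / (\<Lambda> * (mb powr \<kappa> * vb))"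
    using pos m \<Lambda> by (intro divide_right_mono mult_left_mono ma) auto
  also have "\<dots> = 2 * (1 + C) powr \<kappa> * (\<tau> powr n * \<tau> powr (- (n * (1 / e)) * \<kappa>)) / \<Lambda>"
    using pos m by (simp add: va)
  also have "\<dots> = \<tau> powr n * \<tau> powr (- (n * (1 / e)) * \<kappa>) / \<tau> powr (n * (1 / e) * (1 - \<kappa>))"
    using C_pos by (simp add: \<Lambda>_def n_def \<tau>_def)
  also have "\<dots> = \<tau> powr (n + (- (n * (1 / e)) * \<kappa>) - n * (1 / e) * (1 - \<kappa>))"
    by (simp only: powr_add powr_diff)
  also have "n + (- (n * (1 / e)) * \<kappa>) - n * (1 / e) * (1 - \<kappa>) = n * (1 - 1 / e)"
    by (simp add: algebra_simps diff_divide_distrib)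
  finally have real: "2 * va * ma powr \<kappa> / (\<Lambda> * (mb powr \<kappa> * vb)) \<le> \<tau> powr (n * (1 - 1 / e))" .

  let ?H = "\<lambda>x. ennreal (\<Lambda> * w x powr (1 - \<kappa>)) * ball_sup (harmonic_term \<kappa> f) x"
  \<comment> \<open>Valid on the whole large ball, because that ball takes part in the supremum at
    each of its points; the restriction to the small ball comes only with the integration.\<close>
  have pt: "inverse (?H x) * ennreal (w x) \<le> ?J / ennreal (\<Lambda> * (mb powr \<kappa> * vb)) * ennreal (w x powr \<kappa>)"
    if x: "x \<in> ball y (b * t)" for x
  proof -
    have wx: "0 < w x powr (1 - \<kappa>)" using w_pos[of x] by simp
    have "ennreal (\<Lambda> * w x powr (1 - \<kappa>) * (mb powr \<kappa> * vb)) / ?J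
      = ennreal (\<Lambda> * w x powr (1 - \<kappa>)) * harmonic_term \<kappa> f y (b * t)"
      unfolding harmonic_term_def mb_def wb_def vb_def ennreal_times_divide
      using \<Lambda> by (subst ennreal_mult[symmetric]) auto
    also have "\<dots> \<le> ?H x"
      by (intro mult_left_mono ball_sup_upper x) simp
    finally have "inverse (?H x) \<le> inverse (ennreal (\<Lambda> * w x powr (1 - \<kappa>) * (mb powr \<kappa> * vb)) / ?J)"
      by (rule inverse_antimono_ennreal)
    also have "\<dots> = ?J / ennreal (\<Lambda> * w x powr (1 - \<kappa>) * (mb powr \<kappa> * vb))"
      using wx \<Lambda> m pos by (intro inverse_divide_ennreal) simp
    finally have "inverse (?H x) * ennreal (w x) \<le> ?J / ennreal (\<Lambda> * w x powr (1 - \<kappa>) * (mb powr \<kappa> * vb)) * ennreal (w x)"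
      by (rule mult_right_mono) simp
    also have "\<dots> = ?J * ennreal (inverse (\<Lambda> * w x powr (1 - \<kappa>) * (mb powr \<kappa> * vb)) * w x)"
      using wx \<Lambda> m pos w_pos[of x] by (intro ennreal_divide_mult_ennreal) auto
    also have "inverse (\<Lambda> * w x powr (1 - \<kappa>) * (mb powr \<kappa> * vb)) * w x = inverse (\<Lambda> * (mb powr \<kappa> * vb)) * w x powr \<kappa>"
      using w_pos[of x] by (simp add: powr_diff divide_inverse mult_ac)
    also have "?J * ennreal (inverse (\<Lambda> * (mb powr \<kappa> * vb)) * w x powr \<kappa>) = ?J / ennreal (\<Lambda> * (mb powr \<kappa> * vb)) * ennreal (w x powr \<kappa>)"
      using \<Lambda> m pos by (intro ennreal_divide_mult_ennreal[symmetric]) auto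
    finally show ?thesis .
  qed
  have "(\<integral>\<^sup>+x\<in>ball y (a * t). inverse (?H x) \<partial>weighted w) = (\<integral>\<^sup>+x\<in>ball y (a * t). inverse (?H x) * ennreal (w x) \<partial>lborel)"
    by (subst nn_integral_weighted) (auto intro!: nn_integral_cong simp: mult_ac)
  also have "\<dots> \<le> (\<integral>\<^sup>+x. ?J / ennreal (\<Lambda> * (mb powr \<kappa> * vb)) * (ennreal (w x powr \<kappa>) * indicator (ball y (a * t)) x) \<partial>lborel)"
  proof (rule nn_integral_mono)
    fix x
    show "inverse (?H x) * ennreal (w x) * indicator (ball y (a * t)) x
      \<le> ?J / ennreal (\<Lambda> * (mb powr \<kappa> * vb)) * (ennreal (w x powr \<kappa>) * indicator (ball y (a * t)) x)"
      using pt[of x] ab by (auto split: split_indicator)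
  qed
  also have "\<dots> = ?J / ennreal (\<Lambda> * (mb powr \<kappa> * vb)) * (\<integral>\<^sup>+x\<in>ball y (a * t). ennreal (w x powr \<kappa>) \<partial>lborel)"
    by (rule nn_integral_cmult) measurable
  also have "\<dots> \<le> ?J / ennreal (\<Lambda> * (mb powr \<kappa> * vb)) * ennreal (2 * va * ma powr \<kappa>)"
    unfolding va_def ma_def wa_def by (intro mult_left_mono nn_integral_powr_ball_le ab \<kappa>) simp
  also have "\<dots> = ennreal (2 * va * ma powr \<kappa> / (\<Lambda> * (mb powr \<kappa> * vb))) * ?J"
  proof -
    have d: "0 < \<Lambda> * (mb powr \<kappa> * vb)" using \<Lambda> m pos by simp
    have nn: "0 \<le> 2 * va * ma powr \<kappa>" using pos by simp
    show ?thesis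
      unfolding ennreal_divide_mult_ennreal[OF d nn] by (simp add: divide_inverse mult_ac)
  qed
  also have "\<dots> \<le> ennreal (\<tau> powr (n * (1 - 1 / e))) * ?J"
    by (intro mult_right_mono ennreal_leI real) simp
  finally show ?thesis by (simp add: \<tau>_def n_def)
qed

text \<open>The relation (1 - \<kappa>) p = e - 1 determines \<open>\<kappa>\<close>, and the lower
  bound on q is equivalent to \<kappa> \<ge> 0. With it the p-th power of \<open>\<Lambda>\<close>
  contributes the same factor \<open>K\<close> as the ball inequality, so that both terms of the
  Young splitting have the same size.\<close>

lemma cone_integral_contract_less_one:
  assumes q: "1 - 1 / e \<le> q" "q < 1"
  obtains A where "0 < A" "\<And>a b G. 0 < a \<Longrightarrow> a \<le> b \<Longrightarrow> G \<in> borel_measurable borel \<Longrightarrow>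
    cone_power (weighted w) q G a
      \<le> ennreal (A * (a / b) powr (real DIM('a) * (1 - 1 / e))) * cone_power (weighted w) q G b"
proof -
  define p where "p = q / (1 - q)"
  define \<kappa> where "\<kappa> = 1 - (e - 1) / p"
  have "0 < 1 - 1 / e" using e by simp
  then have q0: "0 < q" using q by linarith
  have p: "0 < p" using q q0 by (simp add: p_def)
  have "e - 1 \<le> p" using q e by (simp add: p_def field_simps)
  then have \<kappa>: "0 \<le> \<kappa>" "\<kappa> \<le> 1" "(1 - \<kappa>) * p = e - 1"
    using p e by (auto simp: \<kappa>_def)
  obtain A where A: "0 < A" "\<And>f. f \<in> borel_measurable borel \<Longrightarrow>
    (\<integral>\<^sup>+x. ball_sup (harmonic_term \<kappa> f) x epowr p \<partial>weighted we) \<le> ennreal A * (\<integral>\<^sup>+x. f x epowr p \<partial>weighted w)"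
    using nn_integral_harmonic_term_le[OF p \<kappa>(2,3)] by blast
  obtain D where "doubling_measure (weighted w) D" using doubling by blast
  then interpret W: doubling_measure "weighted w" D .
  define B where "B = (2 * (1 + C) powr \<kappa>) powr p * A"
  have B: "0 < B" using A C_pos by (simp add: B_def)
  show thesis
  proof (rule that)
    show "0 < 1 + B" using B by simp
    fix a b :: real and G :: "'a \<times> real \<Rightarrow> ennreal"
    assume a: "0 < a" "a \<le> b" and G: "G \<in> borel_measurable borel"
    define K where "K = (a / b) powr (real DIM('a) * (1 - 1 / e))"
    define \<Lambda> where "\<Lambda> = 2 * (1 + C) powr \<kappa> * (a / b) powr (real DIM('a) * (1 / e) * (1 - \<kappa>))"
    have K: "0 < K" using a by (simp add: K_def)
    have \<Lambda>: "0 < \<Lambda>" using a C_pos by (simp add: \<Lambda>_def)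
    have "\<Lambda> powr p = (2 * (1 + C) powr \<kappa>) powr p * (a / b) powr (real DIM('a) * (1 / e) * (1 - \<kappa>) * p)"
      unfolding \<Lambda>_def by (simp only: powr_mult powr_powr)
    \<comment> \<open>The exponent n (e - 1) / e does not depend on q any more.\<close>
    also have "real DIM('a) * (1 / e) * (1 - \<kappa>) * p = real DIM('a) * (1 / e) * (e - 1)"
      by (simp only: mult.assoc \<kappa>(3))
    also have "\<dots> = real DIM('a) * (1 - 1 / e)" using e by (simp add: field_simps)
    finally have \<Lambda>p: "\<Lambda> powr p * A = B * K" by (simp add: B_def K_def)
    show "cone_power (weighted w) q G a
      \<le> ennreal ((1 + B) * (a / b) powr (real DIM('a) * (1 - 1 / e))) * cone_power (weighted w) q G b"
      unfolding K_def[symmetric]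
    proof (rule cone_integral_le_of_less_one[OF W.sigma_finite sets_weighted q0 q(2) a(1) K B G])
      fix f :: "'a \<Rightarrow> ennreal" assume f [measurable]: "f \<in> borel_measurable borel"
      let ?H = "\<lambda>x. ennreal (\<Lambda> * w x powr (1 - \<kappa>)) * ball_sup (harmonic_term \<kappa> f) x"
      show "\<exists>H\<in>borel_measurable borel.
        (\<forall>y t. 0 < t \<longrightarrow> (\<integral>\<^sup>+x\<in>ball y (a * t). inverse (H x) \<partial>weighted w)
          \<le> ennreal K * (\<integral>\<^sup>+x\<in>ball y (b * t). inverse (f x) \<partial>weighted w)) \<and>
        (\<integral>\<^sup>+x. H x epowr (q / (1 - q)) \<partial>weighted w) \<le> ennreal (B * K) * (\<integral>\<^sup>+x. f x epowr (q / (1 - q)) \<partial>weighted w)"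
      proof (intro bexI[of _ ?H] conjI allI impI)
        show "(\<integral>\<^sup>+x\<in>ball y (a * t). inverse (?H x) \<partial>weighted w)
          \<le> ennreal K * (\<integral>\<^sup>+x\<in>ball y (b * t). inverse (f x) \<partial>weighted w)" if "0 < t" for y t
          unfolding K_def \<Lambda>_def by (rule set_nn_integral_inverse_ball_le[OF a that \<kappa>(1,2) f])
        have "?H x epowr p * ennreal (w x) = ennreal (\<Lambda> powr p) * (ball_sup (harmonic_term \<kappa> f) x epowr p * ennreal (we x))" for x
        proof -
          have "(\<Lambda> * w x powr (1 - \<kappa>)) powr p * w x = \<Lambda> powr p * (w x powr ((1 - \<kappa>) * p) * w x powr 1)"
            using w_pos[of x] by (simp add: powr_mult powr_powr)
          also have "w x powr ((1 - \<kappa>) * p) * w x powr 1 = w x powr ((1 - \<kappa>) * p + 1)"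
            by (simp only: powr_add)
          also have "(1 - \<kappa>) * p + 1 = e" unfolding \<kappa> by simp
          finally have *: "(\<Lambda> * w x powr (1 - \<kappa>)) powr p * w x = \<Lambda> powr p * we x" .
          have "?H x epowr p = ennreal (\<Lambda> * w x powr (1 - \<kappa>)) epowr p * ball_sup (harmonic_term \<kappa> f) x epowr p"
            using p by (intro epowr_mult) simp
          also have "ennreal (\<Lambda> * w x powr (1 - \<kappa>)) epowr p = ennreal ((\<Lambda> * w x powr (1 - \<kappa>)) powr p)"
            using \<Lambda> by (intro epowr_ennreal) simp
          finally have "?H x epowr p * ennreal (w x) = ennreal (\<Lambda> powr p * we x) * ball_sup (harmonic_term \<kappa> f) x epowr p"
            by (simp only: ennreal_mult_regroup[OF less_imp_le[OF w_pos]] *)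
          then show ?thesis by (simp add: ennreal_mult mult_ac)
        qed
        then have "(\<integral>\<^sup>+x. ?H x epowr p \<partial>weighted w)
          = ennreal (\<Lambda> powr p) * (\<integral>\<^sup>+x. ball_sup (harmonic_term \<kappa> f) x epowr p \<partial>weighted we)"
          by (simp add: nn_integral_weighted nn_integral_cmult)
        also have "\<dots> \<le> ennreal (\<Lambda> powr p) * (ennreal A * (\<integral>\<^sup>+x. f x epowr p \<partial>weighted w))"
          by (intro mult_left_mono A f) simp
        also have "\<dots> = ennreal (\<Lambda> powr p * A) * (\<integral>\<^sup>+x. f x epowr p \<partial>weighted w)"
          using A by (simp add: ennreal_mult mult.assoc)
        finally show "(\<integral>\<^sup>+x. ?H x epowr (q / (1 - q)) \<partial>weighted w)
          \<le> ennreal (B * K) * (\<integral>\<^sup>+x. f x epowr (q / (1 - q)) \<partial>weighted w)"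
          unfolding \<Lambda>p unfolding p_def .
      qed measurable
    qed
  qed
qed

end

section \<open>Area functions\<close>

text \<open>A single Borel function \<open>G\<close> serves all apertures and all points, since
  changing the integrand on a null set of the half space affects none of the cone integrals.\<close>

lemma cone_representative:
  fixes F :: "(real ^ 'n) \<times> real \<Rightarrow> complex"
  assumes F: "F \<in> borel_measurable (lebesgue_on upper_half_space)"
  obtains G where "G \<in> borel_measurable borel"
    and "\<And>a x. 0 < a \<Longrightarrow> area a F x = cone_integral G a x epowr (1 / 2)"
proof -
  have U: "(upper_half_space :: ((real ^ 'n) \<times> real) set) \<in> sets lebesgue"
  proof -
    have "(upper_half_space :: ((real ^ 'n) \<times> real) set) = {z. 0 < snd z}"
      by (auto simp: upper_half_space_def)
    moreover have "open {z :: (real ^ 'n) \<times> real. 0 < snd z}"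
      by (intro open_Collect_less continuous_intros)
    ultimately show ?thesis by (simp add: borel_open)
  qed
  define F' where "F' = (\<lambda>z. if z \<in> upper_half_space then F z else 0)"
  have [measurable]: "F' \<in> borel_measurable lebesgue"
    unfolding F'_def using F U by (simp add: borel_measurable_if)
  have snd_meas [measurable]: "snd \<in> borel_measurable (lebesgue :: ((real ^ 'n) \<times> real) measure)"
  proof -
    have "(snd :: (real ^ 'n) \<times> real \<Rightarrow> real) \<in> borel_measurable borel"
      by (intro borel_measurable_continuous_onI continuous_intros)
    then show ?thesis by (simp add: measurable_completion)
  qed
  define g where "g = (\<lambda>z. ennreal ((cmod (F' z))\<^sup>2 / snd z ^ (CARD('n) + 1)))"
  have "g \<in> borel_measurable (completion lborel)"
    unfolding g_def by measurable
  then obtain G where G: "G \<in> borel_measurable lborel" and eq: "AE z in lborel. g z = G z"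
    using completion_ex_borel_measurable by blast
  have "area a F x = cone_integral G a x epowr (1 / 2)" if a: "0 < a" for a x
  proof -
    \<comment> \<open>The inequality |x - y| < a t with a > 0 already forces t > 0.\<close>
    have mem: "z \<in> cone a x \<longleftrightarrow> x \<in> ball (fst z) (a * snd z)" for z :: "(real ^ 'n) \<times> real"
    proof -
      have "0 < snd z" if "norm (x - fst z) < a * snd z"
        using that a norm_ge_zero[of "x - fst z"] by (smt (verit) zero_less_mult_pos)
      then show ?thesis
        by (auto simp: cone_def upper_half_space_def case_prod_beta dist_norm norm_minus_commute)
    qed
    have sub: "cone a x \<subseteq> upper_half_space" by (auto simp: cone_def)
    have "(\<integral>\<^sup>+z\<in>cone a x. ennreal ((cmod (F z))\<^sup>2 / snd z ^ (CARD('n) + 1)) \<partial>lebesgue)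
      = (\<integral>\<^sup>+z. g z * indicator (cone a x) z \<partial>lborel)"
      unfolding nn_integral_completion using sub
      by (intro nn_integral_cong) (auto simp: g_def F'_def indicator_def)
    also have "\<dots> = (\<integral>\<^sup>+z. G z * indicator (ball (fst z) (a * snd z)) x \<partial>lborel)"
    proof (rule nn_integral_cong_AE)
      show "AE z in lborel. g z * indicator (cone a x) z = G z * indicator (ball (fst z) (a * snd z)) x"
        using eq by eventually_elim (simp add: indicator_def mem del: mem_ball)
    qed
    finally show ?thesis unfolding area_def cone_integral_def by simp
  qed
  moreover have "G \<in> borel_measurable borel" using G by simp
  ultimately show thesis using that by blast
qed

text \<open>Measurability on the whole space has to be extracted from integrability on compact sets
  before a Borel version can be chosen.\<close>

lemma weight_representative:
  fixes w :: "real ^ 'n \<Rightarrow> real"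
  assumes w: "weight w"
  obtains v where "local_weight v" "AE x in lborel. w x = v x"
proof -
  have int: "w absolutely_integrable_on cball y \<rho>" for y and \<rho> :: real
    using w by (auto simp: weight_def)
  \<comment> \<open>\<open>w\<close> is the pointwise limit of its restrictions to the balls of
    integer radius.\<close>
  have "w \<in> borel_measurable lebesgue"
  proof (rule borel_measurable_LIMSEQ_real)
    fix x :: "real ^ 'n"
    obtain N where N: "norm x < real N" using reals_Archimedean2 by blast
    have "eventually (\<lambda>i. (if x \<in> cball 0 (real i) then w x else 0) = w x) sequentially"
      using eventually_ge_at_top[of N] by eventually_elim (use N in auto)
    then show "(\<lambda>i. if x \<in> cball 0 (real i) then w x else 0) \<longlonglongrightarrow> w x"
      by (rule tendsto_eventually)
  next
    fix i
    have "w \<in> borel_measurable (lebesgue_on (cball 0 (real i)))"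
      using int[of 0 "real i"] by (intro absolutely_integrable_measurable[THEN iffD1, THEN conjunct1]) auto
    then show "(\<lambda>x. if x \<in> cball 0 (real i) then w x else 0) \<in> borel_measurable lebesgue"
      by (rule borel_measurable_if_I) simp
  qed
  then obtain u where u: "u \<in> borel_measurable lborel" "AE x in lborel. w x = u x"
    using completion_ex_borel_measurable_real by blast
  \<comment> \<open>The value 1 is taken on a null set only.\<close>
  define v where "v = (\<lambda>x. if 0 < u x then u x else 1)"
  have [measurable]: "u \<in> borel_measurable borel" using u by simp
  have v [measurable]: "v \<in> borel_measurable borel"
    unfolding v_def by measurable
  have "AE x in lborel. 0 < w x" using w by (auto simp: weight_def AE_completion_iff)
  then have eq: "AE x in lborel. w x = v x"
    using u(2) by eventually_elim (auto simp: v_def)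
  have "local_weight v"
  proof
    fix y :: "real ^ 'n" and \<rho> :: real
    have "(\<integral>\<^sup>+x. ennreal (norm (indicator (cball y \<rho>) x *\<^sub>R w x)) \<partial>lebesgue) < \<infinity>"
      using int[of y \<rho>] unfolding set_integrable_def integrable_iff_bounded by blast
    then have fin: "(\<integral>\<^sup>+x. ennreal (norm (indicator (cball y \<rho>) x *\<^sub>R w x)) \<partial>lborel) < \<infinity>"
      unfolding nn_integral_completion .
    have "emeasure (weighted v) (ball y \<rho>) = (\<integral>\<^sup>+x\<in>ball y \<rho>. ennreal (v x) \<partial>lborel)"
      by (rule emeasure_weighted) measurable
    also have "\<dots> \<le> (\<integral>\<^sup>+x. ennreal (norm (indicator (cball y \<rho>) x *\<^sub>R w x)) \<partial>lborel)"
    proof (rule nn_integral_mono_AE)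
      show "AE x in lborel. ennreal (v x) * indicator (ball y \<rho>) x \<le> ennreal (norm (indicator (cball y \<rho>) x *\<^sub>R w x))"
        using eq by eventually_elim (auto simp: indicator_def intro: ennreal_leI)
    qed
    finally show "emeasure (weighted v) (ball y \<rho>) \<noteq> \<infinity>" using fin by auto
  qed (simp_all add: v_def)
  then show thesis using that eq by blast
qed

section \<open>From averages in the definitions of the classes to the assumptions of the
  locales\<close>

lemma average_eq:
  fixes v :: "real ^ 'n \<Rightarrow> real"
  assumes v [measurable]: "v \<in> borel_measurable borel" and eq: "AE x in lborel. f x = v x"
  shows "average (ball c \<rho>) f = emeasure (weighted v) (ball c \<rho>) / emeasure lborel (ball c \<rho>)"
proof -
  have "(\<integral>\<^sup>+x\<in>ball c \<rho>. ennreal (f x) \<partial>lebesgue) = (\<integral>\<^sup>+x\<in>ball c \<rho>. ennreal (v x) \<partial>lborel)"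
    unfolding nn_integral_completion
    by (rule nn_integral_cong_AE) (use eq in eventually_elim, simp)
  then show ?thesis
    by (simp add: average_def emeasure_weighted)
qed

lemma emeasure_lborel_ball_eq: "emeasure lborel (ball y \<rho>) = ennreal (measure lborel (ball y \<rho>))"
  using emeasure_lborel_ball_finite[of y \<rho>] by (simp add: emeasure_eq_ennreal_measure)

lemma average_weight_eq:
  fixes v :: "real ^ 'n \<Rightarrow> real"
  assumes v: "local_weight v" and \<rho>: "0 < \<rho>" and eq: "AE x in lborel. f x = v x"
  shows "average (ball c \<rho>) f = ennreal (measure (weighted v) (ball c \<rho>) / measure lborel (ball c \<rho>))"
proof -
  interpret local_weight v by fact
  show ?thesis
    using measure_ball_pos[OF \<rho>, of c]
    by (simp add: average_eq[OF w_meas eq] emeasure_ball_weighted emeasure_lborel_ball_eq divide_ennreal)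
qed

text \<open>Local finiteness of the dual weight is not assumed but follows: an infinite dual average
  times the positive average of the weight would exceed every real constant. Passing to
  \<open>max C 1\<close> makes the constant positive.\<close>

lemma Muckenhoupt_Ar_weight:
  fixes w v :: "real ^ 'n \<Rightarrow> real"
  assumes r: "1 < r" and w: "w \<in> Muckenhoupt r" and v: "local_weight v" and eq: "AE x in lborel. w x = v x"
  obtains C where "Ar_weight v r C"
proof -
  interpret local_weight v by fact
  let ?s = "\<lambda>x. v x powr - (1 / (r - 1))"
  obtain C where C: "\<And>c \<rho>. 0 < \<rho> \<Longrightarrow>
    average (ball c \<rho>) w * (average (ball c \<rho>) (\<lambda>x. w x powr (- 1 / (r - 1)))) epowr (r - 1) \<le> ennreal C"
    using w r unfolding Muckenhoupt_def by auto
  have s_meas [measurable]: "?s \<in> borel_measurable borel" by measurable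
  have eq2: "AE x in lborel. w x powr (- 1 / (r - 1)) = ?s x"
    using eq by eventually_elim simp
  have *: "emeasure (weighted ?s) (ball c \<rho>) \<noteq> \<infinity> \<and>
    measure (weighted v) (ball c \<rho>) * measure (weighted ?s) (ball c \<rho>) powr (r - 1) \<le> max C 1 * measure lborel (ball c \<rho>) powr r"
    if \<rho>: "0 < \<rho>" for c \<rho>
  proof -
    define V W where "V = measure lborel (ball c \<rho>)" and "W = measure (weighted v) (ball c \<rho>)"
    have pos: "0 < V" "0 < W"
      using \<rho> by (simp_all add: V_def W_def measure_ball_pos measure_ball_weighted_pos)
    have le: "ennreal (W / V) * (emeasure (weighted ?s) (ball c \<rho>) / ennreal V) epowr (r - 1) \<le> ennreal C"
      using C[OF \<rho>, of c]
      by (simp only: average_weight_eq[OF v \<rho> eq] average_eq[OF s_meas eq2] V_def W_def emeasure_lborel_ball_eq)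
    have fin: "emeasure (weighted ?s) (ball c \<rho>) \<noteq> \<infinity>"
    proof
      assume "emeasure (weighted ?s) (ball c \<rho>) = \<infinity>"
      with le pos show False by (simp add: ennreal_top_divide ennreal_mult_top top_unique)
    qed
    define S where "S = measure (weighted ?s) (ball c \<rho>)"
    have "emeasure (weighted ?s) (ball c \<rho>) = ennreal S"
      unfolding S_def using fin by (simp add: emeasure_eq_ennreal_measure)
    moreover have "0 \<le> S" by (simp add: S_def)
    ultimately have "ennreal (W / V) * ennreal ((S / V) powr (r - 1)) \<le> ennreal C"
      using le pos by (simp add: divide_ennreal epowr_ennreal)
    moreover have "0 \<le> W / V" using pos by simp
    ultimately have "ennreal (W / V * (S / V) powr (r - 1)) \<le> ennreal C"
      by (simp only: ennreal_mult[OF _ powr_ge_zero])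
    also have "\<dots> \<le> ennreal (max C 1)" by (simp add: ennreal_leI)
    finally have "W / V * (S / V) powr (r - 1) \<le> max C 1" by simp
    then have "W / V * (S / V) powr (r - 1) * V powr r \<le> max C 1 * V powr r"
      by (rule mult_right_mono) simp
    also have "W / V * (S / V) powr (r - 1) * V powr r = W * S powr (r - 1)"
      using pos \<open>0 \<le> S\<close> by (simp add: powr_divide powr_diff)
    finally show ?thesis using fin by (simp add: V_def W_def S_def)
  qed
  have "Ar_weight v r (max C 1)"
  proof
    show "emeasure (weighted ?s) (ball y \<rho>) \<noteq> \<infinity>" for y \<rho>
      using *[of \<rho> y] by (cases "0 < \<rho>") (auto simp: not_less ball_empty)
  qed (use r * in auto)
  then show thesis using that by blast
qed

text \<open>The pointwise lower bound for the weight on the large ball is integrated over the small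
  one; the volume ratio gives the power of \<tau>.\<close>

lemma Muckenhoupt_one_mass_scale:
  assumes w: "w \<in> Muckenhoupt 1" and v: "local_weight v" and eq: "AE x in lborel. w x = v x"
  obtains C where "0 < C" "\<And>y \<rho> \<tau>. 0 < \<rho> \<Longrightarrow> 0 < \<tau> \<Longrightarrow> \<tau> \<le> 1 \<Longrightarrow>
    measure (weighted v) (ball y \<rho>) \<le> C * (1 / \<tau>) powr real CARD('n) * measure (weighted v) (ball (y :: real ^ 'n) (\<tau> * \<rho>))"
proof -
  interpret local_weight v by fact
  obtain C where C: "\<And>c \<rho>. 0 < \<rho> \<Longrightarrow>
    AE y in lebesgue. y \<in> ball c \<rho> \<longrightarrow> average (ball c \<rho>) w \<le> ennreal C * ennreal (w y)"
    using w unfolding Muckenhoupt_def by auto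
  show thesis
  proof (rule that)
    show "0 < max C 1" by simp
    fix y :: "real ^ 'n" and \<rho> \<tau> :: real
    assume \<rho>: "0 < \<rho>" and \<tau>: "0 < \<tau>" "\<tau> \<le> 1"
    let ?V = "\<lambda>\<rho>. measure lborel (ball y \<rho>)" and ?W = "\<lambda>\<rho>. measure (weighted v) (ball y \<rho>)"
    have \<tau>\<rho>: "0 < \<tau> * \<rho>" "\<tau> * \<rho> \<le> \<rho>" using \<rho> \<tau> by (auto simp: mult_left_le_one_le)
    have V: "0 < ?V \<rho>" "0 < ?V (\<tau> * \<rho>)" using \<rho> \<tau>\<rho> by (simp_all add: measure_ball_pos)
    have scale: "?V (\<tau> * \<rho>) = \<tau> powr real CARD('n) * ?V \<rho>"
      using measure_ball_scale[of \<tau> \<rho> y] \<tau> \<rho> by simp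
    have "AE x in lborel. x \<in> ball y \<rho> \<longrightarrow> ennreal (?W \<rho> / ?V \<rho>) \<le> ennreal (max C 1) * ennreal (v x)"
      using C[OF \<rho>, of y, unfolded average_weight_eq[OF v \<rho> eq] AE_completion_iff] eq
    proof eventually_elim
      case (elim x)
      have "ennreal C * ennreal (w x) \<le> ennreal (max C 1) * ennreal (w x)"
        by (intro mult_right_mono ennreal_leI) auto
      with elim show ?case by auto
    qed
    then have "AE x in lborel. ennreal (?W \<rho> / ?V \<rho>) * indicator (ball y (\<tau> * \<rho>)) x
      \<le> ennreal (max C 1) * (ennreal (v x) * indicator (ball y (\<tau> * \<rho>)) x)"
      by eventually_elim (use \<tau>\<rho> in \<open>auto simp: indicator_def\<close>)
    then have "(\<integral>\<^sup>+x. ennreal (?W \<rho> / ?V \<rho>) * indicator (ball y (\<tau> * \<rho>)) x \<partial>lborel)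
      \<le> (\<integral>\<^sup>+x. ennreal (max C 1) * (ennreal (v x) * indicator (ball y (\<tau> * \<rho>)) x) \<partial>lborel)"
      by (rule nn_integral_mono_AE)
    then have "ennreal (?W \<rho> / ?V \<rho>) * emeasure lborel (ball y (\<tau> * \<rho>)) \<le> ennreal (max C 1) * emeasure (weighted v) (ball y (\<tau> * \<rho>))"
      by (simp add: nn_integral_cmult nn_integral_cmult_indicator emeasure_weighted)
    then have "?W \<rho> / ?V \<rho> * ?V (\<tau> * \<rho>) \<le> max C 1 * ?W (\<tau> * \<rho>)"
      by (simp add: emeasure_lborel_ball_eq emeasure_ball_weighted ennreal_mult[symmetric])
    then have "?W \<rho> * \<tau> powr real CARD('n) \<le> max C 1 * ?W (\<tau> * \<rho>)"
      using V by (simp add: scale)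
    then show "?W \<rho> \<le> max C 1 * (1 / \<tau>) powr real CARD('n) * ?W (\<tau> * \<rho>)"
      using \<tau> by (simp add: powr_divide field_simps)
  qed
qed

lemma Muckenhoupt_mass_scale:
  assumes r: "1 \<le> r" and w: "w \<in> Muckenhoupt r" and v: "local_weight v" and eq: "AE x in lborel. w x = v x"
  obtains C where "0 < C" "\<And>y \<rho> \<tau>. 0 < \<rho> \<Longrightarrow> 0 < \<tau> \<Longrightarrow> \<tau> \<le> 1 \<Longrightarrow>
    measure (weighted v) (ball y \<rho>) \<le> C * (1 / \<tau>) powr (real CARD('n) * r) * measure (weighted v) (ball (y :: real ^ 'n) (\<tau> * \<rho>))"
proof (cases "r = 1")
  case True
  with Muckenhoupt_one_mass_scale[OF _ v eq] w that show thesis by auto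
next
  case False
  then have r: "1 < r" using r by simp
  obtain C where "Ar_weight v r C" using Muckenhoupt_Ar_weight[OF r w v eq] by blast
  then interpret Ar_weight v r C .
  show thesis
    using that[of "2 powr r * C"] mass_scale(1) C_pos by simp
qed

text \<open>For q \<le> 1 the mass comparison suffices for every r \<ge> 1. For q > 1 the condition
  q \<le> r excludes r = 1, so the dual weight is available.\<close>

lemma Muckenhoupt_cone_integral:
  fixes w :: "real ^ 'n \<Rightarrow> real"
  assumes r: "1 \<le> r" and w: "w \<in> Muckenhoupt r" and v: "local_weight v" and eq: "AE x in lborel. w x = v x"
    and q: "0 < q" "q \<le> r"
  obtains A where "0 < A" "\<And>a b G. 0 < a \<Longrightarrow> a \<le> b \<Longrightarrow> G \<in> borel_measurable borel \<Longrightarrow>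
    cone_power (weighted v) q G b
      \<le> ennreal (A * (b / a) powr (real CARD('n) * r)) * cone_power (weighted v) q G a"
proof (cases "q \<le> 1")
  case True
  interpret local_weight v by fact
  obtain C where C: "0 < C" "\<And>y \<rho> \<tau>. 0 < \<rho> \<Longrightarrow> 0 < \<tau> \<Longrightarrow> \<tau> \<le> 1 \<Longrightarrow>
    measure (weighted v) (ball y \<rho>) \<le> C * (1 / \<tau>) powr (real CARD('n) * r) * measure (weighted v) (ball y (\<tau> * \<rho>))"
    using Muckenhoupt_mass_scale[OF r w v eq] by blast
  let ?D = "C * 5 powr (real CARD('n) * r)"
  interpret D: doubling_measure "weighted v" ?D
  proof (rule doubling_measure_weighted)
    show "measure (weighted v) (ball y (5 * \<rho>)) \<le> ?D * measure (weighted v) (ball y \<rho>)" if "0 < \<rho>" for y \<rho>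
      using C(2)[of "5 * \<rho>" "1 / 5" y] that by simp
  qed (use C in simp)
  let ?B = "1 + 2 * ?D * (1 / 2) powr - (q / (1 - q))"
  show thesis
  proof (rule that)
    show "0 < ?B * C" using C by (intro mult_pos_pos add_pos_nonneg) auto
    fix a b :: real and G :: "(real ^ 'n) \<times> real \<Rightarrow> ennreal"
    assume a: "0 < a" "a \<le> b" and G: "G \<in> borel_measurable borel"
    let ?K = "C * (b / a) powr (real CARD('n) * r)"
    have "cone_power (weighted v) q G b \<le> ennreal (?B * ?K) * cone_power (weighted v) q G a"
    proof (rule D.cone_integral_expand[OF q(1) True a _ G])
      show "emeasure (weighted v) (ball y \<rho>) \<le> ennreal ?K * emeasure (weighted v) (ball y (a / b * \<rho>))" if "0 < \<rho>" for y \<rho>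
        using C(2)[of \<rho> "a / b" y] that a C(1) by (simp add: emeasure_ball_weighted ennreal_mult[symmetric])
    qed (use C a in simp)
    then show "cone_power (weighted v) q G b
      \<le> ennreal (?B * C * (b / a) powr (real CARD('n) * r)) * cone_power (weighted v) q G a"
      by (simp add: mult.assoc)
  qed
next
  case False
  then have r: "1 < r" and q1: "1 < q" using q by auto
  obtain C where "Ar_weight v r C" using Muckenhoupt_Ar_weight[OF r w v eq] by blast
  then interpret Ar_weight v r C .
  show thesis
    using cone_integral_expand_greater_one[OF q1 q(2)] that by (metis DIM_cart DIM_real mult.right_neutral)
qed

text \<open>Local integrability of the power of the weight follows from the inequality itself, whose
  right side is finite.\<close>

lemma reverse_Hoelder_RH_weight:
  fixes w v :: "real ^ 'n \<Rightarrow> real"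
  assumes s: "1 < s" and w: "w \<in> reverse_Hoelder (conjugate_exponent s)"
    and v: "local_weight v" and eq: "AE x in lborel. w x = v x"
  obtains C where "RH_weight v (s / (s - 1)) C"
proof -
  interpret local_weight v by fact
  define e where "e = s / (s - 1)"
  have e: "1 < e" using s by (simp add: e_def field_simps)
  let ?s = "\<lambda>x. v x powr e"
  obtain C where C: "\<And>c \<rho>. 0 < \<rho> \<Longrightarrow>
    (average (ball c \<rho>) (\<lambda>x. w x powr e)) epowr (1 / e) \<le> ennreal C * average (ball c \<rho>) w"
    using w s unfolding reverse_Hoelder_def conjugate_exponent_def e_def by auto
  have s_meas [measurable]: "?s \<in> borel_measurable borel" by measurable
  have eq2: "AE x in lborel. w x powr e = ?s x"
    using eq by eventually_elim simp
  have *: "emeasure (weighted ?s) (ball c \<rho>) \<noteq> \<infinity> \<and>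
    measure (weighted ?s) (ball c \<rho>) \<le> max C 1 powr e *
      (measure (weighted v) (ball c \<rho>) / measure lborel (ball c \<rho>)) powr e * measure lborel (ball c \<rho>)"
    if \<rho>: "0 < \<rho>" for c \<rho>
  proof -
    define V W where "V = measure lborel (ball c \<rho>)" and "W = measure (weighted v) (ball c \<rho>)"
    have pos: "0 < V" "0 < W"
      using \<rho> by (simp_all add: V_def W_def measure_ball_pos measure_ball_weighted_pos)
    have le: "(emeasure (weighted ?s) (ball c \<rho>) / ennreal V) epowr (1 / e) \<le> ennreal C * ennreal (W / V)"
      using C[OF \<rho>, of c]
      by (simp only: average_weight_eq[OF v \<rho> eq] average_eq[OF s_meas eq2] V_def W_def emeasure_lborel_ball_eq)
    have fin: "emeasure (weighted ?s) (ball c \<rho>) \<noteq> \<infinity>"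
    proof
      assume "emeasure (weighted ?s) (ball c \<rho>) = \<infinity>"
      with le pos show False by (simp add: ennreal_top_divide top_unique ennreal_mult_eq_top_iff)
    qed
    define S where "S = measure (weighted ?s) (ball c \<rho>)"
    have S: "emeasure (weighted ?s) (ball c \<rho>) = ennreal S" "0 \<le> S"
      unfolding S_def using fin by (simp_all add: emeasure_eq_ennreal_measure)
    have "ennreal ((S / V) powr (1 / e)) \<le> ennreal C * ennreal (W / V)"
      using le pos S by (simp add: divide_ennreal epowr_ennreal)
    also have "\<dots> \<le> ennreal (max C 1) * ennreal (W / V)"
      by (intro mult_right_mono ennreal_leI) auto
    also have "\<dots> = ennreal (max C 1 * (W / V))"
      using pos by (intro ennreal_mult[symmetric]) auto
    finally have "(S / V) powr (1 / e) \<le> max C 1 * (W / V)"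
      using pos by simp
    then have "((S / V) powr (1 / e)) powr e \<le> (max C 1 * (W / V)) powr e"
      using e by (intro powr_mono2) auto
    then have "S / V \<le> max C 1 powr e * (W / V) powr e"
      using e pos S by (simp add: powr_powr powr_mult[symmetric])
    then have "S \<le> max C 1 powr e * (W / V) powr e * V"
      using pos by (simp add: field_simps)
    then show ?thesis using fin by (simp add: V_def W_def S_def)
  qed
  have "RH_weight v e (max C 1 powr e)"
  proof
    show "emeasure (weighted ?s) (ball y \<rho>) \<noteq> \<infinity>" for y \<rho>
      using *[of \<rho> y] by (cases "0 < \<rho>") (auto simp: not_less ball_empty)
  qed (use e * in auto)
  then show thesis using that unfolding e_def by blast
qed

text \<open>Integration over \<open>X\<close> of the essential bound of the weight by its average.
  The exponent 1 is kept visible to match the hypothesis of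
  \<open>doubling_of_scaling\<close>.\<close>

lemma reverse_Hoelder_infinity_measure_le:
  fixes w v :: "real ^ 'n \<Rightarrow> real"
  assumes w: "w \<in> reverse_Hoelder \<infinity>"
    and v: "local_weight v" and eq: "AE x in lborel. w x = v x"
  obtains A where "0 < A" "\<And>y \<rho> X. 0 < \<rho> \<Longrightarrow> X \<in> sets borel \<Longrightarrow> X \<subseteq> ball y \<rho> \<Longrightarrow>
      measure (weighted v) X \<le> A * (measure lborel X / measure lborel (ball y \<rho>)) powr 1 * measure (weighted v) (ball y \<rho>)"
proof -
  interpret local_weight v by fact
  obtain C where C: "\<And>c \<rho>. 0 < \<rho> \<Longrightarrow>
    AE y in lebesgue. y \<in> ball c \<rho> \<longrightarrow> ennreal (w y) \<le> ennreal C * average (ball c \<rho>) w"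
    using w unfolding reverse_Hoelder_def by auto
  show thesis
  proof (rule that)
    show "0 < max C 1" by simp
    fix y :: "real ^ 'n" and \<rho> :: real and X assume \<rho>: "0 < \<rho>" and X [measurable]: "X \<in> sets borel" and sub: "X \<subseteq> ball y \<rho>"
    define V W where "V = measure lborel (ball y \<rho>)" and "W = measure (weighted v) (ball y \<rho>)"
    have pos: "0 < V" "0 < W"
      using \<rho> by (simp_all add: V_def W_def measure_ball_pos measure_ball_weighted_pos)
    have "AE x in lborel. x \<in> ball y \<rho> \<longrightarrow> ennreal (v x) \<le> ennreal (max C 1) * ennreal (W / V)"
      using C[OF \<rho>, of y, unfolded average_weight_eq[OF v \<rho> eq] AE_completion_iff, folded V_def W_def] eq
    proof eventually_elim
      case (elim x)
      have "ennreal C * ennreal (W / V) \<le> ennreal (max C 1) * ennreal (W / V)"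
        by (intro mult_right_mono ennreal_leI) auto
      with elim show ?case by auto
    qed
    then have ae: "AE x in lborel. x \<in> ball y \<rho> \<longrightarrow> ennreal (v x) \<le> ennreal (max C 1) * ennreal (W / V)" .
    have bound: "ennreal (max C 1 * (W / V)) = ennreal (max C 1) * ennreal (W / V)"
      using pos by (intro ennreal_mult) auto
    have "AE x in lborel. ennreal (v x) * indicator X x \<le> ennreal (max C 1 * (W / V)) * indicator X x"
      unfolding bound using ae by eventually_elim (use sub in \<open>auto simp del: mem_ball split: split_indicator\<close>)
    then have "(\<integral>\<^sup>+x\<in>X. ennreal (v x) \<partial>lborel) \<le> (\<integral>\<^sup>+x. ennreal (max C 1 * (W / V)) * indicator X x \<partial>lborel)"
      by (rule nn_integral_mono_AE)
    then have "emeasure (weighted v) X \<le> ennreal (max C 1 * (W / V)) * emeasure lborel X"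
      by (simp add: nn_integral_cmult_indicator emeasure_weighted)
    moreover have "emeasure lborel X \<noteq> top"
      using emeasure_mono[OF sub, of lborel] emeasure_lborel_ball_finite[of y \<rho>] by (auto simp: top_unique)
    moreover have "emeasure (weighted v) X \<noteq> top"
      using subset_ball_fin[OF sub] by simp
    ultimately have "measure (weighted v) X \<le> max C 1 * (W / V) * measure lborel X"
      using pos by (simp add: emeasure_eq_ennreal_measure ennreal_mult[symmetric])
    then show "measure (weighted v) X \<le> max C 1 * (measure lborel X / V) powr 1 * W"
      using pos by (simp add: mult_ac)
  qed
qed

lemma reverse_Hoelder_mass_scale:
  assumes s: "1 \<le> s" and w: "w \<in> reverse_Hoelder (conjugate_exponent s)"
    and v: "local_weight v" and eq: "AE x in lborel. w x = v x"
  obtains D A where "doubling_measure (weighted v) D" "0 < A" "\<And>y \<rho> \<tau>. 0 < \<rho> \<Longrightarrow> 0 < \<tau> \<Longrightarrow> \<tau> \<le> 1 \<Longrightarrow>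
    measure (weighted v) (ball (y :: real ^ 'n) (\<tau> * \<rho>)) \<le> A * \<tau> powr (real CARD('n) * (1 / s)) * measure (weighted v) (ball y \<rho>)"
proof (cases "s = 1")
  case True
  interpret local_weight v by fact
  have "w \<in> reverse_Hoelder \<infinity>" using w True by (simp add: conjugate_exponent_def)
  from reverse_Hoelder_infinity_measure_le[OF this v eq]
  obtain A where A: "0 < A" "\<And>y \<rho> X. 0 < \<rho> \<Longrightarrow> X \<in> sets borel \<Longrightarrow> X \<subseteq> ball y \<rho> \<Longrightarrow>
      measure (weighted v) X \<le> A * (measure lborel X / measure lborel (ball y \<rho>)) powr 1 * measure (weighted v) (ball y \<rho>)"
    by blast
  obtain D where D: "doubling_measure (weighted v) D"
    using doubling_of_scaling[OF A(1) zero_less_one A(2)] by blast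
  show thesis
  proof (rule that[OF D A(1)])
    fix y :: "real ^ 'n" and \<rho> \<tau> :: real assume \<rho>: "0 < \<rho>" and \<tau>: "0 < \<tau>" "\<tau> \<le> 1"
    have "\<tau> * \<rho> \<le> \<rho>" using \<tau> \<rho> by (simp add: mult_left_le_one_le)
    then have "measure (weighted v) (ball y (\<tau> * \<rho>)) \<le> A * (measure lborel (ball y (\<tau> * \<rho>)) / measure lborel (ball y \<rho>)) powr 1 * measure (weighted v) (ball y \<rho>)"
      by (intro A \<rho>) auto
    also have "measure lborel (ball y (\<tau> * \<rho>)) / measure lborel (ball y \<rho>) = \<tau> powr real CARD('n)"
      using measure_ball_scale[of \<tau> \<rho> y] \<tau> \<rho> measure_ball_pos[OF \<rho>, of y] by simp
    finally show "measure (weighted v) (ball y (\<tau> * \<rho>)) \<le> A * \<tau> powr (real CARD('n) * (1 / s)) * measure (weighted v) (ball y \<rho>)"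
      using True by simp
  qed
next
  case False
  then have s: "1 < s" using s by simp
  obtain C where "RH_weight v (s / (s - 1)) C" using reverse_Hoelder_RH_weight[OF s w v eq] by blast
  then interpret RH_weight v "s / (s - 1)" C .
  obtain D where D: "doubling_measure (weighted v) D" using doubling by blast
  have "1 - 1 / (s / (s - 1)) = 1 / s" using s by (simp add: field_simps)
  then show thesis
    using that[OF D, of "1 + C"] mass_scale C_pos by simp
qed

text \<open>For q \<ge> 1 the decay of mass under shrinking suffices. For q < 1 the condition 1/s
  \<le> q excludes s = 1, so the exponent s' is finite and \<open>w powr e\<close> makes
  sense.\<close>

lemma reverse_Hoelder_cone_integral:
  fixes w :: "real ^ 'n \<Rightarrow> real"
  assumes s: "1 \<le> s" and w: "w \<in> reverse_Hoelder (conjugate_exponent s)"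
    and v: "local_weight v" and eq: "AE x in lborel. w x = v x" and q: "1 / s \<le> q"
  obtains A where "0 < A" "\<And>a b G. 0 < a \<Longrightarrow> a \<le> b \<Longrightarrow> G \<in> borel_measurable borel \<Longrightarrow>
    cone_power (weighted v) q G a
      \<le> ennreal (A * (a / b) powr (real CARD('n) * (1 / s))) * cone_power (weighted v) q G b"
proof (cases "1 \<le> q")
  case True
  interpret local_weight v by fact
  obtain D A where "doubling_measure (weighted v) D" and A: "0 < A" "\<And>y \<rho> \<tau>. 0 < \<rho> \<Longrightarrow> 0 < \<tau> \<Longrightarrow> \<tau> \<le> 1 \<Longrightarrow>
    measure (weighted v) (ball (y :: real ^ 'n) (\<tau> * \<rho>)) \<le> A * \<tau> powr (real CARD('n) * (1 / s)) * measure (weighted v) (ball y \<rho>)"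
    using reverse_Hoelder_mass_scale[OF s w v eq] by blast
  then interpret D: doubling_measure "weighted v" D by simp
  let ?B = "1 + 2 * (4 * D * q * 2 powr (1 / (q - 1))) powr (q - 1)"
  show thesis
  proof (rule that)
    show "0 < ?B * A" using A by (intro mult_pos_pos add_pos_nonneg) auto
    fix a b :: real and G :: "(real ^ 'n) \<times> real \<Rightarrow> ennreal"
    assume a: "0 < a" "a \<le> b" and G: "G \<in> borel_measurable borel"
    let ?K = "A * (a / b) powr (real CARD('n) * (1 / s))"
    have "cone_power (weighted v) q G a \<le> ennreal (?B * ?K) * cone_power (weighted v) q G b"
    proof (rule D.cone_integral_contract[OF True a _ G])
      show "emeasure (weighted v) (ball y (a / b * \<rho>)) \<le> ennreal ?K * emeasure (weighted v) (ball y \<rho>)" if "0 < \<rho>" for y \<rho>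
        using A(2)[of \<rho> "a / b" y] that a A(1) by (simp add: emeasure_ball_weighted ennreal_mult[symmetric])
    qed (use A a in simp)
    then show "cone_power (weighted v) q G a
      \<le> ennreal (?B * A * (a / b) powr (real CARD('n) * (1 / s))) * cone_power (weighted v) q G b"
      by (simp add: mult.assoc)
  qed
next
  case False
  then have q1: "q < 1" by simp
  then have s: "1 < s" using q s by (cases "s = 1") auto
  obtain C where "RH_weight v (s / (s - 1)) C" using reverse_Hoelder_RH_weight[OF s w v eq] by blast
  then interpret RH_weight v "s / (s - 1)" C .
  have se: "1 - 1 / (s / (s - 1)) = 1 / s" using s by (simp add: field_simps)
  show thesis
    using cone_integral_contract_less_one[OF _ q1] q that unfolding se
    by (metis DIM_cart DIM_real mult.right_neutral)
qed

section \<open>Weighted norms of area functions\<close>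

lemma weighted_Lp_norm_area:
  assumes v: "local_weight v" and eq: "AE x in lborel. w x = v x"
    and G: "G \<in> borel_measurable borel" "\<And>x. area a F x = cone_integral G a x epowr (1 / 2)"
  shows "weighted_Lp_norm p w (area a F) = cone_power (weighted v) (p / 2) G a epowr (1 / p)"
proof -
  interpret local_weight v by fact
  note [measurable] = G(1)
  have "(\<integral>\<^sup>+x. area a F x epowr p * ennreal (w x) \<partial>lebesgue)
    = (\<integral>\<^sup>+x. cone_integral G a x epowr (p / 2) * ennreal (v x) \<partial>lborel)"
    unfolding nn_integral_completion
    by (rule nn_integral_cong_AE) (use eq in \<open>eventually_elim, simp add: G(2) epowr_epowr\<close>)
  also have "\<dots> = cone_power (weighted v) (p / 2) G a"
    by (rule nn_integral_weighted[symmetric]) measurable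
  finally show ?thesis by (simp add: weighted_Lp_norm_def)
qed

lemma epowr_le_mult_root:
  assumes le: "X \<le> ennreal (A * k powr c) * Y" and A: "0 < A" and p: "0 < p"
  shows "X epowr (1 / p) \<le> ennreal (A powr (1 / p) * k powr (c / p)) * Y epowr (1 / p)"
proof -
  have "X epowr (1 / p) \<le> (ennreal (A * k powr c) * Y) epowr (1 / p)"
    using p by (intro epowr_mono le) simp
  also have "\<dots> = ennreal ((A * k powr c) powr (1 / p)) * Y epowr (1 / p)"
    using p A by (simp add: epowr_mult epowr_ennreal)
  also have "(A * k powr c) powr (1 / p) = A powr (1 / p) * k powr (c / p)"
    by (simp add: powr_mult powr_powr)
  finally show ?thesis .
qed

theorem proposition3p2:
  shows "(\<forall>(r::real) (w :: real ^ 'n \<Rightarrow> real) (p::real).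
            1 \<le> r \<and> w \<in> Muckenhoupt r \<and> 0 < p \<and> p \<le> 2 * r \<longrightarrow>
            (\<exists>C::real. C > 0 \<and> (\<forall>(\<alpha>::real) (\<beta>::real) (F :: (real ^ 'n) \<times> real \<Rightarrow> complex).
               0 < \<alpha> \<and> \<alpha> \<le> \<beta> \<and> F \<in> borel_measurable (lebesgue_on upper_half_space) \<longrightarrow>
               weighted_Lp_norm p w (area \<beta> F)
                 \<le> ennreal (C * (\<beta> / \<alpha>) powr (real CARD('n) * r / p)) * weighted_Lp_norm p w (area \<alpha> F))))
       \<and> (\<forall>(s::real) (w :: real ^ 'n \<Rightarrow> real) (p::real).
            1 \<le> s \<and> w \<in> reverse_Hoelder (conjugate_exponent s) \<and> 2 / s \<le> p \<longrightarrow>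
            (\<exists>C::real. C > 0 \<and> (\<forall>(\<alpha>::real) (\<beta>::real) (F :: (real ^ 'n) \<times> real \<Rightarrow> complex).
               0 < \<alpha> \<and> \<alpha> \<le> \<beta> \<and> F \<in> borel_measurable (lebesgue_on upper_half_space) \<longrightarrow>
               weighted_Lp_norm p w (area \<alpha> F)
                 \<le> ennreal (C * (\<alpha> / \<beta>) powr (real CARD('n) / (s * p))) * weighted_Lp_norm p w (area \<beta> F))))"
proof (intro conjI allI impI)
  fix r p :: real and w :: "real ^ 'n \<Rightarrow> real"
  assume "1 \<le> r \<and> w \<in> Muckenhoupt r \<and> 0 < p \<and> p \<le> 2 * r"
  then have r: "1 \<le> r" and w: "w \<in> Muckenhoupt r" and p: "0 < p" "p \<le> 2 * r" by auto
  have "weight w" using w by (simp add: Muckenhoupt_def)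
  then obtain v where v: "local_weight v" and eq: "AE x in lborel. w x = v x"
    using weight_representative by blast
  have q: "0 < p / 2" "p / 2 \<le> r" using p by auto
  \<comment> \<open>Fixed before the apertures and \<open>F\<close> are introduced, hence
    independent of them.\<close>
  obtain A where A: "0 < A" "\<And>a b G. 0 < a \<Longrightarrow> a \<le> b \<Longrightarrow> G \<in> borel_measurable borel \<Longrightarrow>
    cone_power (weighted v) (p / 2) G b
      \<le> ennreal (A * (b / a) powr (real CARD('n) * r)) * cone_power (weighted v) (p / 2) G a"
    using Muckenhoupt_cone_integral[OF r w v eq q] by blast
  show "\<exists>C>0. \<forall>\<alpha> \<beta> F. 0 < \<alpha> \<and> \<alpha> \<le> \<beta> \<and> F \<in> borel_measurable (lebesgue_on upper_half_space) \<longrightarrow>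
    weighted_Lp_norm p w (area \<beta> F)
      \<le> ennreal (C * (\<beta> / \<alpha>) powr (real CARD('n) * r / p)) * weighted_Lp_norm p w (area \<alpha> F)"
  \<comment> \<open>The p-th root turns the exponent n r of the integral estimate into n r /
    p.\<close>
  proof (intro exI[of _ "A powr (1 / p)"] conjI allI impI)
    fix a b :: real and F :: "(real ^ 'n) \<times> real \<Rightarrow> complex"
    assume "0 < a \<and> a \<le> b \<and> F \<in> borel_measurable (lebesgue_on upper_half_space)"
    then have a: "0 < a" "a \<le> b" "0 < b" and F: "F \<in> borel_measurable (lebesgue_on upper_half_space)" by auto
    obtain G where G: "G \<in> borel_measurable borel"
      "\<And>a x. 0 < a \<Longrightarrow> area a F x = cone_integral G a x epowr (1 / 2)"
      using cone_representative[OF F] by blast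
    show "weighted_Lp_norm p w (area b F)
      \<le> ennreal (A powr (1 / p) * (b / a) powr (real CARD('n) * r / p)) * weighted_Lp_norm p w (area a F)"
      unfolding weighted_Lp_norm_area[OF v eq G(1) G(2)[OF a(1)]] weighted_Lp_norm_area[OF v eq G(1) G(2)[OF a(3)]]
      by (rule epowr_le_mult_root[OF A(2)[OF a(1,2) G(1)] A(1) p(1)])
  qed (use A in simp)
next
  fix s p :: real and w :: "real ^ 'n \<Rightarrow> real"
  assume "1 \<le> s \<and> w \<in> reverse_Hoelder (conjugate_exponent s) \<and> 2 / s \<le> p"
  then have s: "1 \<le> s" and w: "w \<in> reverse_Hoelder (conjugate_exponent s)" and p: "2 / s \<le> p" by auto
  have "0 < 2 / s" using s by simp
  then have p0: "0 < p" using p by linarith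
  have "weight w" using w by (simp add: reverse_Hoelder_def)
  then obtain v where v: "local_weight v" and eq: "AE x in lborel. w x = v x"
    using weight_representative by blast
  have q: "1 / s \<le> p / 2" using p by simp
  obtain A where A: "0 < A" "\<And>a b G. 0 < a \<Longrightarrow> a \<le> b \<Longrightarrow> G \<in> borel_measurable borel \<Longrightarrow>
    cone_power (weighted v) (p / 2) G a
      \<le> ennreal (A * (a / b) powr (real CARD('n) * (1 / s))) * cone_power (weighted v) (p / 2) G b"
    using reverse_Hoelder_cone_integral[OF s w v eq q] by blast
  show "\<exists>C>0. \<forall>\<alpha> \<beta> F. 0 < \<alpha> \<and> \<alpha> \<le> \<beta> \<and> F \<in> borel_measurable (lebesgue_on upper_half_space) \<longrightarrow>
    weighted_Lp_norm p w (area \<alpha> F)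
      \<le> ennreal (C * (\<alpha> / \<beta>) powr (real CARD('n) / (s * p))) * weighted_Lp_norm p w (area \<beta> F)"
  proof (intro exI[of _ "A powr (1 / p)"] conjI allI impI)
    fix a b :: real and F :: "(real ^ 'n) \<times> real \<Rightarrow> complex"
    assume "0 < a \<and> a \<le> b \<and> F \<in> borel_measurable (lebesgue_on upper_half_space)"
    then have a: "0 < a" "a \<le> b" "0 < b" and F: "F \<in> borel_measurable (lebesgue_on upper_half_space)" by auto
    obtain G where G: "G \<in> borel_measurable borel"
      "\<And>a x. 0 < a \<Longrightarrow> area a F x = cone_integral G a x epowr (1 / 2)"
      using cone_representative[OF F] by blast
    have "real CARD('n) / (s * p) = real CARD('n) * (1 / s) / p" by simp
    then show "weighted_Lp_norm p w (area a F)
      \<le> ennreal (A powr (1 / p) * (a / b) powr (real CARD('n) / (s * p))) * weighted_Lp_norm p w (area b F)"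
      unfolding weighted_Lp_norm_area[OF v eq G(1) G(2)[OF a(1)]] weighted_Lp_norm_area[OF v eq G(1) G(2)[OF a(3)]]
      by (simp only: epowr_le_mult_root[OF A(2)[OF a(1,2) G(1)] A(1) p0])
  qed (use A in simp)
qed

end
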